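(* Let $\vec p\in\mathbb P$ be fixed, let $N\ge 1$ be an integer and let $\mathbb K_N:=\{2\pi|\vec l|/L \mid \vec l\in\mathbb Z^3,\ 1\le|\vec l|\le N\}$. Then the Fourier coefficients $\{a_{\vec l}\}_{1\le|\vec l|\le N}$ and $\{b_{\vec l}\}_{1\le|\vec l|\le N}$ of the source $\vec J=\vec p f+\vec p\times\nabla g$ are uniquely determined by the measurements $\{\vec E(\vec x;k,\vec p)\mid \vec x\in\Gamma_R,\ k\in\mathbb K_N\}$. That is, if $\vec J=\vec p f+\vec p\times\nabla g$ and $\tilde{\vec J}=\vec p\tilde f+\vec p\times\nabla\tilde g$ are two sources satisfying the standing assumptions (with the same $\vec p$), and their radiated electric fields $\vec E(\cdot;k,\vec p)$ and $\tilde{\vec E}(\cdot;k,\vec p)$ agree on $\Gamma_R$ for every $k\in\mathbb K_N$, then $a_{\vec l}=\tilde a_{\vec l}$ and $b_{\vec l}=\tilde b_{\vec l}$ for all $\vec l\in\mathbb Z^3$ with $1\le|\vec l|\le N$.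
   Context: Let $L,R>0$, $V_0=(-L/2,L/2)^3$, $B_R=\{\vec x\in\mathbb R^3: |\vec x|<R\}$, $\Gamma_R=\{|\vec x|=R\}$, with $V_0\subset B_R$. Here $|\cdot|$ is the Euclidean norm and $\hat{\vec x}=\vec x/|\vec x|$. The admissible polarizations are $\mathbb P=\{\vec q\in\mathbb R^3:\ \vec q\times\vec l\ne\vec 0\ \ \forall\,\vec l\in\mathbb Z^3\setminus\{\vec 0\}\}$. Sources: $\vec J\in(L^2(\mathbb R^3))^3$ is independent of $k$, $\operatorname{supp}\vec J\subset V_0$, and $\vec J=\vec p f+\vec p\times\nabla g$ with $f\in L^2(V_0)$, $g\in H^1(V_0)$. With $\phi_{\vec l}(\vec x)=\exp(\mathrm i\frac{2\pi}{L}\vec l\cdot\vec x)$, $\vec l\in\mathbb Z^3$, the Fourier coefficients are $$a_{\vec l}=\frac1{L^3}\int_{V_0}f\,\overline{\phi_{\vec l}}\,d\vec x\ (|\vec l|\ge0),\qquad b_{\vec l}=\frac1{L^3}\int_{V_0}g\,\overline{\phi_{\vec l}}\,d\vec x\ (|\vec l|\ge1).$$ It is a standing assumption that the Fourier series of $g$ may be differentiated term by term (periodic setting), i.e. on $V_0$ $$\vec J=a_{\vec 0}\vec p+\sum_{|\vec l|\ge1}\Big(a_{\vec l}\vec p+\frac{2\pi\mathrm i}{L}b_{\vec l}(\vec p\times\vec l)\Big)\phi_{\vec l}.$$ Field: for $k>0$, $\vec E(\cdot;k,\vec p)$ is the unique solution in $\mathbb R^3$ of $\nabla\times\nabla\times\vec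 E-k^2\vec E=\mathrm i k\vec J$ satisfying the Silver–Müller radiation condition $\lim_{|\vec x|\to\infty}|\vec x|\,\big((\nabla\times\vec E)\times\hat{\vec x}-\mathrm i k\vec E\big)=0$ uniformly in $\hat{\vec x}$. Tildes denote the corresponding objects for $\tilde{\vec J}$. *)

theory Defs
  imports "HOL-Analysis.Analysis"
begin

section \<open>Vectors\<close>

definition rvec :: "int ^ 3 \<Rightarrow> real ^ 3" where
  "rvec l = (\<chi> i. real_of_int (l $ i))"

definition cvec :: "real ^ 3 \<Rightarrow> complex ^ 3" where
  "cvec v = (\<chi> i. complex_of_real (v $ i))"

text \<open>Bilinear (no complex conjugation), like the complex cross product below.\<close>

definition cdot :: "complex ^ 3 \<Rightarrow> complex ^ 3 \<Rightarrow> complex" where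
  "cdot u v = (\<Sum>i\<in>UNIV. u $ i * v $ i)"

definition ccross :: "complex ^ 3 \<Rightarrow> complex ^ 3 \<Rightarrow> complex ^ 3" where
  "ccross u v = vector [u $ 2 * v $ 3 - u $ 3 * v $ 2,
                        u $ 3 * v $ 1 - u $ 1 * v $ 3,
                        u $ 1 * v $ 2 - u $ 2 * v $ 1]"

section \<open>Derivatives and smooth functions\<close>

definition partial :: "3 \<Rightarrow> (real ^ 3 \<Rightarrow> 'b::real_normed_vector) \<Rightarrow> real ^ 3 \<Rightarrow> 'b" where
  "partial i F x = frechet_derivative F (at x) (axis i 1)"

definition curl :: "(real ^ 3 \<Rightarrow> complex ^ 3) \<Rightarrow> real ^ 3 \<Rightarrow> complex ^ 3" where
  "curl F x = vector [partial 2 F x $ 3 - partial 3 F x $ 2,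
                      partial 3 F x $ 1 - partial 1 F x $ 3,
                      partial 1 F x $ 2 - partial 2 F x $ 1]"

text \<open>\<open>Ck_on k U F\<close> is meant for open \<open>U\<close>.\<close>

primrec Ck_on :: "nat \<Rightarrow> (real ^ 3) set \<Rightarrow> (real ^ 3 \<Rightarrow> 'b::real_normed_vector) \<Rightarrow> bool" where
  "Ck_on 0 U F \<longleftrightarrow> continuous_on U F"
| "Ck_on (Suc k) U F \<longleftrightarrow>
     (\<forall>x\<in>U. F differentiable (at x)) \<and> (\<forall>i. Ck_on k U (partial i F))"

definition smooth_on :: "(real ^ 3) set \<Rightarrow> (real ^ 3 \<Rightarrow> 'b::real_normed_vector) \<Rightarrow> bool" where
  "smooth_on U F \<longleftrightarrow> (\<forall>k. Ck_on k U F)"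

definition test_function :: "(real ^ 3) set \<Rightarrow> (real ^ 3 \<Rightarrow> 'b::real_normed_vector) \<Rightarrow> bool" where
  "test_function U \<phi> \<longleftrightarrow> smooth_on UNIV \<phi> \<and>
     compact (closure {x. \<phi> x \<noteq> 0}) \<and> closure {x. \<phi> x \<noteq> 0} \<subseteq> U"

section \<open>Function spaces\<close>

text \<open>
  Elements of $L^2$ and $H^1$ are represented by functions, and all conditions on them
  are insensitive to changes on null sets.
\<close>

definition L2_on :: "(real ^ 3) set \<Rightarrow> (real ^ 3 \<Rightarrow> 'b::euclidean_space) \<Rightarrow> bool" where
  "L2_on S F \<longleftrightarrow> set_borel_measurable lebesgue S F \<and>
     set_integrable lebesgue S (\<lambda>x. (norm (F x))\<^sup>2)"

definition L2_loc :: "(real ^ 3 \<Rightarrow> 'b::euclidean_space) \<Rightarrow> bool" where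
  "L2_loc F \<longleftrightarrow> (\<forall>K. compact K \<longrightarrow> L2_on K F)"

text \<open>Support of an element of $L^2(\mathbb{R}^3)$: the complement of the largest open set
  on which it vanishes almost everywhere.\<close>

definition ess_supp :: "(real ^ 3 \<Rightarrow> 'b::real_normed_vector) \<Rightarrow> (real ^ 3) set" where
  "ess_supp F = - \<Union>{U. open U \<and> (AE x in lebesgue. x \<in> U \<longrightarrow> F x = 0)}"

definition weak_gradient ::
  "(real ^ 3) set \<Rightarrow> (real ^ 3 \<Rightarrow> complex) \<Rightarrow> (real ^ 3 \<Rightarrow> complex ^ 3) \<Rightarrow> bool" where
  "weak_gradient V g G \<longleftrightarrow> L2_on V G \<and>
     (\<forall>\<phi> :: real ^ 3 \<Rightarrow> complex. test_function V \<phi> \<longrightarrow> (\<forall>i.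
        (LINT x:V|lebesgue. g x * partial i \<phi> x) = - (LINT x:V|lebesgue. G x $ i * \<phi> x)))"

definition H1_on :: "(real ^ 3) set \<Rightarrow> (real ^ 3 \<Rightarrow> complex) \<Rightarrow> bool" where
  "H1_on V g \<longleftrightarrow> L2_on V g \<and> (\<exists>G. weak_gradient V g G)"

section \<open>Geometry, Fourier coefficients and polarizations\<close>

definition cube :: "real \<Rightarrow> (real ^ 3) set" where
  "cube L = {x. \<forall>i. - L / 2 < x $ i \<and> x $ i < L / 2}"

definition fourier_basis :: "real \<Rightarrow> int ^ 3 \<Rightarrow> real ^ 3 \<Rightarrow> complex" where
  "fourier_basis L l x = exp (\<i> * of_real (2 * pi / L * (rvec l \<bullet> x)))"

definition fourier_coeff :: "real \<Rightarrow> (real ^ 3 \<Rightarrow> complex) \<Rightarrow> int ^ 3 \<Rightarrow> complex" where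
  "fourier_coeff L h l =
     (1 / of_real (L ^ 3)) * (LINT x:cube L|lebesgue. h x * cnj (fourier_basis L l x))"

definition admissible_polarizations :: "(real ^ 3) set" where
  "admissible_polarizations = {q. \<forall>l :: int ^ 3. l \<noteq> 0 \<longrightarrow> cross3 q (rvec l) \<noteq> 0}"

definition wavenumbers :: "real \<Rightarrow> nat \<Rightarrow> real set" where
  "wavenumbers L N =
     {2 * pi * norm (rvec l) / L | l. 1 \<le> norm (rvec l) \<and> norm (rvec l) \<le> real N}"

section \<open>Sources\<close>

definition source_term ::
  "real \<Rightarrow> real ^ 3 \<Rightarrow> (real ^ 3 \<Rightarrow> complex) \<Rightarrow> (real ^ 3 \<Rightarrow> complex)
   \<Rightarrow> int ^ 3 \<Rightarrow> real ^ 3 \<Rightarrow> complex ^ 3" where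
  "source_term L p f g l x = fourier_basis L l x *s
     (fourier_coeff L f l *s cvec p +
      (2 * of_real pi * \<i> / of_real L * fourier_coeff L g l) *s cvec (cross3 p (rvec l)))"

text \<open>
  The series is understood as an unconditional sum in $L^2(V_0)$, the mode of convergence
  of multiple Fourier series of square integrable functions.
\<close>

definition termwise_expansion ::
  "real \<Rightarrow> real ^ 3 \<Rightarrow> (real ^ 3 \<Rightarrow> complex) \<Rightarrow> (real ^ 3 \<Rightarrow> complex)
   \<Rightarrow> (real ^ 3 \<Rightarrow> complex ^ 3) \<Rightarrow> bool" where
  "termwise_expansion L p f g J \<longleftrightarrow>
     ((\<lambda>S. LINT x:cube L|lebesgue.
         (norm (J x - (fourier_coeff L f 0 *s cvec p + (\<Sum>l\<in>S. source_term L p f g l x))))\<^sup>2)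
       \<longlongrightarrow> 0) (finite_subsets_at_top {l. 1 \<le> norm (rvec l)})"

definition is_source ::
  "real \<Rightarrow> real ^ 3 \<Rightarrow> (real ^ 3 \<Rightarrow> complex) \<Rightarrow> (real ^ 3 \<Rightarrow> complex)
   \<Rightarrow> (real ^ 3 \<Rightarrow> complex ^ 3) \<Rightarrow> bool" where
  "is_source L p f g J \<longleftrightarrow>
     L2_on UNIV J \<and> ess_supp J \<subseteq> cube L \<and>
     L2_on (cube L) f \<and> H1_on (cube L) g \<and>
     (\<exists>G. weak_gradient (cube L) g G \<and>
        (AE x in lebesgue. x \<in> cube L \<longrightarrow> J x = f x *s cvec p + ccross (cvec p) (G x))) \<and>
     termwise_expansion L p f g J"

section \<open>Radiated fields\<close>

text \<open>$\nabla\times\nabla\times E - k^2 E = \mathrm{i} k J$ in the sense of distributions.\<close>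

definition maxwell_weak ::
  "real \<Rightarrow> (real ^ 3 \<Rightarrow> complex ^ 3) \<Rightarrow> (real ^ 3 \<Rightarrow> complex ^ 3) \<Rightarrow> bool" where
  "maxwell_weak k J E \<longleftrightarrow>
     (\<forall>\<phi> :: real ^ 3 \<Rightarrow> complex ^ 3. test_function UNIV \<phi> \<longrightarrow>
        (LINT x|lebesgue. cdot (E x) (curl (curl \<phi>) x - of_real (k\<^sup>2) *s \<phi> x))
          = \<i> * of_real k * (LINT x|lebesgue. cdot (J x) (\<phi> x)))"

text \<open>A limit along \<open>at_infinity\<close> is uniform in the direction of \<open>x\<close>.\<close>

definition silver_mueller :: "real \<Rightarrow> (real ^ 3 \<Rightarrow> complex ^ 3) \<Rightarrow> bool" where
  "silver_mueller k E \<longleftrightarrow>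
     ((\<lambda>x. norm x *\<^sub>R (ccross (curl E x) (cvec (x /\<^sub>R norm x)) - (\<i> * of_real k) *s E x))
       \<longlongrightarrow> 0) at_infinity"

text \<open>
  By elliptic regularity a solution agrees almost everywhere with a function that is smooth
  off the support of \<open>J\<close>. Choosing that representative makes the pointwise values of \<open>E\<close> and
  its curl there, and hence the boundary measurements and the radiation condition, well defined.
\<close>

definition radiated_field ::
  "real \<Rightarrow> (real ^ 3 \<Rightarrow> complex ^ 3) \<Rightarrow> (real ^ 3 \<Rightarrow> complex ^ 3) \<Rightarrow> bool" where
  "radiated_field k J E \<longleftrightarrow>
     L2_loc E \<and> maxwell_weak k J E \<and> smooth_on (- ess_supp J) E \<and> silver_mueller k E"

end

theory Submission
  imports Defs
begin

text \<open>
  Let \<open>W\<close> be the difference of the two fields at a wave number \<open>k\<close>. It vanishes on the sphere of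
  radius \<open>R\<close>, so the energy flux of \<open>W\<close> through every larger sphere vanishes, and the radiation
  condition forces the integral of \<open>|W|\<^sup>2\<close> over the shells \<open>\<rho> \<le> |x| < 3 \<rho>\<close> to be \<open>o(\<rho>)\<close>. Neither
  Rellich's lemma nor unique continuation is needed after that: testing the weak Maxwell equation
  with a cut-off entire solution \<open>\<nabla>u \<times> c\<close>, where \<open>u\<close> solves the Helmholtz equation and decays like
  \<open>1 / |x|\<close> together with its derivatives, the cut-off error tends to zero, and so the difference of
  the sources is orthogonal to \<open>\<nabla>u \<times> c\<close>. Spherical waves with a source at the complex point
  \<open>\<i> t d\<close> are such solutions, and for \<open>t \<rightarrow> \<infinity>\<close> they turn, suitably normalized, into plane waves
  in direction \<open>d\<close>. For \<open>k = 2 \<pi> |l| / L\<close> and \<open>d = - l / |l|\<close> the orthogonality to plane waves says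
  that the components transversal to \<open>l\<close> of the \<open>l\<close>-th Fourier coefficients of the sources agree;
  these components separate \<open>p\<close> from \<open>p \<times> l\<close>.
\<close>

section \<open>Calculus of partial derivatives\<close>

text \<open>The obstacle is a count of powers. A cut-off at radius rho makes an error of size
  O(1/rho) times \<open>u\<close> on a shell of volume O(rho^3). For a plane wave this error has L2
  norm O(rho^(1/2)), and against a field of L2 norm o(rho^(1/2)) the pairing is only o(rho); the
  decay 1/|x| of \<open>u\<close> gains exactly the missing power. Hence plane waves enter only as
  limits, after the orthogonality is established. Fields grad u x c are divergence free, so the
  Maxwell operator acts on them as the Helmholtz operator on \<open>u\<close>. No surface integrals
  occur: the flux identity is integrated against the weight rho^2 - |x|^2, which vanishes on the
  outer sphere, while the field vanishes on the inner one. Every divergence theorem reduces to one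
  fact: a directional derivative of a compactly supported Lipschitz function that is differentiable
  off finitely many spheres has integral zero. The cross product with \<open>d\<close> leaves only
  the part of the source transversal to \<open>d\<close>. The transversal plane is spanned by p x l
  and the projection of p, which are independent exactly when p x l is nonzero.\<close>

lemma partial_eqI:
  assumes "(F has_derivative D) (at x)"
  shows "partial i F x = D (axis i 1)"
  using frechet_derivative_at[OF assms] by (simp add: partial_def)

lemma partial_cong_open:
  assumes "open U" "x \<in> U" "\<And>y. y \<in> U \<Longrightarrow> F y = G y"
  shows "partial i F x = partial i G x"
proof -
  have "(F has_derivative D) (at x) \<longleftrightarrow> (G has_derivative D) (at x)" for D
    using has_derivative_transform_within_open[OF _ assms(1,2)] assms(3) by metis
  then show ?thesis by (simp add: partial_def frechet_derivative_def)
qed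

lemma differentiable_cong_open:
  assumes "open U" "x \<in> U" "\<And>y. y \<in> U \<Longrightarrow> F y = G y" "F differentiable (at x)"
  shows "G differentiable (at x)"
  using assms unfolding differentiable_def
  by (meson has_derivative_transform_within_open)

lemma has_derivative_partial_sum:
  fixes F :: "real ^ 3 \<Rightarrow> 'b::real_normed_vector"
  assumes "F differentiable (at x)"
  shows "(F has_derivative (\<lambda>v. \<Sum>i\<in>UNIV. v $ i *\<^sub>R partial i F x)) (at x)"
proof -
  obtain D where D: "(F has_derivative D) (at x)" using assms by (auto simp: differentiable_def)
  have lin: "linear D" using D has_derivative_linear by blast
  have "D v = (\<Sum>i\<in>UNIV. v $ i *\<^sub>R partial i F x)" for v
  proof -
    have "D v = D (\<Sum>i\<in>UNIV. v $ i *\<^sub>R axis i 1)"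
      using basis_expansion[of v] by (simp add: scalar_mult_eq_scaleR)
    also have "\<dots> = (\<Sum>i\<in>UNIV. v $ i *\<^sub>R D (axis i 1))"
      using lin by (simp add: linear_sum linear_scale)
    finally show ?thesis using partial_eqI[OF D] by simp
  qed
  then have "D = (\<lambda>v. \<Sum>i\<in>UNIV. v $ i *\<^sub>R partial i F x)" by blast
  then show ?thesis using D by simp
qed

lemma partial_const [simp]: "partial i (\<lambda>x. c) x = 0"
  using partial_eqI[OF has_derivative_const, of i c x] by simp

lemma partial_add:
  assumes "F differentiable (at x)" "G differentiable (at x)"
  shows "partial i (\<lambda>y. F y + G y) x = partial i F x + partial i G x"
  using partial_eqI[OF has_derivative_add[OF assms[unfolded frechet_derivative_works]]]
  by (simp add: partial_def)

lemma partial_diff: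
  assumes "F differentiable (at x)" "G differentiable (at x)"
  shows "partial i (\<lambda>y. F y - G y) x = partial i F x - partial i G x"
  using partial_eqI[OF has_derivative_diff[OF assms[unfolded frechet_derivative_works]]]
  by (simp add: partial_def)

lemma partial_bounded_linear:
  assumes "bounded_linear T" "F differentiable (at x)"
  shows "partial i (\<lambda>y. T (F y)) x = T (partial i F x)"
  using partial_eqI[OF bounded_linear.has_derivative[OF assms(1)
      assms(2)[unfolded frechet_derivative_works]]]
  by (simp add: partial_def)

lemma partial_bilinear:
  assumes "bounded_bilinear P" "F differentiable (at x)" "G differentiable (at x)"
  shows "partial i (\<lambda>y. P (F y) (G y)) x = P (F x) (partial i G x) + P (partial i F x) (G x)"
  using partial_eqI[OF bounded_bilinear.FDERIV[OF assms(1)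
      assms(2,3)[unfolded frechet_derivative_works]]]
  by (simp add: partial_def)

lemmas partial_mult = partial_bilinear[OF bounded_bilinear_mult]

lemma partial_sum:
  assumes "\<And>j. j \<in> I \<Longrightarrow> F j differentiable (at x)"
  shows "partial i (\<lambda>y. \<Sum>j\<in>I. F j y) x = (\<Sum>j\<in>I. partial i (F j) x)"
proof -
  have "((\<lambda>y. \<Sum>j\<in>I. F j y) has_derivative
      (\<lambda>v. \<Sum>j\<in>I. frechet_derivative (F j) (at x) v)) (at x)"
    using assms by (intro has_derivative_sum) (auto simp: frechet_derivative_works)
  from partial_eqI[OF this] show ?thesis by (simp add: partial_def)
qed

lemma differentiable_bilinear:
  assumes "bounded_bilinear P" "F differentiable (at x)" "G differentiable (at x)"
  shows "(\<lambda>y. P (F y) (G y)) differentiable (at x)"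
  using bounded_bilinear.FDERIV[OF assms(1) assms(2,3)[unfolded frechet_derivative_works]]
  by (auto simp: differentiable_def)

lemma differentiable_bounded_linear:
  assumes "bounded_linear T" "F differentiable (at x)"
  shows "(\<lambda>y. T (F y)) differentiable (at x)"
  using bounded_linear.has_derivative[OF assms(1) assms(2)[unfolded frechet_derivative_works]]
  by (auto simp: differentiable_def)

text \<open>The derivative of \<open>h\<close> is a multiplication in the field, so one chain rule
  serves both real profiles and holomorphic functions of a complex-valued phase.\<close>

lemma partial_compose_field:
  fixes h :: "'c::real_normed_field \<Rightarrow> 'c"
  assumes "(h has_field_derivative h') (at (q x))" "q differentiable (at x)"
  shows "partial i (\<lambda>y. h (q y)) x = h' * partial i q x"
    and "(\<lambda>y. h (q y)) differentiable (at x)"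
proof -
  have "((\<lambda>y. h (q y)) has_derivative (\<lambda>v. h' * frechet_derivative q (at x) v)) (at x)"
    using has_derivative_compose[OF assms(2)[unfolded frechet_derivative_works]
        assms(1)[unfolded has_field_derivative_def]] .
  then show "partial i (\<lambda>y. h (q y)) x = h' * partial i q x"
    "(\<lambda>y. h (q y)) differentiable (at x)"
    by (auto simp: partial_def differentiable_def dest: partial_eqI[where i=i])
qed

section \<open>Differentiability classes and their closure properties\<close>

lemma Ck_on_cong:
  assumes "open U"
  shows "(\<And>x. x \<in> U \<Longrightarrow> F x = G x) \<Longrightarrow> Ck_on k U F \<Longrightarrow> Ck_on k U G"
proof (induction k arbitrary: F G)
  case 0
  then show ?case by (auto cong: continuous_on_cong)
next
  case (Suc k)
  \<comment> \<open>Equality on an open set passes to the partial derivatives there. This lets the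
    closure lemmas below compute \<open>partial\<close> by rules that are valid only at points of
    \<open>U\<close>.\<close>
  have "Ck_on k U (partial i G)" for i
  proof (rule Suc.IH)
    show "partial i F x = partial i G x" if "x \<in> U" for x
      using partial_cong_open[OF assms that] Suc.prems(1) by blast
  qed (use Suc.prems in auto)
  moreover have "G differentiable (at x)" if "x \<in> U" for x
    using differentiable_cong_open[OF assms that, of F G] Suc.prems that by auto
  ultimately show ?case by auto
qed

lemma Ck_on_subset: "V \<subseteq> U \<Longrightarrow> Ck_on k U F \<Longrightarrow> Ck_on k V F"
  by (induction k arbitrary: F) (auto intro: continuous_on_subset)

lemma Ck_on_Suc_imp: "Ck_on (Suc k) U F \<Longrightarrow> Ck_on k U F"
proof (induction k arbitrary: F)
  case 0
  then show ?case
    by (auto intro!: continuous_at_imp_continuous_on differentiable_imp_continuous_within)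
next
  case (Suc k)
  then show ?case by simp
qed

lemma Ck_on_le: "j \<le> k \<Longrightarrow> Ck_on k U F \<Longrightarrow> Ck_on j U F"
  by (induction k rule: dec_induct) (auto dest: Ck_on_Suc_imp simp del: Ck_on.simps)

lemma Ck_on_const: "Ck_on k U (\<lambda>x. c)"
proof (induction k arbitrary: c)
  case (Suc k)
  have "partial i (\<lambda>x::real^3. c) = (\<lambda>x. 0)" for i by (simp add: fun_eq_iff)
  then show ?case using Suc by simp
qed simp

lemma Ck_on_add:
  assumes "open U"
  shows "Ck_on k U F \<Longrightarrow> Ck_on k U G \<Longrightarrow> Ck_on k U (\<lambda>x. F x + G x)"
proof (induction k arbitrary: F G)
  case 0
  then show ?case by (auto intro: continuous_on_add)
next
  case (Suc k)
  have "Ck_on k U (partial i (\<lambda>x. F x + G x))" for i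
    by (rule Ck_on_cong[OF assms, where F = "\<lambda>x. partial i F x + partial i G x"])
      (use Suc in \<open>auto simp: partial_add\<close>)
  then show ?case using Suc.prems by auto
qed

lemma Ck_on_bounded_linear:
  assumes "open U" "bounded_linear T"
  shows "Ck_on k U F \<Longrightarrow> Ck_on k U (\<lambda>x. T (F x))"
proof (induction k arbitrary: F)
  case 0
  then show ?case using assms by (auto intro: bounded_linear.continuous_on)
next
  case (Suc k)
  have "Ck_on k U (partial i (\<lambda>x. T (F x)))" for i
    by (rule Ck_on_cong[OF assms(1), where F = "\<lambda>x. T (partial i F x)"])
      (use Suc in \<open>auto simp: partial_bounded_linear[OF assms(2)]\<close>)
  then show ?case using Suc.prems by (auto intro: differentiable_bounded_linear[OF assms(2)])
qed

lemma Ck_on_diff: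
  assumes "open U" "Ck_on k U F" "Ck_on k U G"
  shows "Ck_on k U (\<lambda>x. F x - G x)"
  using Ck_on_add[OF assms(1,2) Ck_on_bounded_linear[OF assms(1)
        bounded_linear_minus[OF bounded_linear_ident] assms(3)]] by simp

lemma Ck_on_sum:
  assumes "open U" "\<And>j. j \<in> I \<Longrightarrow> Ck_on k U (F j)"
  shows "Ck_on k U (\<lambda>x. \<Sum>j\<in>I. F j x)"
  using assms(2)
  by (induction I rule: infinite_finite_induct) (auto intro: Ck_on_const Ck_on_add[OF assms(1)])

lemma Ck_on_bilinear:
  assumes "open U" "bounded_bilinear P"
  shows "Ck_on k U F \<Longrightarrow> Ck_on k U G \<Longrightarrow> Ck_on k U (\<lambda>x. P (F x) (G x))"
proof (induction k arbitrary: F G)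
  case 0
  then show ?case using assms by (auto intro: bounded_bilinear.continuous_on)
next
  case (Suc k)
  have "Ck_on k U F" "Ck_on k U G" using Suc.prems by (metis Ck_on_Suc_imp)+
  then have "Ck_on k U (\<lambda>x. P (F x) (partial i G x) + P (partial i F x) (G x))" for i
    using Suc.prems by (intro Ck_on_add[OF assms(1)] Suc.IH) auto
  then have "Ck_on k U (partial i (\<lambda>x. P (F x) (G x)))" for i
    by (rule Ck_on_cong[OF assms(1), rotated])
      (use Suc.prems in \<open>auto simp: partial_bilinear[OF assms(2)]\<close>)
  then show ?case using Suc.prems by (auto intro: differentiable_bilinear[OF assms(2)])
qed

lemmas Ck_on_mult = Ck_on_bilinear[OF _ bounded_bilinear_mult]

text \<open>Carrying the whole sequence of derivatives makes the induction possible: one partial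
  derivative turns \<open>D n\<close> after \<open>q\<close> into the product of
  \<open>D (Suc n)\<close> after \<open>q\<close> and a partial derivative of \<open>q\<close>, so
  \<open>n\<close> must be arbitrary.\<close>

lemma Ck_on_compose_field:
  fixes D :: "nat \<Rightarrow> 'c::real_normed_field \<Rightarrow> 'c"
  assumes "open U" "\<And>n z. (D n has_field_derivative D (Suc n) z) (at z)" "\<And>k. Ck_on k U q"
  shows "Ck_on k U (\<lambda>x. D n (q x))"
proof (induction k arbitrary: n)
  case 0
  have "continuous_on UNIV (D n)" using assms(2) DERIV_continuous_on by blast
  then show ?case using assms(3)[of 0] by (auto intro: continuous_on_compose2)
next
  case (Suc k)
  have dq: "q differentiable (at x)" if "x \<in> U" for x using assms(3)[of 1] that by auto
  have "Ck_on k U (partial i (\<lambda>x. D n (q x)))" for i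
  proof (rule Ck_on_cong[OF assms(1)])
    show "Ck_on k U (\<lambda>x. D (Suc n) (q x) * partial i q x)"
      using Suc assms(3)[of "Suc k"] by (intro Ck_on_mult[OF assms(1)]) auto
  qed (use dq partial_compose_field(1)[OF assms(2)] in auto)
  then show ?case using dq by (auto intro: partial_compose_field(2)[OF assms(2)])
qed

lemma Ck_on_component: "Ck_on k UNIV (\<lambda>x. x $ i)"
proof (cases k)
  case (Suc n)
  have "partial j (\<lambda>x. x $ i) = (\<lambda>x. axis j 1 $ i)" for j :: 3
    using partial_eqI[OF bounded_linear_imp_has_derivative[OF bounded_linear_vec_nth]] by blast
  then show ?thesis using Suc
    by (auto intro!: Ck_on_const bounded_linear_imp_differentiable bounded_linear_vec_nth)
qed (simp add: continuous_on_component)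

lemma smooth_onD:
  assumes "smooth_on U F"
  shows "x \<in> U \<Longrightarrow> F differentiable (at x)" "smooth_on U (partial i F)" "continuous_on U F"
proof -
  have k: "Ck_on k U F" for k using assms by (simp add: smooth_on_def)
  show "F differentiable (at x)" if "x \<in> U" using k[of 1] that by simp
  show "smooth_on U (partial i F)" unfolding smooth_on_def
  proof
    show "Ck_on n U (partial i F)" for n using k[of "Suc n"] by simp
  qed
  show "continuous_on U F" using k[of 0] by simp
qed

lemma smooth_on_subset: "V \<subseteq> U \<Longrightarrow> smooth_on U F \<Longrightarrow> smooth_on V F"
  by (simp add: smooth_on_def Ck_on_subset)

lemma smooth_on_const: "smooth_on U (\<lambda>x. c)"
  by (simp add: smooth_on_def Ck_on_const)

lemma smooth_on_nth: "smooth_on UNIV (\<lambda>x. x $ i)"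
  by (simp add: smooth_on_def Ck_on_component)

lemma smooth_on_add:
  "open U \<Longrightarrow> smooth_on U F \<Longrightarrow> smooth_on U G \<Longrightarrow> smooth_on U (\<lambda>x. F x + G x)"
  by (simp add: smooth_on_def Ck_on_add)

lemma smooth_on_diff:
  "open U \<Longrightarrow> smooth_on U F \<Longrightarrow> smooth_on U G \<Longrightarrow> smooth_on U (\<lambda>x. F x - G x)"
  by (simp add: smooth_on_def Ck_on_diff)

lemma smooth_on_sum:
  "open U \<Longrightarrow> (\<And>j. j \<in> I \<Longrightarrow> smooth_on U (F j)) \<Longrightarrow> smooth_on U (\<lambda>x. \<Sum>j\<in>I. F j x)"
  by (simp add: smooth_on_def Ck_on_sum)

lemma smooth_on_bounded_linear:
  "bounded_linear T \<Longrightarrow> open U \<Longrightarrow> smooth_on U F \<Longrightarrow> smooth_on U (\<lambda>x. T (F x))"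
  by (simp add: smooth_on_def Ck_on_bounded_linear)

lemma smooth_on_bilinear:
  "bounded_bilinear P \<Longrightarrow> open U \<Longrightarrow> smooth_on U F \<Longrightarrow> smooth_on U G
    \<Longrightarrow> smooth_on U (\<lambda>x. P (F x) (G x))"
  by (simp add: smooth_on_def Ck_on_bilinear)

lemmas smooth_on_mult = smooth_on_bilinear[OF bounded_bilinear_mult]

lemmas smooth_on_intros =
  open_UNIV smooth_on_const smooth_on_nth smooth_on_add smooth_on_diff smooth_on_sum smooth_on_mult

lemma smooth_on_compose_field:
  fixes D :: "nat \<Rightarrow> 'c::real_normed_field \<Rightarrow> 'c"
  assumes "open U" "\<And>n z. (D n has_field_derivative D (Suc n) z) (at z)" "smooth_on U q"
  shows "smooth_on U (\<lambda>x. D n (q x))"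
  unfolding smooth_on_def
proof
  show "Ck_on k U (\<lambda>x. D n (q x))" for k
    using assms by (intro Ck_on_compose_field[where D = D]) (auto simp: smooth_on_def)
qed

section \<open>Integration by parts\<close>

text \<open>Along the line the squared norm is a quadratic polynomial with nonzero leading
  coefficient \<open>d \<bullet> d\<close>, so each radius in \<open>C\<close> is attained only
  finitely often.\<close>

lemma finite_line_sphere_intersection:
  fixes x d :: "'a::real_inner"
  assumes "d \<noteq> 0" "finite C"
  shows "finite {t::real. norm (x + t *\<^sub>R d) \<in> C}"
proof -
  define p where "p c = [:x \<bullet> x - c\<^sup>2, 2 * (x \<bullet> d), d \<bullet> d:]" for c :: real
  have "poly (p c) t = (norm (x + t *\<^sub>R d))\<^sup>2 - c\<^sup>2" for c t
    unfolding p_def power2_norm_eq_inner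
    by (simp add: inner_add inner_commute algebra_simps power2_eq_square)
  then have "{t. norm (x + t *\<^sub>R d) \<in> C} \<subseteq> (\<Union>c\<in>C. {t. poly (p c) t = 0})" by auto
  moreover have "finite (\<Union>c\<in>C. {t. poly (p c) t = 0})"
    using assms by (intro finite_UN_I poly_roots_finite) (auto simp: p_def)
  ultimately show ?thesis by (rule finite_subset)
qed

text \<open>A segment meets the exceptional spheres in finitely many points, and the fundamental
  theorem of calculus tolerates finitely many exceptions for a continuous function. This admits the
  kinks that arise when a function is extended by zero from a shell.\<close>

lemma lipschitz_off_spheres:
  fixes F :: "'a::euclidean_space \<Rightarrow> 'b::banach"
  assumes cont: "continuous_on UNIV F" and C: "finite C"
    and der: "\<And>x. norm x \<notin> C \<Longrightarrow> (F has_derivative F' x) (at x)"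
    and bd: "\<And>x v. norm x \<notin> C \<Longrightarrow> norm (F' x v) \<le> B * norm v" and "0 \<le> B"
  shows "norm (F y - F x) \<le> B * norm (y - x)"
proof (cases "x = y")
  case False
  define d where "d = y - x"
  define S where "S = {t::real. norm (x + t *\<^sub>R d) \<in> C}"
  have S: "finite S"
    unfolding S_def by (rule finite_line_sphere_intersection[OF _ C]) (use False in \<open>simp add: d_def\<close>)
  have "((\<lambda>t. F' (x + t *\<^sub>R d) d) has_integral (F (x + 1 *\<^sub>R d) - F (x + 0 *\<^sub>R d))) {0..1}"
  proof (rule fundamental_theorem_of_calculus_strong[OF S])
    fix t :: real assume "t \<in> {0..1} - S"
    then have 1: "(F has_derivative F' (x + t *\<^sub>R d)) (at (x + t *\<^sub>R d))"
      by (intro der) (auto simp: S_def)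
    have 2: "((\<lambda>t. x + t *\<^sub>R d) has_derivative (\<lambda>s. s *\<^sub>R d)) (at t)"
      by (auto intro!: derivative_eq_intros)
    have "((\<lambda>t. F (x + t *\<^sub>R d)) has_derivative (\<lambda>s. F' (x + t *\<^sub>R d) (s *\<^sub>R d))) (at t)"
      using has_derivative_compose[OF 2 1] .
    then show "((\<lambda>t. F (x + t *\<^sub>R d)) has_vector_derivative F' (x + t *\<^sub>R d) d) (at t)"
      using linear_scale[OF has_derivative_linear[OF 1]] by (simp add: has_vector_derivative_def)
  next
    show "continuous_on {0..1} (\<lambda>t. F (x + t *\<^sub>R d))"
      by (intro continuous_on_compose2[OF cont] continuous_intros) auto
  qed simp
  then have I: "((\<lambda>t. F' (x + t *\<^sub>R d) d) has_integral (F y - F x)) (cbox 0 1)"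
    by (simp add: d_def)
  have "norm (F y - F x) \<le> B * norm d * measure lborel (cbox 0 (1::real))"
  proof (rule has_integral_bound_spike_finite[OF _ S I])
    show "0 \<le> B * norm d" using \<open>0 \<le> B\<close> by simp
    show "norm (F' (x + t *\<^sub>R d) d) \<le> B * norm d" if "t \<in> cbox 0 1 - S" for t
      using that bd by (simp add: S_def)
  qed
  then show ?thesis by (simp add: d_def)
qed simp

lemma lborel_integral_translation:
  fixes F :: "'a::euclidean_space \<Rightarrow> 'b::{banach, second_countable_topology}"
  assumes "F \<in> borel_measurable borel"
  shows "(LINT x|lborel. F (x + c)) = (LINT x|lborel. F x)"
proof -
  have "(LINT x|lborel. F x) = (LINT x|distr lborel borel ((+) c). F x)"
    by (simp only: lborel_distr_plus)
  also have "\<dots> = (LINT x|lborel. F (c + x))"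
    by (rule integral_distr) (use assms in auto)
  finally show ?thesis by (simp only: add.commute)
qed

lemma lborel_integrable_bounded_support:
  fixes F :: "'a::euclidean_space \<Rightarrow> 'b::{banach, second_countable_topology}"
  assumes "F \<in> borel_measurable borel" "\<And>x. norm (F x) \<le> M" "\<And>x. norm x > r \<Longrightarrow> F x = 0"
  shows "integrable lborel F"
proof (rule Bochner_Integration.integrable_bound[of lborel "\<lambda>x. M * indicator (cball 0 r) x"])
  show "integrable lborel (\<lambda>x::'a. M * indicator (cball 0 r) x :: real)"
    using emeasure_bounded_finite[of "cball (0::'a) r"]
    by (intro integrable_mult_right integrable_real_indicator) auto
  have "norm (F x) \<le> norm (M * indicator (cball 0 r) x :: real)" for x
  proof (cases "norm x > r")
    case True
    then show ?thesis using assms(3)[of x] by simp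
  next
    case False
    then have "x \<in> cball 0 r" by simp
    then show ?thesis using assms(2)[of x] by simp
  qed
  then show "AE x in lborel. norm (F x) \<le> norm (M * indicator (cball 0 r) x :: real)" by blast
qed (use assms(1) in simp)

text \<open>Translation invariance of Lebesgue measure makes the integrals of the difference quotients
  vanish; the Lipschitz bound lets them converge dominatedly.\<close>

lemma integral_directional_derivative_eq_0:
  fixes F :: "real ^ 3 \<Rightarrow> 'b::{banach, second_countable_topology}"
  assumes cont: "continuous_on UNIV F" and C: "finite C"
    and der: "\<And>x. norm x \<notin> C \<Longrightarrow> (F has_derivative F' x) (at x)"
    and bd: "\<And>x v. norm x \<notin> C \<Longrightarrow> norm (F' x v) \<le> B * norm v" and B: "0 \<le> B"
    and supp: "\<And>x. norm x \<ge> r \<Longrightarrow> F x = 0"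
  shows "(LINT x|lebesgue. indicator {x. norm x \<notin> C} x *\<^sub>R F' x (axis i 1)) = 0"
proof -
  define e :: "real ^ 3" where "e = axis i 1"
  have e: "norm e = 1" by (simp add: e_def)
  define A where "A = {x::real^3. norm x \<notin> C}"
  have "A = UNIV - (\<Union>c\<in>C. sphere 0 c)" by (auto simp: A_def)
  moreover have "closed (\<Union>c\<in>C. sphere (0::real^3) c)" using C by (intro closed_UN) auto
  ultimately have A: "A \<in> sets borel" by (auto intro: borel_open open_Diff)
  have Fm: "F \<in> borel_measurable borel" using cont by (rule borel_measurable_continuous_onI)
  have lip: "norm (F y - F x) \<le> B * norm (y - x)" for x y
    using lipschitz_off_spheres[OF cont C der bd B] by blast
  have Fint: "integrable lborel F"
  proof (rule lborel_integrable_bounded_support[OF Fm, where M = "B * ((1 + \<bar>r\<bar>) * 2)" and r = "r"])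
    have v: "norm ((1 + \<bar>r\<bar>) *\<^sub>R e) = 1 + \<bar>r\<bar>" by (simp add: e)
    show "norm (F x) \<le> B * ((1 + \<bar>r\<bar>) * 2)" for x
    proof (cases "norm x \<ge> r")
      case True
      then show ?thesis using supp B by simp
    next
      case False
      \<comment> \<open>The Lipschitz bound is started at a point beyond radius \<open>r\<close>,
        where \<open>F\<close> vanishes; this bounds \<open>F\<close> itself.\<close>
      have "norm (F ((1 + \<bar>r\<bar>) *\<^sub>R e) - F x) \<le> B * norm ((1 + \<bar>r\<bar>) *\<^sub>R e - x)" by (rule lip)
      moreover have "F ((1 + \<bar>r\<bar>) *\<^sub>R e) = 0" by (rule supp) (simp add: e)
      moreover have "norm ((1 + \<bar>r\<bar>) *\<^sub>R e - x) \<le> (1 + \<bar>r\<bar>) * 2"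
        using norm_triangle_ineq4[of "(1 + \<bar>r\<bar>) *\<^sub>R e" x] False v abs_ge_self[of r] by argo
      ultimately show ?thesis
        using B mult_left_mono[of "norm ((1 + \<bar>r\<bar>) *\<^sub>R e - x)" "(1 + \<bar>r\<bar>) * 2" B] by simp
    qed
  qed (use supp in auto)
  define h where "h n = inverse (real (Suc n))" for n
  have h: "h n > 0" "h n \<le> 1" for n by (auto simp: h_def field_simps)
  define s where "s n x = inverse (h n) *\<^sub>R (F (x + h n *\<^sub>R e) - F x)" for n x
  have sm: "s n \<in> borel_measurable borel" for n
    unfolding s_def using Fm by measurable
  have s0: "(LINT x|lborel. s n x) = 0" for n
  proof -
    have "integrable lborel (\<lambda>x. F (x + h n *\<^sub>R e))"
    proof -
      have "integrable (distr lborel borel ((+) (h n *\<^sub>R e))) F"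
        using Fint by (simp only: lborel_distr_plus)
      then have "integrable lborel (\<lambda>x. F (h n *\<^sub>R e + x))"
        by (rule integrable_distr[rotated]) simp
      then show ?thesis by (simp only: add.commute)
    qed
    then show ?thesis
      using Fint lborel_integral_translation[OF Fm] by (simp add: s_def)
  qed
  have null: "AE x in lborel. x \<in> A"
  proof -
    have "(\<Union>c\<in>C. sphere 0 c) \<in> null_sets (lborel :: (real^3) measure)"
      using C by (intro null_sets.finite_UN)
        (auto simp: null_sets_completion_iff[symmetric] negligible_iff_null_sets[symmetric] negligible_sphere)
    then show ?thesis by (rule AE_I') (auto simp: A_def)
  qed
  have lim: "(\<lambda>n. s n x) \<longlonglongrightarrow> F' x e" if "x \<in> A" for x
  proof -
    have D: "(F has_derivative F' x) (at x)" using der that by (simp add: A_def)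
    have *: "(\<lambda>n. x + h n *\<^sub>R e) \<longlonglongrightarrow> x"
      unfolding h_def by (rule tendsto_eq_intros refl LIMSEQ_inverse_real_of_nat)+ simp
    have "filterlim (\<lambda>n. x + h n *\<^sub>R e) (at x) sequentially"
      unfolding filterlim_at using * e h by (auto simp: h_def)
    from filterlim_compose[OF D[unfolded has_derivative_iff_norm, THEN conjunct2] this]
    have "(\<lambda>n. norm (F (x + h n *\<^sub>R e) - F x - F' x (h n *\<^sub>R e)) / h n) \<longlonglongrightarrow> 0"
      using e h by (simp add: abs_of_pos)
    moreover have "norm (F (x + h n *\<^sub>R e) - F x - F' x (h n *\<^sub>R e)) / h n = norm (s n x - F' x e)" for n
    proof -
      have "s n x - F' x e = inverse (h n) *\<^sub>R (F (x + h n *\<^sub>R e) - F x - F' x (h n *\<^sub>R e))"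
        using h(1)[of n] linear_scale[OF has_derivative_linear[OF D], of "h n" e]
        by (simp add: s_def scaleR_diff_right)
      then show ?thesis using h(1)[of n] by (simp add: divide_inverse mult.commute)
    qed
    ultimately have "(\<lambda>n. norm (s n x - F' x e)) \<longlonglongrightarrow> 0" by simp
    then show ?thesis using LIM_zero_cancel tendsto_norm_zero_iff by blast
  qed
  \<comment> \<open>The indicator makes the limit exist at every point, so \<open>G\<close> is
    measurable as a pointwise limit.\<close>
  define G where "G x = indicator A x *\<^sub>R F' x e" for x
  have Glim: "(\<lambda>n. indicator A x *\<^sub>R s n x) \<longlonglongrightarrow> G x" for x
    using lim[of x] by (cases "x \<in> A") (auto simp: G_def)
  have Gm: "G \<in> borel_measurable borel"
    by (rule borel_measurable_LIMSEQ_metric[OF _ Glim]) (use A sm in measurable)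
  \<comment> \<open>Steps of length at most 1 enlarge the support by at most 1, so one ball carries
    all difference quotients.\<close>
  have sb: "norm (s n x) \<le> B * indicator (cball 0 (\<bar>r\<bar> + 1)) x" for n x
  proof (cases "norm x \<le> \<bar>r\<bar> + 1")
    case True
    have "norm (F (x + h n *\<^sub>R e) - F x) \<le> B * h n"
      using lip[of "x + h n *\<^sub>R e" x] e h[of n] by simp
    moreover have "norm (s n x) = norm (F (x + h n *\<^sub>R e) - F x) / h n"
      using h(1)[of n] unfolding s_def norm_scaleR by (simp add: divide_inverse mult.commute)
    ultimately show ?thesis using True h(1)[of n] by (simp add: pos_divide_le_eq)
  next
    case False
    have "norm (x + h n *\<^sub>R e) \<ge> norm x - h n"
      using norm_triangle_ineq2[of x "- (h n *\<^sub>R e)"] e h(1)[of n] by simp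
    then have "norm (x + h n *\<^sub>R e) \<ge> r" "norm x \<ge> r" using False h(2)[of n] by auto
    then show ?thesis using supp False by (simp add: s_def)
  qed
  have "(\<lambda>n. LINT x|lborel. s n x) \<longlonglongrightarrow> (LINT x|lborel. G x)"
  proof (rule integral_dominated_convergence[where w = "\<lambda>x. B * indicator (cball 0 (\<bar>r\<bar> + 1)) x"])
    show "integrable lborel (\<lambda>x::real^3. B * indicator (cball 0 (\<bar>r\<bar> + 1)) x)"
      using emeasure_bounded_finite[of "cball (0::real^3) (\<bar>r\<bar> + 1)"]
      by (intro integrable_mult_right integrable_real_indicator) auto
    show "AE x in lborel. (\<lambda>n. s n x) \<longlonglongrightarrow> G x"
      using null by eventually_elim (use lim in \<open>auto simp: G_def\<close>)
  qed (use Gm sm sb in auto)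
  then have "(LINT x|lborel. G x) = 0" by (simp add: s0 LIMSEQ_const_iff)
  then have "(LINT x|lebesgue. G x) = 0" using Gm integral_completion[of G lborel] by simp
  then show ?thesis unfolding G_def A_def e_def .
qed

lemma partial_eq_0_outside:
  assumes "closed K" "\<And>x. x \<notin> K \<Longrightarrow> F x = 0" "x \<notin> K"
  shows "partial i F x = 0"
proof -
  have "partial i F x = partial i (\<lambda>x. 0) x"
    by (rule partial_cong_open[of "- K"]) (use assms in auto)
  then show ?thesis by simp
qed

section \<open>Extension by zero and integration by parts on open sets\<close>

lemma Ck_on_Un:
  assumes "open U" "open V"
  shows "Ck_on k U F \<Longrightarrow> Ck_on k V F \<Longrightarrow> Ck_on k (U \<union> V) F"
  using assms by (induction k arbitrary: F) (auto intro: continuous_on_open_Un)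

text \<open>\<open>U\<close> and the complement of \<open>K\<close> form an open cover, and on the
  second set the function is zero.\<close>

lemma Ck_on_extend_0:
  assumes "open U" "closed K" "K \<subseteq> U" "\<And>x. x \<notin> K \<Longrightarrow> F x = 0" "Ck_on k U F"
  shows "Ck_on k UNIV F"
proof -
  have "Ck_on k (- K) F"
    by (rule Ck_on_cong[OF _ _ Ck_on_const[of _ _ 0]]) (use assms in auto)
  then have "Ck_on k (U \<union> - K) F" using assms by (intro Ck_on_Un) auto
  moreover have "U \<union> - K = UNIV" using assms by blast
  ultimately show ?thesis by simp
qed

lemma bounded_if_compact_support:
  fixes F :: "'a::metric_space \<Rightarrow> 'b::real_normed_vector"
  assumes "continuous_on K F" "compact K" "\<And>x. x \<notin> K \<Longrightarrow> F x = 0"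
  obtains M where "M \<ge> 0" "\<And>x. norm (F x) \<le> M"
proof -
  have "bounded (F ` K)" using assms by (intro compact_imp_bounded compact_continuous_image)
  then obtain M where M: "M > 0" "\<And>x. x \<in> K \<Longrightarrow> norm (F x) \<le> M"
    by (auto simp: bounded_pos)
  have "norm (F x) \<le> M" for x using M assms(3)[of x] by (cases "x \<in> K") auto
  then show thesis using that[of M] M(1) by auto
qed

lemma integrable_on_subset_compact:
  fixes f :: "real ^ 3 \<Rightarrow> 'b::euclidean_space"
  assumes "compact A" "continuous_on A f" "S \<subseteq> A" "S \<in> sets borel"
  shows "integrable lebesgue (\<lambda>x. indicator S x *\<^sub>R f x)"
proof -
  have "integrable lborel (\<lambda>x. indicator S x *\<^sub>R (indicator A x *\<^sub>R f x))"
    by (rule integrable_mult_indicator[OF _ borel_integrable_compact[OF assms(1,2)]]) (use assms(4) in simp)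
  moreover have "indicator S x *\<^sub>R (indicator A x *\<^sub>R f x) = indicator S x *\<^sub>R f x" for x
    using assms(3) by (auto simp: indicator_def)
  ultimately have "integrable lborel (\<lambda>x. indicator S x *\<^sub>R f x)" by (simp only:)
  then show ?thesis
    using integrable_completion[of "\<lambda>x. indicator S x *\<^sub>R f x" lborel]
      borel_measurable_integrable[of lborel "\<lambda>x. indicator S x *\<^sub>R f x"] by simp
qed

lemma sum_axis_scaleR:
  fixes f :: "3 \<Rightarrow> 'b::real_vector"
  shows "(\<Sum>j\<in>UNIV. (axis i 1 :: real^3) $ j *\<^sub>R f j) = f i"
proof -
  have "(\<Sum>j\<in>UNIV. (axis i 1 :: real^3) $ j *\<^sub>R f j) = (\<Sum>j\<in>UNIV. if j = i then f j else 0)"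
    by (rule sum.cong) (auto simp: axis_def)
  then show ?thesis by simp
qed

lemma compact_shell: "compact {x::'a::euclidean_space. a \<le> norm x \<and> norm x \<le> b}"
proof -
  have "{x::'a. a \<le> norm x \<and> norm x \<le> b} = cball 0 b \<inter> {x. a \<le> norm x}" by auto
  then show ?thesis by (simp add: compact_Int_closed closed_Collect_le continuous_intros)
qed

lemma integrable_lebesgue_compact_support:
  fixes F :: "real ^ 3 \<Rightarrow> 'b::euclidean_space"
  assumes "continuous_on K F" "compact K" "\<And>x. x \<notin> K \<Longrightarrow> F x = 0"
  shows "integrable lebesgue F"
proof -
  have "K \<in> sets borel" using assms(2) by (simp add: borel_closed compact_imp_closed)
  then have "integrable lebesgue (\<lambda>x. indicator K x *\<^sub>R F x)"
    by (rule integrable_on_subset_compact[OF assms(2,1) order_refl])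
  moreover have "(\<lambda>x. indicator K x *\<^sub>R F x) = F"
    using assms(3) by (auto simp: fun_eq_iff indicator_def)
  ultimately show ?thesis by simp
qed

lemma integral_partial_compact_support:
  fixes F :: "real ^ 3 \<Rightarrow> 'b::euclidean_space"
  assumes "Ck_on 1 UNIV F" "compact K" "\<And>x. x \<notin> K \<Longrightarrow> F x = 0"
  shows "(LINT x|lebesgue. partial i F x) = 0"
proof -
  have diff: "F differentiable (at x)" for x using assms(1) by simp
  have cont: "continuous_on UNIV (partial j F)" for j using assms(1) by simp
  have "\<exists>M\<ge>0. \<forall>x. norm (partial j F x) \<le> M" for j
  proof -
    obtain M where "M \<ge> 0" "\<And>x. norm (partial j F x) \<le> M"
    proof (rule bounded_if_compact_support)
      show "continuous_on K (partial j F)" by (rule continuous_on_subset[OF cont subset_UNIV])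
      show "partial j F x = 0" if "x \<notin> K" for x
        by (rule partial_eq_0_outside[OF compact_imp_closed[OF assms(2)] assms(3) that])
    qed (use assms(2) in auto)
    then show ?thesis by blast
  qed
  then obtain M where M: "\<And>j. M j \<ge> 0" "\<And>j x. norm (partial j F x) \<le> M j"
    using choice[of "\<lambda>j M. M \<ge> 0 \<and> (\<forall>x. norm (partial j F x) \<le> M)"] by blast
  obtain r where r: "\<And>x. x \<in> K \<Longrightarrow> norm x \<le> r"
    using compact_imp_bounded[OF assms(2)] by (auto simp: bounded_iff)
  have "(LINT x|lebesgue. indicator {x. norm x \<notin> {}} x *\<^sub>R
      (\<Sum>j\<in>UNIV. (axis i 1 :: real^3) $ j *\<^sub>R partial j F x)) = 0"
  proof (rule integral_directional_derivative_eq_0[where F = F and B = "\<Sum>j\<in>UNIV. M j" and r = "r + 1"])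
    show "continuous_on UNIV F"
      using diff by (simp add: continuous_at_imp_continuous_on differentiable_imp_continuous_within)
    show "(F has_derivative (\<lambda>v. \<Sum>j\<in>UNIV. v $ j *\<^sub>R partial j F x)) (at x)" for x
      by (rule has_derivative_partial_sum[OF diff])
    show "norm (\<Sum>j\<in>UNIV. v $ j *\<^sub>R partial j F x) \<le> (\<Sum>j\<in>UNIV. M j) * norm v" for x v
      unfolding sum_distrib_right
    proof (rule sum_norm_le)
      show "norm (v $ j *\<^sub>R partial j F x) \<le> M j * norm v" for j
        using mult_mono[OF component_le_norm_cart[of v j] M(2)[of j x]] by (simp add: mult.commute)
    qed
    show "0 \<le> (\<Sum>j\<in>UNIV. M j)" using M(1) by (simp add: sum_nonneg)
    show "F x = 0" if "r + 1 \<le> norm x" for x using r[of x] assms(3)[of x] that by linarith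
  qed simp
  then show ?thesis by (simp add: sum_axis_scaleR)
qed

text \<open>\<open>h\<close> is controlled only on \<open>U\<close>. The product with \<psi>
  vanishes off \<open>K\<close>, so it is C1 on the whole space and its partial derivative has
  integral zero; the product rule then gives the formula.\<close>

lemma integration_by_parts:
  fixes h \<psi> :: "real ^ 3 \<Rightarrow> complex"
  assumes U: "open U" and h: "Ck_on 1 U h" and \<psi>: "Ck_on 1 UNIV \<psi>"
    and K: "compact K" "K \<subseteq> U" "\<And>x. x \<notin> K \<Longrightarrow> \<psi> x = 0"
  shows "integrable lebesgue (\<lambda>x. partial i h x * \<psi> x)"
    and "integrable lebesgue (\<lambda>x. h x * partial i \<psi> x)"
    and "(LINT x|lebesgue. partial i h x * \<psi> x) = - (LINT x|lebesgue. h x * partial i \<psi> x)"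
proof -
  have clK: "closed K" by (rule compact_imp_closed[OF K(1)])
  have \<psi>U: "Ck_on 1 U \<psi>" using \<psi> Ck_on_subset by blast
  have p0: "partial i \<psi> x = 0" if "x \<notin> K" for x
    using partial_eq_0_outside[OF clK K(3) that] .
  have hd: "h differentiable (at x)" if "x \<in> U" for x using h that by simp
  have \<psi>d: "\<psi> differentiable (at x)" for x using \<psi> by simp
  have hc: "continuous_on K h" "continuous_on K (partial i h)"
    using Ck_on_le[OF _ h, of 0] h by (auto intro: continuous_on_subset[OF _ K(2)])
  have \<psi>c: "continuous_on K \<psi>" "continuous_on K (partial i \<psi>)"
    using Ck_on_le[OF _ \<psi>, of 0] \<psi> by (auto intro: continuous_on_subset[OF _ subset_UNIV])
  have C1: "Ck_on 1 UNIV (\<lambda>x. h x * \<psi> x)"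
    by (rule Ck_on_extend_0[OF U clK K(2) _ Ck_on_mult[OF U h \<psi>U]]) (simp add: K(3))
  have 0: "(LINT x|lebesgue. partial i (\<lambda>x. h x * \<psi> x) x) = 0"
    by (rule integral_partial_compact_support[OF C1 K(1)]) (simp add: K(3))
  have eq: "partial i (\<lambda>x. h x * \<psi> x) x = h x * partial i \<psi> x + partial i h x * \<psi> x" for x
  proof (cases "x \<in> U")
    case True
    then show ?thesis by (intro partial_mult hd \<psi>d)
  next
    case False
    then have "x \<notin> K" using K(2) by blast
    moreover have "partial i (\<lambda>x. h x * \<psi> x) x = 0"
      by (rule partial_eq_0_outside[OF clK _ \<open>x \<notin> K\<close>]) (simp add: K(3))
    ultimately show ?thesis by (simp add: p0 K(3))
  qed
  show i1: "integrable lebesgue (\<lambda>x. h x * partial i \<psi> x)"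
    by (rule integrable_lebesgue_compact_support[OF continuous_on_mult[OF hc(1) \<psi>c(2)] K(1)])
      (simp add: p0)
  show i2: "integrable lebesgue (\<lambda>x. partial i h x * \<psi> x)"
    by (rule integrable_lebesgue_compact_support[OF continuous_on_mult[OF hc(2) \<psi>c(1)] K(1)])
      (simp add: K(3))
  have "(LINT x|lebesgue. h x * partial i \<psi> x) + (LINT x|lebesgue. partial i h x * \<psi> x) = 0"
    using 0 unfolding eq Bochner_Integration.integral_add[OF i1 i2] .
  then show "(LINT x|lebesgue. partial i h x * \<psi> x) = - (LINT x|lebesgue. h x * partial i \<psi> x)"
    by (simp add: eq_neg_iff_add_eq_0 add.commute)
qed

section \<open>Smooth cut-off functions\<close>

text \<open>Polynomials in 1/t times exp(-1/t), continued by 0, form a class closed under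
  differentiation. This yields the full derivative sequence that smoothness of compositions
  requires.\<close>

definition flat :: "real poly \<Rightarrow> real \<Rightarrow> real" where
  "flat p t = (if t > 0 then poly p (1 / t) * exp (- (1 / t)) else 0)"

text \<open>With s = 1/t, the derivative of p(s) exp(-s) with respect to t is s^2 (p(s) - p'(s))
  exp(-s).\<close>

definition flat_deriv :: "real poly \<Rightarrow> real poly" where
  "flat_deriv p = [:0, 0, 1:] * (p - pderiv p)"

lemma poly_div_exp_tendsto_0: "((\<lambda>s::real. poly p s * exp (- s)) \<longlongrightarrow> 0) at_top"
proof -
  have "((\<lambda>s. \<Sum>i\<le>degree p. coeff p i * (s ^ i / exp s)) \<longlongrightarrow> (\<Sum>i\<le>degree p. coeff p i * 0)) at_top"
    by (intro tendsto_sum tendsto_mult_left tendsto_power_div_exp_0)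
  then show ?thesis
    by (simp add: poly_altdef sum_distrib_right exp_minus divide_inverse mult.assoc)
qed

lemma flat_has_derivative: "(flat p has_real_derivative flat (flat_deriv p) t) (at t)"
proof -
  consider "t > 0" | "t < 0" | "t = 0" by linarith
  then show ?thesis
  proof cases
    case 1
    have r: "((\<lambda>t. 1 / t) has_real_derivative - (1 / t\<^sup>2)) (at t)"
      using 1 by (auto intro!: derivative_eq_intros simp: power2_eq_square)
    have "((\<lambda>t. poly p (1 / t) * exp (- (1 / t))) has_real_derivative
        poly (pderiv p) (1 / t) * - (1 / t\<^sup>2) * exp (- (1 / t)) +
        exp (- (1 / t)) * - (- (1 / t\<^sup>2)) * poly p (1 / t)) (at t)"
      by (intro DERIV_mult DERIV_chain2[OF poly_DERIV r] DERIV_chain2[OF DERIV_exp DERIV_minus[OF r]])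
    moreover have "poly (pderiv p) (1 / t) * - (1 / t\<^sup>2) * exp (- (1 / t)) +
        exp (- (1 / t)) * - (- (1 / t\<^sup>2)) * poly p (1 / t) = flat (flat_deriv p) t"
      using 1 by (simp add: flat_def flat_deriv_def power2_eq_square algebra_simps)
    ultimately have "((\<lambda>t. poly p (1 / t) * exp (- (1 / t))) has_real_derivative
        flat (flat_deriv p) t) (at t)" by simp
    then show ?thesis
      by (rule has_field_derivative_transform_within_open[where S = "{0<..}"])
        (use 1 in \<open>auto simp: flat_def\<close>)
  next
    case 2
    have "((\<lambda>t. 0) has_real_derivative flat (flat_deriv p) t) (at t)" using 2 by (simp add: flat_def)
    then show ?thesis
      by (rule has_field_derivative_transform_within_open[where S = "{..<0}"])
        (use 2 in \<open>auto simp: flat_def\<close>)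
  next
    case 3
    have "((\<lambda>h. flat p h / h) \<longlongrightarrow> 0) (at_left 0)"
      by (rule tendsto_eventually) (auto simp: eventually_at_filter flat_def)
    moreover have "((\<lambda>h. flat p h / h) \<longlongrightarrow> 0) (at_right 0)"
    proof -
      \<comment> \<open>The difference quotient at 0 is s p(s) exp(-s) with s = 1/h;
        \<open>pCons 0 p\<close> supplies the extra factor s.\<close>
      have "((\<lambda>h::real. poly (pCons 0 p) (inverse h) * exp (- inverse h)) \<longlongrightarrow> 0) (at_right 0)"
        by (rule filterlim_compose[OF poly_div_exp_tendsto_0 filterlim_inverse_at_top_right])
      then show ?thesis
        by (rule Lim_transform_eventually)
          (auto simp: eventually_at_filter flat_def divide_inverse mult_ac)
    qed
    ultimately have "((\<lambda>h. flat p h / h) \<longlongrightarrow> 0) (at 0)"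
      by (simp add: filterlim_at_split)
    then show ?thesis using 3 by (simp add: has_field_derivative_iff flat_def)
  qed
qed

lemma flat_one: "flat 1 t = (if t > 0 then exp (- (1 / t)) else 0)" by (simp add: flat_def)

lemma flat_one_mono: "s \<le> t \<Longrightarrow> flat 1 s \<le> flat 1 t"
  by (auto simp: flat_one intro: divide_left_mono)

text \<open>Nesting the flat function gives a plateau without a quotient of smooth functions; the constant
  denominator only normalizes its height.\<close>

definition cutoff :: "real ^ 3 \<Rightarrow> real \<Rightarrow> real ^ 3 \<Rightarrow> real" where
  "cutoff a r x = flat 1 (flat 1 (3/4) - flat 1 ((norm (x - a))\<^sup>2 / r\<^sup>2 - 1/4)) / flat 1 (flat 1 (3/4))"

lemma cutoff_nonneg: "cutoff a r x \<ge> 0"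
  by (simp add: cutoff_def flat_one)

lemma flat_plateau_pos: "flat 1 (flat 1 (3/4)) > 0"
  by (simp add: flat_one)

lemma cutoff_inside:
  assumes "norm (x - a) \<le> r / 2" "r > 0"
  shows "cutoff a r x = 1"
proof -
  have "(norm (x - a))\<^sup>2 \<le> (r / 2)\<^sup>2" using assms by (intro power_mono) auto
  then have "(norm (x - a))\<^sup>2 / r\<^sup>2 \<le> (r / 2)\<^sup>2 / r\<^sup>2" by (rule divide_right_mono) simp
  moreover have "(r / 2)\<^sup>2 / r\<^sup>2 = 1/4" using assms(2) by (simp add: power_divide)
  ultimately have "(norm (x - a))\<^sup>2 / r\<^sup>2 - 1/4 \<le> 0" by linarith
  \<comment> \<open>For |x - a| <= r/2 the inner \<open>flat\<close> vanishes, so the outer argument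
    is exactly \<open>flat 1 (3/4)\<close>, the one used for the normalization.\<close>
  then have "flat 1 ((norm (x - a))\<^sup>2 / r\<^sup>2 - 1/4) = 0" by (simp add: flat_one)
  then show ?thesis using flat_plateau_pos by (simp add: cutoff_def)
qed

lemma cutoff_outside:
  assumes "norm (x - a) \<ge> r" "r > 0"
  shows "cutoff a r x = 0"
proof -
  have "r\<^sup>2 \<le> (norm (x - a))\<^sup>2" using assms by (intro power_mono) auto
  then have "r\<^sup>2 / r\<^sup>2 \<le> (norm (x - a))\<^sup>2 / r\<^sup>2" by (rule divide_right_mono) simp
  moreover have "r\<^sup>2 / r\<^sup>2 = 1" using assms(2) by simp
  \<comment> \<open>The threshold 3/4 = 1 - 1/4 is reached at |x - a| = r; from there on
    monotonicity makes the outer argument nonpositive.\<close>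
  ultimately have "3/4 \<le> (norm (x - a))\<^sup>2 / r\<^sup>2 - 1/4" by linarith
  from flat_one_mono[OF this] show ?thesis by (simp add: cutoff_def flat_def)
qed

lemma cutoff_scale: "r > 0 \<Longrightarrow> cutoff 0 r x = cutoff 0 1 (x /\<^sub>R r)"
proof -
  assume "r > 0"
  then have "norm (x /\<^sub>R r) = norm x / r" by (simp add: divide_inverse mult.commute)
  then show ?thesis by (simp add: cutoff_def power_divide)
qed

text \<open>Symmetry of mixed derivatives for arbitrary smooth functions is obtained below by
  duality against cut-offs. It must first be known for the cut-offs themselves, by explicit
  computation along their construction.\<close>

definition symmetric_partials :: "(real ^ 3 \<Rightarrow> 'b::real_normed_vector) \<Rightarrow> bool" where
  "symmetric_partials F \<longleftrightarrow> smooth_on UNIV F \<and>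
     (\<forall>i j x. partial i (partial j F) x = partial j (partial i F) x)"

text \<open>By the chain rule a mixed derivative is a multiple of the product of two first
  derivatives of \<open>q\<close> plus a multiple of a mixed derivative of \<open>q\<close>; both
  are symmetric in the indices.\<close>

lemma symmetric_partials_compose_field:
  fixes D :: "nat \<Rightarrow> 'c::real_normed_field \<Rightarrow> 'c"
  assumes D: "\<And>n z. (D n has_field_derivative D (Suc n) z) (at z)" and q: "symmetric_partials q"
  shows "symmetric_partials (\<lambda>x. D n (q x))"
  unfolding symmetric_partials_def
proof (intro conjI allI)
  have sq: "smooth_on UNIV q" using q by (simp add: symmetric_partials_def)
  have dq: "q differentiable (at x)" "partial j q differentiable (at x)" for x j
    using smooth_onD[OF sq] smooth_onD[OF smooth_onD(2)[OF sq]] by auto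
  show "smooth_on UNIV (\<lambda>x. D n (q x))"
    by (rule smooth_on_compose_field[where D = D, OF open_UNIV D sq])
  have 1: "partial j (\<lambda>x. D n (q x)) = (\<lambda>x. D (Suc n) (q x) * partial j q x)" for j n
    using partial_compose_field(1)[OF D dq(1)] by blast
  have "partial i (partial j (\<lambda>x. D n (q x))) x
      = D (Suc n) (q x) * partial i (partial j q) x
        + D (Suc (Suc n)) (q x) * partial i q x * partial j q x" for i j x
    using partial_mult[OF partial_compose_field(2)[OF D dq(1)] dq(2)]
    by (simp add: 1)
  then show "partial i (partial j (\<lambda>x. D n (q x))) x = partial j (partial i (\<lambda>x. D n (q x))) x" for i j x
    using q by (simp add: symmetric_partials_def mult_ac)
qed

lemma symmetric_partials_const_diff:
  assumes "symmetric_partials F"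
  shows "symmetric_partials (\<lambda>x. c - F x)"
proof -
  have s: "smooth_on UNIV F" using assms by (simp add: symmetric_partials_def)
  have d: "F differentiable (at x)" "partial j F differentiable (at x)" for x j
    using smooth_onD[OF s] smooth_onD[OF smooth_onD(2)[OF s]] by auto
  have 1: "partial j (\<lambda>x. c - F x) = (\<lambda>x. 0 - partial j F x)" for j
    using partial_diff[OF differentiable_const d(1)] by (auto simp: fun_eq_iff)
  have "partial i (partial j (\<lambda>x. c - F x)) x = 0 - partial i (partial j F) x" for i j x
    unfolding 1 by (simp only: partial_diff[OF differentiable_const d(2)] partial_const)
  then show ?thesis
    using assms by (auto simp: symmetric_partials_def intro!: smooth_on_intros)
qed

lemma symmetric_partials_norm_square:
  "symmetric_partials (\<lambda>x::real^3. (norm (x - a))\<^sup>2 / r)"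
proof -
  have e: "(norm (x - a))\<^sup>2 / r = (\<Sum>i\<in>UNIV. ((x $ i - a $ i) * (x $ i - a $ i)) * inverse r)" for x
    by (simp add: power2_norm_eq_inner inner_vec_def sum_distrib_right divide_inverse)
  have s: "smooth_on UNIV (\<lambda>x::real^3. (norm (x - a))\<^sup>2 / r)"
    unfolding e by (intro smooth_on_intros)
  have d: "((\<lambda>x. x - a) has_derivative (\<lambda>v. v)) (at x)" for x
    by (auto intro!: derivative_eq_intros)
  have "((\<lambda>x. inverse r * ((x - a) \<bullet> (x - a))) has_derivative
      (\<lambda>v. inverse r * ((x - a) \<bullet> v + v \<bullet> (x - a)))) (at x)" for x
    by (rule has_derivative_mult_right[OF has_derivative_inner[OF d d]])
  from partial_eqI[OF this] have 1: "partial j (\<lambda>x. (norm (x - a))\<^sup>2 / r)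
      = (\<lambda>x. inverse r * ((x - a) \<bullet> axis j 1 + axis j 1 \<bullet> (x - a)))" for j
    by (intro ext) (simp add: power2_norm_eq_inner divide_inverse mult.commute)
  have "((\<lambda>x. inverse r * ((x - a) \<bullet> axis j 1 + axis j 1 \<bullet> (x - a))) has_derivative
      (\<lambda>v. inverse r * (v \<bullet> axis j 1 + axis j 1 \<bullet> v))) (at x)" for x and j :: 3
    by (intro has_derivative_mult_right has_derivative_add has_derivative_inner_left[OF d]
        has_derivative_inner_right[OF d])
  note 2 = partial_eqI[OF this]
  have "partial i (partial j (\<lambda>x. (norm (x - a))\<^sup>2 / r)) x
      = inverse r * ((axis i 1 :: real^3) \<bullet> axis j 1 + (axis j 1 :: real^3) \<bullet> axis i 1)" for i j x
    unfolding 1 by (rule 2)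
  then show ?thesis using s by (simp add: symmetric_partials_def add.commute)
qed

lemma symmetric_partials_cutoff: "symmetric_partials (cutoff a r)"
proof -
  \<comment> \<open>Iterating \<open>flat_deriv\<close> from the polynomial 1 gives all derivatives
    of \<open>flat 1\<close>; the two further sequences incorporate the shift by 1/4 and the
    normalization.\<close>
  define D where "D n = flat ((flat_deriv ^^ n) 1)" for n
  have D: "(D n has_real_derivative D (Suc n) t) (at t)" for n t
    unfolding D_def using flat_has_derivative by simp
  define D' where "D' n t = D n (t - 1/4)" for n t
  have D': "(D' n has_real_derivative D' (Suc n) t) (at t)" for n t
  proof -
    have "((\<lambda>t. t - 1/4) has_real_derivative 1) (at t)"
      by (auto intro!: derivative_eq_intros)
    from DERIV_chain2[OF D this] show ?thesis by (simp add: D'_def[abs_def])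
  qed
  define D'' where "D'' n t = D n t / flat 1 (flat 1 (3/4))" for n t
  have D'': "(D'' n has_real_derivative D'' (Suc n) t) (at t)" for n t
    unfolding D''_def using DERIV_cdivide[OF D] by blast
  have "symmetric_partials (\<lambda>x. D'' 0 (flat 1 (3/4) - D' 0 ((norm (x - a))\<^sup>2 / r\<^sup>2)))"
    by (rule symmetric_partials_compose_field[where D = D'', OF D'' symmetric_partials_const_diff[OF
            symmetric_partials_compose_field[where D = D', OF D' symmetric_partials_norm_square]]])
  moreover have "(\<lambda>x. D'' 0 (flat 1 (3/4) - D' 0 ((norm (x - a))\<^sup>2 / r\<^sup>2))) = cutoff a r"
    by (simp add: D_def D'_def D''_def cutoff_def fun_eq_iff)
  ultimately show ?thesis by simp
qed

lemma smooth_on_cutoff: "smooth_on UNIV (cutoff a r)"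
  using symmetric_partials_cutoff by (simp add: symmetric_partials_def)

lemma test_functionI:
  assumes "smooth_on UNIV \<phi>" "compact K" "K \<subseteq> U" "\<And>x. x \<notin> K \<Longrightarrow> \<phi> x = 0"
  shows "test_function U \<phi>"
proof -
  have "{x. \<phi> x \<noteq> 0} \<subseteq> K" using assms(4) by blast
  then have "closure {x. \<phi> x \<noteq> 0} \<subseteq> K" using assms(2) by (simp add: closure_minimal compact_imp_closed)
  moreover have "bounded {x. \<phi> x \<noteq> 0}"
    using \<open>{x. \<phi> x \<noteq> 0} \<subseteq> K\<close> assms(2) bounded_subset compact_imp_bounded by blast
  ultimately show ?thesis using assms by (auto simp: test_function_def)
qed

definition ccut :: "real ^ 3 \<Rightarrow> real \<Rightarrow> real ^ 3 \<Rightarrow> complex" where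
  "ccut a r x = complex_of_real (cutoff a r x)"

lemma smooth_on_ccut: "smooth_on UNIV (ccut a r)"
  unfolding ccut_def[abs_def]
  by (rule smooth_on_bounded_linear[OF bounded_linear_of_real open_UNIV smooth_on_cutoff])

lemma ccut_outside: "r > 0 \<Longrightarrow> x \<notin> cball a r \<Longrightarrow> ccut a r x = 0"
  using cutoff_outside[of r x a] by (simp add: ccut_def dist_norm norm_minus_commute)

lemma partial_ccut: "partial i (ccut a r) x = of_real (partial i (cutoff a r) x)"
  unfolding ccut_def[abs_def]
  by (rule partial_bounded_linear[OF bounded_linear_of_real smooth_onD(1)[OF smooth_on_cutoff UNIV_I]])

lemma partial_partial_ccut:
  "partial i (partial j (ccut a r)) x = of_real (partial i (partial j (cutoff a r)) x)"
proof -
  have "partial j (ccut a r) = (\<lambda>x. complex_of_real (partial j (cutoff a r) x))"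
    using partial_ccut by blast
  then show ?thesis
    using partial_bounded_linear[OF bounded_linear_of_real
        smooth_onD(1)[OF smooth_onD(2)[OF smooth_on_cutoff] UNIV_I]] by simp
qed

lemma ccut_symmetric: "partial i (partial j (ccut a r)) x = partial j (partial i (ccut a r)) x"
  using symmetric_partials_cutoff by (simp add: partial_partial_ccut symmetric_partials_def)

text \<open>Cut-offs suffice as test functions: if \<open>G a\<close> is nonzero, the real part of
  cnj (G a) G is positive near \<open>a\<close>, and a cut-off supported there would give a nonzero
  integral.\<close>

lemma fundamental_lemma_variations:
  fixes G :: "real ^ 3 \<Rightarrow> complex"
  assumes U: "open U" and G: "continuous_on U G"
    and int: "\<And>a r. r > 0 \<Longrightarrow> cball a r \<subseteq> U \<Longrightarrow> (LINT x|lebesgue. G x * ccut a r x) = 0"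
    and a: "a \<in> U"
  shows "G a = 0"
proof (rule ccontr)
  assume Ga: "G a \<noteq> 0"
  define h where "h x = Re (cnj (G a) * G x)" for x
  have "h a > 0" using Ga by (simp add: h_def complex_neq_0 power2_eq_square)
  have h: "continuous_on U h" unfolding h_def by (intro continuous_intros G)
  have "open (U \<inter> h -` {0<..})" by (rule continuous_open_preimage[OF h U open_greaterThan])
  moreover have "a \<in> U \<inter> h -` {0<..}" using a \<open>h a > 0\<close> by simp
  ultimately obtain \<delta> where \<delta>: "\<delta> > 0" "ball a \<delta> \<subseteq> U \<inter> h -` {0<..}" by (rule openE)
  define r where "r = \<delta> / 2"
  have r: "r > 0" "cball a r \<subseteq> ball a \<delta>" using \<delta>(1) by (auto simp: r_def)
  define f where "f x = h x * cutoff a r x" for x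
  have c0: "cutoff a r x = 0" if "x \<notin> cball a r" for x
    using cutoff_outside[of r x a] r(1) that by (simp add: dist_norm norm_minus_commute)
  have cc: "continuous_on UNIV (cutoff a r)" by (rule smooth_onD(3)[OF smooth_on_cutoff])
  have sub: "cball a r \<subseteq> U" using r(2) \<delta>(2) by blast
  have f0: "f x \<ge> 0" for x
  proof (cases "x \<in> cball a r")
    case True
    then have "h x > 0" using r(2) \<delta>(2) by auto
    then show ?thesis using cutoff_nonneg[of a r x] by (simp add: f_def)
  next
    case False
    then show ?thesis by (simp add: f_def c0)
  qed
  have "continuous_on (cball a r) f"
    unfolding f_def by (intro continuous_on_mult continuous_on_subset[OF h sub]
        continuous_on_subset[OF cc subset_UNIV])
  then have fint: "integrable lebesgue f"
    by (rule integrable_lebesgue_compact_support) (auto simp: f_def c0)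
  have Gint: "integrable lebesgue (\<lambda>x. G x * ccut a r x)"
  proof (rule integrable_lebesgue_compact_support[of "cball a r"])
    show "continuous_on (cball a r) (\<lambda>x. G x * ccut a r x)"
      by (intro continuous_on_mult continuous_on_subset[OF G sub]
        continuous_on_subset[OF smooth_onD(3)[OF smooth_on_ccut] subset_UNIV])
  qed (use ccut_outside r(1) in auto)
  have "f x = Re (cnj (G a) * (G x * ccut a r x))" for x
    by (simp add: f_def h_def ccut_def distrib_right mult.assoc)
  then have "(LINT x|lebesgue. f x) = (LINT x|lebesgue. Re (cnj (G a) * (G x * ccut a r x)))" by simp
  also have "\<dots> = Re (LINT x|lebesgue. cnj (G a) * (G x * ccut a r x))"
    by (rule integral_Re) (intro integrable_mult_right Gint)
  also have "\<dots> = 0" using int[OF r(1) sub] by simp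
  finally have "AE x in lebesgue. f x = 0"
    using integral_nonneg_eq_0_iff_AE[OF fint] f0 by simp
  then obtain N where N: "{x \<in> space lebesgue. \<not> f x = 0} \<subseteq> N" "N \<in> null_sets lebesgue"
    by (auto simp: eventually_ae_filter)
  then have "negligible {x. f x \<noteq> 0}"
    using negligible_subset[of N "{x. f x \<noteq> 0}"] by (simp add: negligible_iff_null_sets)
  \<comment> \<open>On the plateau of the cut-off the integrand is positive, so a null set would
    contain a ball.\<close>
  moreover have "ball a (r / 2) \<subseteq> {x. f x \<noteq> 0}"
  proof
    fix x assume x: "x \<in> ball a (r / 2)"
    then have "cutoff a r x = 1" using r(1) by (intro cutoff_inside) (auto simp: dist_norm norm_minus_commute)
    moreover have "x \<in> ball a \<delta>" using x r(1) by (auto simp: r_def)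
    then have "h x > 0" using \<delta>(2) by auto
    ultimately show "x \<in> {x. f x \<noteq> 0}" by (simp add: f_def)
  qed
  ultimately have "negligible (ball a (r / 2))"
    by (rule negligible_subset)
  then show False using open_not_negligible[of "ball a (r / 2)"] r(1) by simp
qed

text \<open>Symmetry is transferred from the cut-offs: two integrations by parts move both
  derivatives onto a cut-off, where they commute, and the fundamental lemma returns the identity to
  \<psi>.\<close>

lemma partial_commute:
  fixes \<psi> :: "real ^ 3 \<Rightarrow> complex"
  assumes U: "open U" and \<psi>: "smooth_on U \<psi>" and x: "x \<in> U"
  shows "partial i (partial j \<psi>) x = partial j (partial i \<psi>) x"
proof -
  have C: "Ck_on 1 U \<psi>" "Ck_on 1 U (partial m \<psi>)" for m
    using \<psi> smooth_onD(2)[OF \<psi>] by (auto simp: smooth_on_def)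
  have swap: "(LINT x|lebesgue. partial m (partial n \<psi>) x * ccut a r x)
      = (LINT x|lebesgue. \<psi> x * partial n (partial m (ccut a r)) x)"
    if ar: "r > 0" "cball a r \<subseteq> U" for a r m n
  proof -
    have p0: "partial m (ccut a r) x = 0" if "x \<notin> cball a r" for x
      by (rule partial_eq_0_outside[of "cball a r"]) (use that ccut_outside ar(1) in auto)
    have Cc: "Ck_on 1 UNIV (ccut a r)" "Ck_on 1 UNIV (partial m (ccut a r))"
      using smooth_on_ccut smooth_onD(2)[OF smooth_on_ccut] unfolding smooth_on_def by blast+
    have "(LINT x|lebesgue. partial m (partial n \<psi>) x * ccut a r x)
        = - (LINT x|lebesgue. partial n \<psi> x * partial m (ccut a r) x)"
      by (rule integration_by_parts(3)[OF U C(2) Cc(1) compact_cball ar(2) ccut_outside[OF ar(1)]])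
    also have "(LINT x|lebesgue. partial n \<psi> x * partial m (ccut a r) x)
        = - (LINT x|lebesgue. \<psi> x * partial n (partial m (ccut a r)) x)"
      by (rule integration_by_parts(3)[OF U C(1) Cc(2) compact_cball ar(2) p0])
    finally show ?thesis by simp
  qed
  have cont: "continuous_on U (partial m (partial n \<psi>))" for m n
    by (intro smooth_onD(3) smooth_onD(2) \<psi>)
  have int: "integrable lebesgue (\<lambda>x. partial m (partial n \<psi>) x * ccut a r x)"
    if ar: "r > 0" "cball a r \<subseteq> U" for a r m n
  proof (rule integrable_lebesgue_compact_support[of "cball a r"])
    show "continuous_on (cball a r) (\<lambda>x. partial m (partial n \<psi>) x * ccut a r x)"
      by (intro continuous_on_mult continuous_on_subset[OF cont ar(2)]
        continuous_on_subset[OF smooth_onD(3)[OF smooth_on_ccut] subset_UNIV])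
  qed (use ccut_outside[OF ar(1)] in auto)
  have "partial i (partial j \<psi>) x - partial j (partial i \<psi>) x = 0"
  proof (rule fundamental_lemma_variations[OF U _ _ x])
    show "continuous_on U (\<lambda>x. partial i (partial j \<psi>) x - partial j (partial i \<psi>) x)"
      by (intro continuous_on_diff cont)
    show "(LINT x|lebesgue. (partial i (partial j \<psi>) x - partial j (partial i \<psi>) x) * ccut a r x) = 0"
      if ar: "r > 0" "cball a r \<subseteq> U" for a r
      unfolding left_diff_distrib Bochner_Integration.integral_diff[OF int[OF ar] int[OF ar]]
        swap[OF ar] by (simp add: ccut_symmetric[of i j])
  qed
  then show ?thesis by simp
qed

section \<open>Maxwell equations off the sources\<close>

lemma bounded_linear_axis: "bounded_linear (axis m :: complex \<Rightarrow> complex ^ 3)"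
  by (rule linear_conv_bounded_linear[THEN iffD1], rule linearI) (auto simp: axis_def vec_eq_iff)

lemma vec_axis_sum: "(v :: complex ^ 3) = (\<Sum>m\<in>UNIV. axis m (v $ m))"
  by (simp add: vec_eq_iff axis_def)

lemma smooth_on_nth_iff:
  fixes F :: "real ^ 3 \<Rightarrow> complex ^ 3"
  assumes "open U"
  shows "smooth_on U F \<longleftrightarrow> (\<forall>m. smooth_on U (\<lambda>x. F x $ m))"
proof
  show "\<forall>m. smooth_on U (\<lambda>x. F x $ m)" if "smooth_on U F"
    using smooth_on_bounded_linear[OF bounded_linear_vec_nth assms that] by blast
  assume "\<forall>m. smooth_on U (\<lambda>x. F x $ m)"
  then have "smooth_on U (\<lambda>x. \<Sum>m\<in>UNIV. axis m (F x $ m))"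
    using assms by (intro smooth_on_sum smooth_on_bounded_linear[OF bounded_linear_axis]) auto
  then show "smooth_on U F" by (simp add: vec_axis_sum[symmetric])
qed

lemma partial_nth:
  "F differentiable (at x) \<Longrightarrow> partial i (\<lambda>y. F y $ m) x = partial i F x $ m"
  by (rule partial_bounded_linear[OF bounded_linear_vec_nth])

lemma curl_nth:
  "curl F x $ 1 = partial 2 F x $ 3 - partial 3 F x $ 2"
  "curl F x $ 2 = partial 3 F x $ 1 - partial 1 F x $ 3"
  "curl F x $ 3 = partial 1 F x $ 2 - partial 2 F x $ 1"
  by (simp_all add: curl_def)

lemma smooth_on_curl:
  assumes "open U" "smooth_on U F"
  shows "smooth_on U (curl F)"
proof -
  have *: "smooth_on U (\<lambda>x. partial i F x $ m)" for i m
    using smooth_onD(2)[OF assms(2)] smooth_on_nth_iff[OF assms(1)] by blast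
  have "smooth_on U (\<lambda>x. curl F x $ m)" for m
    using exhaust_3[of m] by (auto simp: curl_nth intro!: smooth_on_diff assms(1) *)
  then show ?thesis using smooth_on_nth_iff[OF assms(1)] by blast
qed

lemma curl_eq_0_outside:
  assumes "closed K" "\<And>x. x \<notin> K \<Longrightarrow> F x = 0" "x \<notin> K"
  shows "curl F x = 0"
  by (simp add: curl_def partial_eq_0_outside[OF assms] vec_eq_iff forall_3)

lemma cdot_3: "cdot u v = u $ 1 * v $ 1 + u $ 2 * v $ 2 + u $ 3 * v $ 3"
  by (simp add: cdot_def sum_3)

text \<open>Each of the six terms is integrated by parts. The minus sign is compensated by the
  antisymmetry of the curl, which is therefore its own adjoint for the bilinear pairing.\<close>

lemma curl_integration_by_parts:
  fixes F \<psi> :: "real ^ 3 \<Rightarrow> complex ^ 3"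
  assumes U: "open U" and F: "smooth_on U F" and \<psi>: "smooth_on UNIV \<psi>"
    and K: "compact K" "K \<subseteq> U" "\<And>x. x \<notin> K \<Longrightarrow> \<psi> x = 0"
  shows "(LINT x|lebesgue. cdot (curl F x) (\<psi> x)) = (LINT x|lebesgue. cdot (F x) (curl \<psi> x))"
proof -
  define A where "A i m n x = partial i (\<lambda>y. F y $ m) x * \<psi> x $ n" for i m n x
  define B where "B i m n x = F x $ m * partial i (\<lambda>y. \<psi> y $ n) x" for i m n x
  have F1: "Ck_on 1 U (\<lambda>y. F y $ m)" for m
    using F smooth_on_nth_iff[OF U] by (auto simp: smooth_on_def)
  have \<psi>1: "Ck_on 1 UNIV (\<lambda>y. \<psi> y $ m)" for m
    using \<psi> smooth_on_nth_iff[OF open_UNIV] by (auto simp: smooth_on_def)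
  have \<psi>0: "\<psi> x $ n = 0" if "x \<notin> K" for x n using K(3)[OF that] by simp
  note ibp = integration_by_parts[OF U F1 \<psi>1 K(1,2) \<psi>0]
  have A: "integrable lebesgue (A i m n)" for i m n
    unfolding A_def[abs_def] by (rule ibp(1))
  have B: "integrable lebesgue (B i m n)" for i m n
    unfolding B_def[abs_def] using ibp(2)[where i = i] by simp
  have AB: "integral\<^sup>L lebesgue (A i m n) = - integral\<^sup>L lebesgue (B i m n)" for i m n
    unfolding A_def[abs_def] B_def[abs_def] by (rule ibp(3))
  have 1: "cdot (curl F x) (\<psi> x) = A 2 3 1 x - A 3 2 1 x + (A 3 1 2 x - A 1 3 2 x) + (A 1 2 3 x - A 2 1 3 x)" for x
  proof (cases "x \<in> U")
    case True
    then show ?thesis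
      using smooth_onD(1)[OF F] by (simp add: cdot_3 curl_nth A_def partial_nth left_diff_distrib)
  next
    case False
    then have "x \<notin> K" using K(2) by blast
    then show ?thesis using K(3) by (simp add: cdot_3 A_def)
  qed
  have 2: "cdot (F x) (curl \<psi> x) = B 2 1 3 x - B 3 1 2 x + (B 3 2 1 x - B 1 2 3 x) + (B 1 3 2 x - B 2 3 1 x)" for x
    using smooth_onD(1)[OF \<psi>] by (simp add: cdot_3 curl_nth B_def partial_nth right_diff_distrib)
  have "(LINT x|lebesgue. cdot (curl F x) (\<psi> x)) = integral\<^sup>L lebesgue (A 2 3 1) - integral\<^sup>L lebesgue (A 3 2 1)
      + (integral\<^sup>L lebesgue (A 3 1 2) - integral\<^sup>L lebesgue (A 1 3 2))
      + (integral\<^sup>L lebesgue (A 1 2 3) - integral\<^sup>L lebesgue (A 2 1 3))"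
    unfolding 1 by (simp add: A)
  moreover have "(LINT x|lebesgue. cdot (F x) (curl \<psi> x)) = integral\<^sup>L lebesgue (B 2 1 3) - integral\<^sup>L lebesgue (B 3 1 2)
      + (integral\<^sup>L lebesgue (B 3 2 1) - integral\<^sup>L lebesgue (B 1 2 3))
      + (integral\<^sup>L lebesgue (B 1 3 2) - integral\<^sup>L lebesgue (B 2 3 1))"
    unfolding 2 by (simp add: B)
  ultimately show ?thesis by (simp add: AB)
qed

lemma cdot_diff_right: "cdot u (v - w) = cdot u v - cdot u w"
  and cdot_diff_left: "cdot (u - v) w = cdot u w - cdot v w"
  and cdot_smult_right: "cdot u (c *s v) = c * cdot u v"
  and cdot_smult_left: "cdot (c *s u) v = c * cdot u v"
  by (simp_all add: cdot_3 algebra_simps)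

lemma continuous_on_cdot:
  "continuous_on S F \<Longrightarrow> continuous_on S G \<Longrightarrow> continuous_on S (\<lambda>x. cdot (F x) (G x))"
  by (auto simp: cdot_def intro!: continuous_intros)

lemma integrable_cdot:
  fixes F \<psi> :: "real ^ 3 \<Rightarrow> complex ^ 3"
  assumes "continuous_on K F" "continuous_on UNIV \<psi>" "compact K" "\<And>x. x \<notin> K \<Longrightarrow> \<psi> x = 0"
  shows "integrable lebesgue (\<lambda>x. cdot (F x) (\<psi> x))"
  by (rule integrable_lebesgue_compact_support[OF continuous_on_cdot[OF assms(1)
          continuous_on_subset[OF assms(2) subset_UNIV]] assms(3)])
    (use assms(4) in \<open>simp add: cdot_def\<close>)

text \<open>Two integrations by parts move both curls onto \<open>W\<close>; a cut-off times a
  coordinate vector then tests one component at a time.\<close>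

lemma weak_Maxwell_imp_strong:
  fixes W :: "real ^ 3 \<Rightarrow> complex ^ 3"
  assumes U: "open U" and W: "smooth_on U W"
    and weak: "\<And>\<phi>. test_function U \<phi> \<Longrightarrow>
      (LINT x|lebesgue. cdot (W x) (curl (curl \<phi>) x - c *s \<phi> x)) = 0"
    and x: "x \<in> U"
  shows "curl (curl W) x = c *s W x"
proof -
  have s: "smooth_on U (curl W)" "smooth_on U (curl (curl W))"
    using W smooth_on_curl[OF U] by auto
  have G: "continuous_on U (\<lambda>x. (curl (curl W) x - c *s W x) $ m)" for m
    using smooth_onD(3)[OF W] smooth_onD(3)[OF s(2)]
    by (auto intro!: continuous_intros continuous_on_component simp: vector_smult_component)
  have "(curl (curl W) x - c *s W x) $ m = 0" for m
  proof (rule fundamental_lemma_variations[OF U G _ x])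
    fix a :: "real^3" and r :: real
    assume ar: "r > 0" "cball a r \<subseteq> U"
    define \<phi> where "\<phi> = (\<lambda>x. axis m (ccut a r x) :: complex^3)"
    have \<phi>s: "smooth_on UNIV \<phi>"
      unfolding \<phi>_def by (rule smooth_on_bounded_linear[OF bounded_linear_axis open_UNIV smooth_on_ccut])
    have \<phi>0: "\<phi> x = 0" if "x \<notin> cball a r" for x
      using ccut_outside[OF ar(1) that] by (simp add: \<phi>_def axis_def vec_eq_iff)
    have c0: "curl \<phi> x = 0" if "x \<notin> cball a r" for x
      by (rule curl_eq_0_outside[OF closed_cball \<phi>0 that])
    have cc0: "curl (curl \<phi>) x = 0" if "x \<notin> cball a r" for x
      by (rule curl_eq_0_outside[OF closed_cball c0 that])
    have cs: "smooth_on UNIV (curl \<phi>)" "smooth_on UNIV (curl (curl \<phi>))"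
      using \<phi>s smooth_on_curl[OF open_UNIV] by auto
    have cW: "continuous_on (cball a r) W" "continuous_on (cball a r) (curl (curl W))"
      using smooth_onD(3)[OF W] smooth_onD(3)[OF s(2)] continuous_on_subset ar(2) by blast+
    have "test_function U \<phi>" by (rule test_functionI[OF \<phi>s compact_cball ar(2) \<phi>0])
    from weak[OF this] have "(LINT x|lebesgue. cdot (W x) (curl (curl \<phi>) x)) - c * (LINT x|lebesgue. cdot (W x) (\<phi> x)) = 0"
      using integrable_cdot[OF cW(1) smooth_onD(3)[OF cs(2)] compact_cball cc0]
        integrable_cdot[OF cW(1) smooth_onD(3)[OF \<phi>s] compact_cball \<phi>0]
      by (simp add: cdot_diff_right cdot_smult_right)
    also have "(LINT x|lebesgue. cdot (W x) (curl (curl \<phi>) x)) = (LINT x|lebesgue. cdot (curl W x) (curl \<phi> x))"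
      by (rule curl_integration_by_parts[OF U W cs(1) compact_cball ar(2) c0, symmetric])
    also have "\<dots> = (LINT x|lebesgue. cdot (curl (curl W) x) (\<phi> x))"
      by (rule curl_integration_by_parts[OF U s(1) \<phi>s compact_cball ar(2) \<phi>0, symmetric])
    finally have "(LINT x|lebesgue. cdot (curl (curl W) x - c *s W x) (\<phi> x)) = 0"
      using integrable_cdot[OF cW(1) smooth_onD(3)[OF \<phi>s] compact_cball \<phi>0]
        integrable_cdot[OF cW(2) smooth_onD(3)[OF \<phi>s] compact_cball \<phi>0]
      by (simp add: cdot_diff_left cdot_smult_left)
    moreover have "cdot v (\<phi> x) = v $ m * ccut a r x" for v x
      using exhaust_3[of m] by (auto simp: cdot_3 \<phi>_def axis_def)
    ultimately show "(LINT x|lebesgue. (curl (curl W) x - c *s W x) $ m * ccut a r x) = 0" by simp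
  qed
  then show ?thesis by (simp add: vec_eq_iff)
qed

section \<open>Energy flux and decay\<close>

text \<open>A divergence theorem on a shell without boundary terms: \<open>h\<close> vanishes on the
  inner sphere and the weight on the outer one, so the weighted function extends by zero to a
  Lipschitz function with kinks on two spheres only. The integrand is its partial
  derivative.\<close>

lemma shell_integral:
  fixes h :: "real ^ 3 \<Rightarrow> complex"
  assumes U: "open U" "{x. R \<le> norm x} \<subseteq> U" and h: "Ck_on 1 U h"
    and h0: "\<And>x. norm x = R \<Longrightarrow> h x = 0" and R: "0 < R" "R < \<rho>"
  shows "has_bochner_integral lebesgue (\<lambda>x. indicator {x. R < norm x \<and> norm x < \<rho>} x *\<^sub>R
    (of_real (\<rho>\<^sup>2 - (norm x)\<^sup>2) * partial i h x - of_real (2 * x $ i) * h x)) 0"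
proof -
  define S where "S = {x::real^3. R < norm x \<and> norm x < \<rho>}"
  define A where "A = {x::real^3. R \<le> norm x \<and> norm x \<le> \<rho>}"
  define g where "g x = complex_of_real (\<rho>\<^sup>2 - (norm x)\<^sup>2) * h x" for x
  define P where "P j x = complex_of_real (\<rho>\<^sup>2 - (norm x)\<^sup>2) * partial j h x - of_real (2 * x $ j) * h x" for j x
  have S: "open S"
  proof -
    have "S = {x. R < norm x} \<inter> {x. norm x < \<rho>}" by (auto simp: S_def)
    then show ?thesis by (simp add: open_Int open_Collect_less continuous_intros)
  qed
  have A: "compact A" unfolding A_def by (rule compact_shell)
  have SA: "S \<subseteq> A" "A \<subseteq> U" using U(2) by (auto simp: S_def A_def)
  have d2: "((\<lambda>x::real^3. complex_of_real (\<rho>\<^sup>2 - (norm x)\<^sup>2)) has_derivative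
      (\<lambda>v. of_real (- (x \<bullet> v + v \<bullet> x)))) (at x)" for x
  proof -
    have "((\<lambda>x::real^3. \<rho>\<^sup>2 - x \<bullet> x) has_derivative (\<lambda>v. 0 - (x \<bullet> v + v \<bullet> x))) (at x)"
      by (intro has_derivative_diff has_derivative_const has_derivative_inner has_derivative_ident)
    from bounded_linear.has_derivative[OF bounded_linear_of_real this]
    show ?thesis by (simp add: power2_norm_eq_inner)
  qed
  have hd: "h differentiable (at x)" if "x \<in> U" for x using h that by simp
  have hc: "continuous_on A h" "continuous_on A (partial j h)" for j
    using Ck_on_le[OF _ h, of 0] h by (auto intro: continuous_on_subset[OF _ SA(2)])
  have gd: "g differentiable (at x)" and gP: "partial j g x = P j x" if "x \<in> U" for x j
  proof -
    have dd: "(\<lambda>x::real^3. complex_of_real (\<rho>\<^sup>2 - (norm x)\<^sup>2)) differentiable (at x)"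
      using d2 by (auto simp: differentiable_def)
    show "g differentiable (at x)"
      unfolding g_def[abs_def] by (rule differentiable_bilinear[OF bounded_bilinear_mult dd hd[OF that]])
    have "partial j g x = complex_of_real (\<rho>\<^sup>2 - (norm x)\<^sup>2) * partial j h x
        + partial j (\<lambda>x. complex_of_real (\<rho>\<^sup>2 - (norm x)\<^sup>2)) x * h x"
      unfolding g_def[abs_def] by (rule partial_mult[OF dd hd[OF that]])
    then show "partial j g x = P j x"
      unfolding partial_eqI[OF d2] by (simp add: P_def inner_axis inner_axis')
  qed
  have Pc: "continuous_on A (P j)" for j
    unfolding P_def[abs_def] by (intro continuous_intros hc continuous_on_component)
  have gc: "continuous_on A g"
    unfolding g_def[abs_def] by (intro continuous_intros hc)
  define F where "F x = (if x \<in> S then g x else 0)" for x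
  have g0: "g x = 0" if "norm x = R \<or> norm x = \<rho>" for x using that h0 by (auto simp: g_def)
  have FA: "F x = g x" if "x \<in> A" for x
    using that g0[of x] by (auto simp: F_def S_def A_def)
  have Fc: "continuous_on UNIV F"
  proof -
    have B: "closed {x::real^3. norm x \<le> R \<or> \<rho> \<le> norm x}"
      by (intro closed_Collect_disj closed_Collect_le continuous_intros)
    have "continuous_on (A \<union> {x. norm x \<le> R \<or> \<rho> \<le> norm x}) F"
    proof (rule continuous_on_closed_Un[OF compact_imp_closed[OF A] B])
      show "continuous_on A F" using gc FA by (simp cong: continuous_on_cong)
      have "continuous_on {x. norm x \<le> R \<or> \<rho> \<le> norm x} (\<lambda>x. 0 :: complex)" by simp
      then show "continuous_on {x. norm x \<le> R \<or> \<rho> \<le> norm x} F"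
        by (rule continuous_on_cong[THEN iffD1, rotated 2]) (auto simp: F_def S_def)
    qed
    moreover have "A \<union> {x. norm x \<le> R \<or> \<rho> \<le> norm x} = UNIV" by (auto simp: A_def)
    ultimately show ?thesis by simp
  qed
  define F' where "F' x v = (if x \<in> S then \<Sum>j\<in>UNIV. v $ j *\<^sub>R partial j g x else 0)" for x and v :: "real^3"
  have "\<exists>M\<ge>0. \<forall>x\<in>A. norm (P j x) \<le> M" for j
  proof -
    have "bounded (P j ` A)" by (intro compact_imp_bounded compact_continuous_image Pc A)
    then obtain M where "M > 0" "\<And>x. x \<in> A \<Longrightarrow> norm (P j x) \<le> M" by (auto simp: bounded_pos)
    then show ?thesis by (intro exI[of _ M]) auto
  qed
  then obtain M where M: "\<And>j. M j \<ge> 0" "\<And>j x. x \<in> A \<Longrightarrow> norm (P j x) \<le> M j"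
    using choice[of "\<lambda>j M. M \<ge> 0 \<and> (\<forall>x\<in>A. norm (P j x) \<le> M)"] by blast
  have "(LINT x|lebesgue. indicator {x. norm x \<notin> {R, \<rho>}} x *\<^sub>R F' x (axis i 1)) = 0"
  proof (rule integral_directional_derivative_eq_0[OF Fc, where B = "\<Sum>j\<in>UNIV. M j" and r = \<rho>])
    show "(F has_derivative F' x) (at x)" if x: "norm x \<notin> {R, \<rho>}" for x
    proof (cases "x \<in> S")
      case True
      have "(g has_derivative (\<lambda>v. \<Sum>j\<in>UNIV. v $ j *\<^sub>R partial j g x)) (at x)"
        using gd True SA by (intro has_derivative_partial_sum) auto
      then have "(F has_derivative (\<lambda>v. \<Sum>j\<in>UNIV. v $ j *\<^sub>R partial j g x)) (at x)"
        by (rule has_derivative_transform_within_open[OF _ S True]) (simp add: F_def)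
      then show ?thesis using True by (simp add: F'_def[abs_def])
    next
      case False
      then have "x \<in> - A" using x by (auto simp: S_def A_def)
      have "((\<lambda>x. 0) has_derivative (\<lambda>v. 0)) (at x)" by simp
      then have "(F has_derivative (\<lambda>v. 0)) (at x)"
        by (rule has_derivative_transform_within_open[OF _ _ \<open>x \<in> - A\<close>])
          (use SA A in \<open>auto simp: F_def intro: compact_imp_closed\<close>)
      then show ?thesis using False by (simp add: F'_def[abs_def])
    qed
    show "0 \<le> (\<Sum>j\<in>UNIV. M j)" using M(1) by (simp add: sum_nonneg)
    show "norm (F' x v) \<le> (\<Sum>j\<in>UNIV. M j) * norm v" for x v
    proof (cases "x \<in> S")
      case True
      have "norm (\<Sum>j\<in>UNIV. v $ j *\<^sub>R partial j g x) \<le> (\<Sum>j\<in>UNIV. M j * norm v)"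
      proof (rule sum_norm_le)
        have "x \<in> A" "x \<in> U" using True SA by auto
        then show "norm (v $ j *\<^sub>R partial j g x) \<le> M j * norm v" for j
          using mult_mono[OF component_le_norm_cart[of v j] M(2)[of x j]] gP[of x j]
          by (simp add: mult.commute)
      qed
      then show ?thesis using True by (simp add: F'_def sum_distrib_right)
    next
      case False
      then show ?thesis using M(1) by (simp add: F'_def sum_nonneg)
    qed
    show "F x = 0" if "\<rho> \<le> norm x" for x using that by (simp add: F_def S_def)
  qed simp
  moreover have "indicator {x. norm x \<notin> {R, \<rho>}} x *\<^sub>R F' x (axis i 1) = indicator S x *\<^sub>R P i x" for x
  proof (cases "x \<in> S")
    case True
    then have "F' x (axis i 1) = P i x" using gP[of x i] SA by (auto simp: F'_def sum_axis_scaleR)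
    then show ?thesis using True by (simp add: S_def)
  qed (simp add: F'_def)
  ultimately have "(LINT x|lebesgue. indicator S x *\<^sub>R P i x) = 0" by simp
  moreover have "integrable lebesgue (\<lambda>x. indicator S x *\<^sub>R P i x)"
    by (rule integrable_on_subset_compact[OF A Pc SA(1) borel_open[OF S]])
  ultimately show ?thesis by (simp add: has_bochner_integral_iff P_def S_def)
qed

text \<open>The triple product n . (cnj w x c), a form of the complex Poynting flux through a
  surface with normal \<open>n\<close>.\<close>

definition flux_density :: "complex ^ 3 \<Rightarrow> complex ^ 3 \<Rightarrow> real ^ 3 \<Rightarrow> complex" where
  "flux_density w c n = of_real (n $ 1) * (cnj (w $ 2) * c $ 3 - cnj (w $ 3) * c $ 2)
     + of_real (n $ 2) * (cnj (w $ 3) * c $ 1 - cnj (w $ 1) * c $ 3)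
     + of_real (n $ 3) * (cnj (w $ 1) * c $ 2 - cnj (w $ 2) * c $ 1)"

text \<open>The integrand is the radial component of the imaginary part of
  $\overline W\times\nabla\times W$, whose divergence is real because of the Maxwell equation.\<close>

lemma energy_flux_eq_0:
  fixes W :: "real ^ 3 \<Rightarrow> complex ^ 3"
  assumes U: "open U" "{x. R \<le> norm x} \<subseteq> U" and W: "smooth_on U W"
    and W0: "\<And>x. norm x = R \<Longrightarrow> W x = 0"
    and Maxwell: "\<And>x. x \<in> U \<Longrightarrow> curl (curl W) x = of_real c *s W x"
    and R: "0 < R" "R < \<rho>"
  shows "has_bochner_integral lebesgue (\<lambda>x. indicator {x. R < norm x \<and> norm x < \<rho>} x *\<^sub>R
    Im (flux_density (W x) (curl W x) x)) 0"
proof -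
  define S where "S = {x::real^3. R < norm x \<and> norm x < \<rho>}"
  define C where "C = curl W"
  have C: "smooth_on U C" unfolding C_def by (rule smooth_on_curl[OF U(1) W])
  \<comment> \<open>The index pairs (2,3), (3,1), (1,2) give the three components of cnj W x
    C.\<close>
  define h where "h a b x = cnj (W x $ a) * C x $ b - cnj (W x $ b) * C x $ a" for a b x
  have Wn: "smooth_on U (\<lambda>x. W x $ a)" "smooth_on U (\<lambda>x. C x $ a)" for a
    using W C smooth_on_nth_iff[OF U(1)] by blast+
  have Wc: "smooth_on U (\<lambda>x. cnj (W x $ a))" for a
    by (rule smooth_on_bounded_linear[OF bounded_linear_cnj U(1) Wn(1)])
  have hs: "smooth_on U (h a b)" for a b
    unfolding h_def[abs_def] by (intro smooth_on_diff smooth_on_mult Wc Wn U(1))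
  then have h1: "Ck_on 1 U (h a b)" for a b unfolding smooth_on_def by blast
  have h0: "h a b x = 0" if "norm x = R" for a b x using W0[OF that] by (simp add: h_def)
  have hp: "partial i (h a b) x = cnj (W x $ a) * partial i C x $ b + cnj (partial i W x $ a) * C x $ b
      - (cnj (W x $ b) * partial i C x $ a + cnj (partial i W x $ b) * C x $ a)" if x: "x \<in> U" for i a b x
  proof -
    have d: "(\<lambda>x. cnj (W x $ a)) differentiable (at x)" "(\<lambda>x. C x $ a) differentiable (at x)" for a
      using smooth_onD(1)[OF Wc x] smooth_onD(1)[OF Wn(2) x] .
    have pW: "partial i (\<lambda>x. cnj (W x $ a)) x = cnj (partial i W x $ a)" for a
      using partial_bounded_linear[OF bounded_linear_cnj smooth_onD(1)[OF Wn(1) x]]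
        partial_nth[OF smooth_onD(1)[OF W x]] by simp
    have pC: "partial i (\<lambda>x. C x $ a) x = partial i C x $ a" for a
      by (rule partial_nth[OF smooth_onD(1)[OF C x]])
    show ?thesis
      unfolding h_def[abs_def]
      by (simp add: partial_diff partial_mult differentiable_bilinear[OF bounded_bilinear_mult] d pW pC)
  qed
  note sh = shell_integral[OF U h1 h0 R]
  define T where "T i a b x = indicator S x *\<^sub>R
    (of_real (\<rho>\<^sup>2 - (norm x)\<^sup>2) * partial i (h a b) x - of_real (2 * x $ i) * h a b x)" for i a b x
  have T: "has_bochner_integral lebesgue (T i a b) 0" for i a b
    unfolding T_def[abs_def] S_def by (rule sh)
  have "has_bochner_integral lebesgue (\<lambda>x. T 1 2 3 x + T 2 3 1 x + T 3 1 2 x) (0 + 0 + 0)"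
    by (intro has_bochner_integral_add T)
  then have "has_bochner_integral lebesgue (\<lambda>x. Im (T 1 2 3 x + T 2 3 1 x + T 3 1 2 x)) (Im (0 + 0 + 0))"
    by (rule has_bochner_integral_bounded_linear[OF bounded_linear_Im])
  \<comment> \<open>The weighted divergence is real and disappears under \<open>Im\<close>; only the
    contribution of the gradient of the weight, -2 x, survives.\<close>
  moreover have "Im (T 1 2 3 x + T 2 3 1 x + T 3 1 2 x)
      = - 2 * (indicator S x *\<^sub>R Im (flux_density (W x) (C x) x))" for x
  proof (cases "x \<in> S")
    case True
    then have x: "x \<in> U" using U(2) by (auto simp: S_def)
    have k: "curl C x = of_real c *s W x" using Maxwell[OF x] by (simp add: C_def)
    have k': "of_real c * W x $ 1 = partial 2 C x $ 3 - partial 3 C x $ 2"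
      "of_real c * W x $ 2 = partial 3 C x $ 1 - partial 1 C x $ 3"
      "of_real c * W x $ 3 = partial 1 C x $ 2 - partial 2 C x $ 1"
      using k curl_nth[of C x] by (auto simp: vec_eq_iff)
    have c': "C x $ 1 = partial 2 W x $ 3 - partial 3 W x $ 2"
      "C x $ 2 = partial 3 W x $ 1 - partial 1 W x $ 3"
      "C x $ 3 = partial 1 W x $ 2 - partial 2 W x $ 1"
      using curl_nth[of W x] by (auto simp: C_def)
    \<comment> \<open>div (cnj W x C) = cnj (curl W) . C - cnj W . curl C, which by the Maxwell
      equation is |C|^2 - c |W|^2.\<close>
    have "partial 1 (h 2 3) x + partial 2 (h 3 1) x + partial 3 (h 1 2) x
        = cnj (partial 2 W x $ 3 - partial 3 W x $ 2) * C x $ 1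
        + cnj (partial 3 W x $ 1 - partial 1 W x $ 3) * C x $ 2
        + cnj (partial 1 W x $ 2 - partial 2 W x $ 1) * C x $ 3
        - (cnj (W x $ 1) * (partial 2 C x $ 3 - partial 3 C x $ 2)
          + cnj (W x $ 2) * (partial 3 C x $ 1 - partial 1 C x $ 3)
          + cnj (W x $ 3) * (partial 1 C x $ 2 - partial 2 C x $ 1))"
      by (simp add: hp[OF x] algebra_simps)
    also have "\<dots> = cnj (C x $ 1) * C x $ 1 + cnj (C x $ 2) * C x $ 2 + cnj (C x $ 3) * C x $ 3
        - (cnj (W x $ 1) * (of_real c * W x $ 1) + cnj (W x $ 2) * (of_real c * W x $ 2)
          + cnj (W x $ 3) * (of_real c * W x $ 3))"
      by (simp only: c'[symmetric] k'[symmetric])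
    finally have div: "partial 1 (h 2 3) x + partial 2 (h 3 1) x + partial 3 (h 1 2) x = \<dots>" .
    have "Im (partial 1 (h 2 3) x + partial 2 (h 3 1) x + partial 3 (h 1 2) x) = 0"
      unfolding div by (simp add: algebra_simps)
    moreover have "T 1 2 3 x + T 2 3 1 x + T 3 1 2 x
        = of_real (\<rho>\<^sup>2 - (norm x)\<^sup>2) * (partial 1 (h 2 3) x + partial 2 (h 3 1) x + partial 3 (h 1 2) x)
        - of_real 2 * flux_density (W x) (C x) x"
      using True by (simp add: T_def flux_density_def h_def algebra_simps)
    ultimately show ?thesis using True by (simp del: of_real_diff of_real_power)
  next
    case False
    then show ?thesis by (simp add: T_def)
  qed
  ultimately have "has_bochner_integral lebesgue (\<lambda>x. - 2 * (indicator S x *\<^sub>R Im (flux_density (W x) (C x) x))) 0"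
    by simp
  from has_bochner_integral_mult_right[OF this, of "- 1/2"]
  show ?thesis by (simp add: S_def C_def)
qed

lemma norm_complex3: "(norm (v :: complex ^ 3))\<^sup>2 = (cmod (v $ 1))\<^sup>2 + (cmod (v $ 2))\<^sup>2 + (cmod (v $ 3))\<^sup>2"
  by (simp add: norm_vec_def L2_set_def sum_3)

lemma flux_density_scaleR: "flux_density w c (a *\<^sub>R n) = of_real a * flux_density w c n"
  by (simp add: flux_density_def algebra_simps)

text \<open>Expanding the square on the right gives |c x n|^2 in addition to the left-hand side,
  because the cross term is -2 k times the imaginary flux. Once the flux integrates to zero, a small
  radiation defect alone controls \<open>w\<close>.\<close>

lemma flux_density_radiation_bound:
  "k\<^sup>2 * (norm w)\<^sup>2 - 2 * k * Im (flux_density w c n)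
    \<le> (norm (ccross c (cvec n) - (\<i> * of_real k) *s w))\<^sup>2"
proof -
  define y where "y = ccross c (cvec n)"
  have y: "flux_density w c n = y $ 1 * cnj (w $ 1) + y $ 2 * cnj (w $ 2) + y $ 3 * cnj (w $ 3)"
    by (simp add: flux_density_def y_def ccross_def cvec_def algebra_simps)
  have *: "k\<^sup>2 * (cmod b)\<^sup>2 - 2 * k * Im (a * cnj b) \<le> (cmod (a - \<i> * of_real k * b))\<^sup>2" for a b
  proof -
    have "(cmod (a - \<i> * of_real k * b))\<^sup>2
        = (k\<^sup>2 * (cmod b)\<^sup>2 - 2 * k * Im (a * cnj b)) + ((Re a)\<^sup>2 + (Im a)\<^sup>2)"
      unfolding cmod_power2 by (simp add: power2_eq_square algebra_simps)
    then show ?thesis by simp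
  qed
  have "k\<^sup>2 * (norm w)\<^sup>2 - 2 * k * Im (flux_density w c n)
      = (k\<^sup>2 * (cmod (w $ 1))\<^sup>2 - 2 * k * Im (y $ 1 * cnj (w $ 1)))
      + (k\<^sup>2 * (cmod (w $ 2))\<^sup>2 - 2 * k * Im (y $ 2 * cnj (w $ 2)))
      + (k\<^sup>2 * (cmod (w $ 3))\<^sup>2 - 2 * k * Im (y $ 3 * cnj (w $ 3)))"
    unfolding y norm_complex3 by (simp add: distrib_left)
  also have "\<dots> \<le> (norm (y - (\<i> * of_real k) *s w))\<^sup>2"
    unfolding norm_complex3 using *[of "w $ 1" "y $ 1"] *[of "w $ 2" "y $ 2"] *[of "w $ 3" "y $ 3"]
    by simp
  finally show ?thesis by (simp add: y_def)
qed

text \<open>The outer factor 3 leaves room: the transition zone of a cut-off of radius 2 rho is the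
  closed shell between rho and 2 rho, which lies inside this half-open one.\<close>

definition shell_energy :: "(real ^ 3 \<Rightarrow> complex ^ 3) \<Rightarrow> real \<Rightarrow> real" where
  "shell_energy W \<rho> = (LINT x|lebesgue. indicator {x. \<rho> \<le> norm x \<and> norm x < 3 * \<rho>} x *\<^sub>R (norm (W x))\<^sup>2)"

text \<open>The flux integral over the shell vanishes as the difference of two vanishing integrals
  with the same inner radius. Integrating the pointwise bound then leaves k^2 rho times the shell
  energy below \<open>\<epsilon>'\<close>^2 / rho times the volume of a ball of radius 3
  rho.\<close>

lemma radiating_null_field_decay:
  fixes W :: "real ^ 3 \<Rightarrow> complex ^ 3"
  assumes U: "open U" "{x. R \<le> norm x} \<subseteq> U" and W: "smooth_on U W"
    and W0: "\<And>x. norm x = R \<Longrightarrow> W x = 0"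
    and Maxwell: "\<And>x. x \<in> U \<Longrightarrow> curl (curl W) x = of_real (k\<^sup>2) *s W x"
    and R: "0 < R" and k: "0 < k" and rad: "silver_mueller k W" and \<epsilon>: "0 < \<epsilon>"
  obtains M where "M > R" "\<And>\<rho>. \<rho> \<ge> M \<Longrightarrow> shell_energy W \<rho> \<le> \<epsilon> * \<rho>"
proof -
  \<comment> \<open>\<open>u\<close> times rho^3 is the volume of the ball of radius 3 rho, and
    \<open>\<epsilon>'\<close> is chosen such that its square times \<open>u\<close> equals
    \<epsilon> k^2.\<close>
  define u where "u = 27 * unit_ball_vol (real DIM(real^3))"
  have u: "u > 0" by (simp add: u_def)
  define \<epsilon>' where "\<epsilon>' = k * sqrt (\<epsilon> / u)"
  have \<epsilon>': "\<epsilon>' > 0" "\<epsilon>'\<^sup>2 * u = \<epsilon> * k\<^sup>2" using u k \<epsilon> by (auto simp: \<epsilon>'_def power_mult_distrib)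
  define D where "D x = ccross (curl W x) (cvec (x /\<^sub>R norm x)) - (\<i> * of_real k) *s W x" for x
  define q where "q x = Im (flux_density (W x) (curl W x) x)" for x
  have "((\<lambda>x. norm x *\<^sub>R D x) \<longlongrightarrow> 0) at_infinity" using rad unfolding silver_mueller_def D_def .
  then have "\<forall>\<^sub>F x in at_infinity. norm (norm x *\<^sub>R D x) < \<epsilon>'"
    using tendstoD[OF _ \<epsilon>'(1)] by (fastforce simp: dist_norm)
  then obtain b where b: "\<And>x. b \<le> norm x \<Longrightarrow> norm (norm x *\<^sub>R D x) < \<epsilon>'"
    by (auto simp: eventually_at_infinity)
  define M where "M = max b R + 1"
  have M: "M > R" "M > b" by (auto simp: M_def)
  have bound: "shell_energy W \<rho> \<le> \<epsilon> * \<rho>"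
    if "\<rho> \<ge> M" for \<rho>
  proof -
    have \<rho>: "\<rho> > R" "\<rho> > 0" "\<rho> > b" using that M R by auto
    define T where "T = {x::real^3. \<rho> \<le> norm x \<and> norm x < 3 * \<rho>}"
    define A where "A = {x::real^3. \<rho> \<le> norm x \<and> norm x \<le> 3 * \<rho>}"
    have A: "compact A" unfolding A_def by (rule compact_shell)
    have TA: "T \<subseteq> A" "A \<subseteq> U" using U(2) \<rho> by (auto simp: T_def A_def)
    have "T = ball 0 (3 * \<rho>) - ball 0 \<rho>" by (auto simp: T_def)
    then have Tm: "T \<in> sets borel" by simp
    have Wc: "continuous_on A W" by (rule continuous_on_subset[OF smooth_onD(3)[OF W] TA(2)])
    have i1: "integrable lebesgue (\<lambda>x. indicator T x *\<^sub>R (norm x * (norm (W x))\<^sup>2))"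
      by (rule integrable_on_subset_compact[OF A _ TA(1) Tm]) (intro continuous_intros Wc)
    have i2: "integrable lebesgue (\<lambda>x. indicator T x *\<^sub>R (norm (W x))\<^sup>2)"
      by (rule integrable_on_subset_compact[OF A _ TA(1) Tm]) (intro continuous_intros Wc)
    have "has_bochner_integral lebesgue (\<lambda>x. indicator {x. R < norm x \<and> norm x < 3 * \<rho>} x *\<^sub>R q x
        - indicator {x. R < norm x \<and> norm x < \<rho>} x *\<^sub>R q x) (0 - 0)"
      unfolding q_def using \<rho> R
      by (intro has_bochner_integral_diff energy_flux_eq_0[OF U W W0 Maxwell]) auto
    moreover have "indicator {x. R < norm x \<and> norm x < 3 * \<rho>} x *\<^sub>R q x
        - indicator {x. R < norm x \<and> norm x < \<rho>} x *\<^sub>R q x = indicator T x *\<^sub>R q x" for x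
      using \<rho> by (auto simp: T_def indicator_def)
    ultimately have q: "has_bochner_integral lebesgue (\<lambda>x. indicator T x *\<^sub>R q x) 0" by (simp only: diff_zero)
    have pt: "indicator T x *\<^sub>R (k\<^sup>2 * \<rho> * (norm (W x))\<^sup>2) - 2 * k * (indicator T x *\<^sub>R q x)
        \<le> indicator (cball 0 (3 * \<rho>)) x *\<^sub>R (\<epsilon>'\<^sup>2 / \<rho>)" for x
    proof (cases "x \<in> T")
      case True
      define r where "r = norm x"
      have r: "\<rho> \<le> r" "r \<le> 3 * \<rho>" "r > 0" using True \<rho> by (auto simp: T_def r_def)
      \<comment> \<open>\<open>q\<close> uses the vector x as normal, the radiation condition the
        unit vector; the factor r converts one into the other.\<close>
      have "Im (flux_density (W x) (curl W x) (x /\<^sub>R r)) = inverse r * q x"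
        unfolding flux_density_scaleR q_def by (simp del: of_real_inverse)
      then have "q x = r * Im (flux_density (W x) (curl W x) (x /\<^sub>R r))" using r by simp
      moreover have "r * (k\<^sup>2 * (norm (W x))\<^sup>2 - 2 * k * Im (flux_density (W x) (curl W x) (x /\<^sub>R r)))
          \<le> r * (norm (D x))\<^sup>2"
        unfolding D_def r_def[symmetric]
        by (rule mult_left_mono[OF flux_density_radiation_bound]) (use r in simp)
      moreover have "r * (norm (D x))\<^sup>2 \<le> \<epsilon>'\<^sup>2 / \<rho>"
      proof -
        have "r * norm (D x) < \<epsilon>'" using b[of x] r \<rho> by (simp add: r_def)
        then have "(r * norm (D x))\<^sup>2 \<le> \<epsilon>'\<^sup>2" using r by (intro power_mono) auto
        then have "r * (norm (D x))\<^sup>2 \<le> \<epsilon>'\<^sup>2 / r"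
          using r by (simp add: pos_le_divide_eq power_mult_distrib power2_eq_square mult_ac)
        also have "\<dots> \<le> \<epsilon>'\<^sup>2 / \<rho>" using r \<rho> by (intro divide_left_mono) auto
        finally show ?thesis .
      qed
      moreover have "k\<^sup>2 * \<rho> * (norm (W x))\<^sup>2 \<le> k\<^sup>2 * r * (norm (W x))\<^sup>2"
        using r by (intro mult_right_mono mult_left_mono) auto
      ultimately have "k\<^sup>2 * \<rho> * (norm (W x))\<^sup>2 - 2 * k * q x \<le> \<epsilon>'\<^sup>2 / \<rho>"
        by (simp add: algebra_simps)
      then show ?thesis using True r by (simp add: r_def)
    next
      case False
      then show ?thesis using \<rho> by (simp add: indicator_def)
    qed
    have "(LINT x|lebesgue. indicator T x *\<^sub>R (k\<^sup>2 * \<rho> * (norm (W x))\<^sup>2) - 2 * k * (indicator T x *\<^sub>R q x))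
        \<le> (LINT x|lebesgue. indicator (cball (0::real^3) (3 * \<rho>)) x *\<^sub>R (\<epsilon>'\<^sup>2 / \<rho>))"
    proof (rule integral_mono)
      show "integrable lebesgue (\<lambda>x. indicator (cball (0::real^3) (3 * \<rho>)) x *\<^sub>R (\<epsilon>'\<^sup>2 / \<rho>))"
        by (rule integrable_on_subset_compact[OF compact_cball]) auto
      have "integrable lebesgue (\<lambda>x. (k\<^sup>2 * \<rho>) * (indicator T x *\<^sub>R (norm (W x))\<^sup>2) - 2 * k * (indicator T x *\<^sub>R q x))"
        by (intro Bochner_Integration.integrable_diff integrable_mult_right i2 integrable.intros[OF q])
      then show "integrable lebesgue (\<lambda>x. indicator T x *\<^sub>R (k\<^sup>2 * \<rho> * (norm (W x))\<^sup>2) - 2 * k * (indicator T x *\<^sub>R q x))"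
        by (simp add: mult_ac)
    qed (rule pt)
    also have "\<dots> = measure lborel (cball (0::real^3) (3 * \<rho>)) * (\<epsilon>'\<^sup>2 / \<rho>)" by simp
    also have "\<dots> = (\<epsilon>'\<^sup>2 * u) * \<rho>\<^sup>2"
      using \<rho> content_cball[of "3 * \<rho>" "0::real^3"]
      by (simp add: u_def power_mult_distrib power2_eq_square power3_eq_cube)
    also have "(LINT x|lebesgue. indicator T x *\<^sub>R (k\<^sup>2 * \<rho> * (norm (W x))\<^sup>2) - 2 * k * (indicator T x *\<^sub>R q x))
        = k\<^sup>2 * \<rho> * (LINT x|lebesgue. indicator T x *\<^sub>R (norm (W x))\<^sup>2)"
    proof -
      have "has_bochner_integral lebesgue (\<lambda>x. (k\<^sup>2 * \<rho>) * (indicator T x *\<^sub>R (norm (W x))\<^sup>2) - (2 * k) * (indicator T x *\<^sub>R q x))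
          ((k\<^sup>2 * \<rho>) * (LINT x|lebesgue. indicator T x *\<^sub>R (norm (W x))\<^sup>2) - (2 * k) * 0)"
        by (intro has_bochner_integral_diff has_bochner_integral_mult_right q has_bochner_integral_integrable i2)
      then have "(LINT x|lebesgue. (k\<^sup>2 * \<rho>) * (indicator T x *\<^sub>R (norm (W x))\<^sup>2) - (2 * k) * (indicator T x *\<^sub>R q x))
          = (k\<^sup>2 * \<rho>) * (LINT x|lebesgue. indicator T x *\<^sub>R (norm (W x))\<^sup>2)"
        by (simp add: has_bochner_integral_iff)
      then show ?thesis by (simp add: mult_ac)
    qed
    also have "(\<epsilon>'\<^sup>2 * u) * \<rho>\<^sup>2 = (k\<^sup>2 * \<rho>) * (\<epsilon> * \<rho>)"
      unfolding \<epsilon>'(2) by (simp add: power2_eq_square)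
    finally have "(k\<^sup>2 * \<rho>) * (LINT x|lebesgue. indicator T x *\<^sub>R (norm (W x))\<^sup>2)
        \<le> (k\<^sup>2 * \<rho>) * (\<epsilon> * \<rho>)" .
    then show ?thesis using k \<rho> by (simp add: T_def shell_energy_def)
  qed
  show thesis by (rule that[OF M(1) bound])
qed

section \<open>Pairing with entire solutions\<close>

definition grad :: "(real ^ 3 \<Rightarrow> complex) \<Rightarrow> real ^ 3 \<Rightarrow> complex ^ 3" where
  "grad \<psi> x = (\<chi> i. partial i \<psi> x)"

definition laplacian :: "(real ^ 3 \<Rightarrow> complex) \<Rightarrow> real ^ 3 \<Rightarrow> complex" where
  "laplacian \<psi> x = (\<Sum>i\<in>UNIV. partial i (partial i \<psi>) x)"

lemma ccross_nth:
  "ccross u v $ 1 = u $ 2 * v $ 3 - u $ 3 * v $ 2"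
  "ccross u v $ 2 = u $ 3 * v $ 1 - u $ 1 * v $ 3"
  "ccross u v $ 3 = u $ 1 * v $ 2 - u $ 2 * v $ 1"
  by (simp_all add: ccross_def)

lemma smooth_on_grad: "open U \<Longrightarrow> smooth_on U \<psi> \<Longrightarrow> smooth_on U (grad \<psi>)"
  by (simp add: smooth_on_nth_iff grad_def smooth_onD(2))

lemma smooth_on_laplacian: "open U \<Longrightarrow> smooth_on U \<psi> \<Longrightarrow> smooth_on U (laplacian \<psi>)"
  unfolding laplacian_def[abs_def] by (intro smooth_on_sum smooth_onD(2))

lemma smooth_on_smult_const: "open U \<Longrightarrow> smooth_on U \<psi> \<Longrightarrow> smooth_on U (\<lambda>x. \<psi> x *s (c :: complex ^ 3))"
  by (simp add: smooth_on_nth_iff smooth_on_mult smooth_on_const)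

lemma curl_smult_const:
  assumes "smooth_on UNIV \<psi>"
  shows "curl (\<lambda>x. \<psi> x *s c) x = ccross (grad \<psi> x) c"
proof -
  have d: "(\<lambda>x. \<psi> x *s c) differentiable (at x)"
    by (rule smooth_onD(1)[OF smooth_on_smult_const[OF open_UNIV assms] UNIV_I])
  have "partial i (\<lambda>x. \<psi> x *s c) x $ m = partial i \<psi> x * c $ m" for i m
    using partial_nth[OF d, of i m] partial_mult[OF smooth_onD(1)[OF assms UNIV_I] differentiable_const, of i "c $ m" x]
    by simp
  then show ?thesis by (simp add: vec_eq_iff forall_3 curl_nth ccross_nth grad_def)
qed

lemma curl_grad:
  assumes "smooth_on UNIV \<psi>"
  shows "curl (grad \<psi>) x = 0"
proof -
  have "partial i (grad \<psi>) x $ m = partial i (partial m \<psi>) x" for i m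
    using partial_nth[OF smooth_onD(1)[OF smooth_on_grad[OF open_UNIV assms] UNIV_I], of i m]
    by (simp add: grad_def)
  then show ?thesis
    using partial_commute[OF open_UNIV assms UNIV_I] by (simp add: vec_eq_iff forall_3 curl_nth)
qed

lemma curl_minus:
  assumes "F differentiable (at x)" "G differentiable (at x)"
  shows "curl (\<lambda>y. F y - G y) x = curl F x - curl G x"
  by (simp add: vec_eq_iff forall_3 curl_nth partial_diff[OF assms])

text \<open>Since \<open>c\<close> is constant, the curl of grad \<psi> x c is (c . grad) grad
  \<psi> - c div grad \<psi>; by symmetry of second derivatives the first term is the gradient of
  the derivative in direction \<open>c\<close>.\<close>

lemma curl_ccross_grad:
  assumes "smooth_on UNIV \<psi>"
  shows "curl (\<lambda>x. ccross (grad \<psi> x) c) x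
    = grad (\<lambda>x. \<Sum>j\<in>UNIV. c $ j * partial j \<psi> x) x - laplacian \<psi> x *s c"
proof -
  have p: "partial j \<psi> differentiable (at x)" for j x
    by (rule smooth_onD(1)[OF smooth_onD(2)[OF assms] UNIV_I])
  have pc: "partial i (\<lambda>x. partial j \<psi> x * c $ m) x = partial i (partial j \<psi>) x * c $ m"
    "(\<lambda>x. partial j \<psi> x * c $ m) differentiable (at x)"
    "partial i (\<lambda>x. c $ m * partial j \<psi> x) x = c $ m * partial i (partial j \<psi>) x"
    "(\<lambda>x. c $ m * partial j \<psi> x) differentiable (at x)" for i j m x
    using partial_mult[OF p differentiable_const, of i j "c $ m" x]
      partial_mult[OF differentiable_const p, of i "c $ m" j x]
    by (simp_all add: p differentiable_bilinear[OF bounded_bilinear_mult p differentiable_const]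
        differentiable_bilinear[OF bounded_bilinear_mult differentiable_const p])
  have cs: "smooth_on UNIV (\<lambda>x. ccross (grad \<psi> x) c)"
  proof -
    have "(\<lambda>x. ccross (grad \<psi> x) c) = curl (\<lambda>x. \<psi> x *s c)"
      using curl_smult_const[OF assms, of c] by (simp add: fun_eq_iff)
    then show ?thesis
      using smooth_on_curl[OF open_UNIV smooth_on_smult_const[OF open_UNIV assms]] by simp
  qed
  have d: "partial i (\<lambda>x. ccross (grad \<psi> x) c) x $ m = partial i (\<lambda>x. ccross (grad \<psi> x) c $ m) x" for i m
    by (rule partial_nth[OF smooth_onD(1)[OF cs UNIV_I], symmetric])
  have g: "grad (\<lambda>x. \<Sum>j\<in>UNIV. c $ j * partial j \<psi> x) x $ m
      = (\<Sum>j\<in>UNIV. c $ j * partial m (partial j \<psi>) x)" for m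
    using partial_sum[of UNIV "\<lambda>j y. c $ j * partial j \<psi> y" x m] pc by (simp add: grad_def)
  have pd: "partial i (\<lambda>x. partial a \<psi> x * c $ m - partial b \<psi> x * c $ n) x
      = partial i (partial a \<psi>) x * c $ m - partial i (partial b \<psi>) x * c $ n" for i a b m n
    by (simp add: partial_diff pc p)
  note sym = partial_commute[OF open_UNIV assms UNIV_I]
  show ?thesis
    unfolding vec_eq_iff forall_3 vector_minus_component vector_smult_component g curl_nth d
    unfolding ccross_nth grad_def vec_lambda_beta pd
    by (simp add: laplacian_def sum_3 algebra_simps sym[of 2 1] sym[of 3 1] sym[of 3 2])
qed

text \<open>The second curl annihilates the gradient term, so only the curl of the Laplacian times
  \<open>c\<close> remains.\<close>

lemma curl_curl_ccross_grad:
  assumes "smooth_on UNIV \<psi>"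
  shows "curl (curl (\<lambda>x. ccross (grad \<psi> x) c)) x = - ccross (grad (laplacian \<psi>) x) c"
proof -
  define f where "f x = (\<Sum>j\<in>UNIV. c $ j * partial j \<psi> x)" for x
  have f: "smooth_on UNIV f"
    unfolding f_def[abs_def] by (intro smooth_on_sum smooth_on_mult smooth_on_const smooth_onD(2) assms open_UNIV)
  have l: "smooth_on UNIV (laplacian \<psi>)" by (rule smooth_on_laplacian[OF open_UNIV assms])
  have "curl (\<lambda>x. ccross (grad \<psi> x) c) = (\<lambda>x. grad f x - laplacian \<psi> x *s c)"
    using curl_ccross_grad[OF assms] by (simp add: fun_eq_iff f_def[abs_def])
  then have "curl (curl (\<lambda>x. ccross (grad \<psi> x) c)) x = curl (grad f) x - curl (\<lambda>x. laplacian \<psi> x *s c) x"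
    using curl_minus[OF smooth_onD(1)[OF smooth_on_grad[OF open_UNIV f] UNIV_I]
        smooth_onD(1)[OF smooth_on_smult_const[OF open_UNIV l] UNIV_I]] by simp
  then show ?thesis by (simp add: curl_grad[OF f] curl_smult_const[OF l])
qed

lemma ccross_diff_left: "ccross (u - v) w = ccross u w - ccross v w"
  and ccross_add_left: "ccross (u + v) w = ccross u w + ccross v w"
  and ccross_smult_left: "ccross (a *s u) w = a *s ccross u w"
  by (simp_all add: vec_eq_iff forall_3 ccross_nth algebra_simps)

text \<open>This explains the form of the test fields: on grad \<psi> x c the Maxwell operator
  becomes, up to sign, the scalar Helmholtz operator on \<psi>.\<close>

lemma grad_helmholtz:
  assumes "smooth_on UNIV \<psi>"
  shows "curl (curl (\<lambda>x. ccross (grad \<psi> x) c)) x - a *s ccross (grad \<psi> x) c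
    = - ccross (grad (\<lambda>x. laplacian \<psi> x + a * \<psi> x) x) c"
proof -
  have "partial i (\<lambda>x. laplacian \<psi> x + a * \<psi> x) x = partial i (laplacian \<psi>) x + a * partial i \<psi> x" for i
    using smooth_onD(1)[OF assms UNIV_I] smooth_onD(1)[OF smooth_on_laplacian[OF open_UNIV assms] UNIV_I]
    by (simp add: partial_add partial_mult differentiable_bilinear[OF bounded_bilinear_mult])
  then have "grad (\<lambda>x. laplacian \<psi> x + a * \<psi> x) x = grad (laplacian \<psi>) x + a *s grad \<psi> x"
    by (simp add: grad_def vec_eq_iff)
  then show ?thesis
    by (simp add: curl_curl_ccross_grad[OF assms] ccross_add_left ccross_smult_left)
qed

lemma laplacian_mult:
  assumes "smooth_on UNIV \<eta>" "smooth_on UNIV u"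
  shows "laplacian (\<lambda>x. \<eta> x * u x) x
    = \<eta> x * laplacian u x + 2 * (\<Sum>j\<in>UNIV. partial j \<eta> x * partial j u x) + laplacian \<eta> x * u x"
proof -
  have d: "\<eta> differentiable (at x)" "u differentiable (at x)" "partial j \<eta> differentiable (at x)"
    "partial j u differentiable (at x)" for x j
    using smooth_onD[OF assms(1)] smooth_onD[OF assms(2)] smooth_onD(1)[OF smooth_onD(2)[OF assms(1)]]
      smooth_onD(1)[OF smooth_onD(2)[OF assms(2)]] by auto
  have 1: "partial j (\<lambda>x. \<eta> x * u x) = (\<lambda>x. \<eta> x * partial j u x + partial j \<eta> x * u x)" for j
    using partial_mult[OF d(1,2)] by (simp add: fun_eq_iff)
  have "partial j (partial j (\<lambda>x. \<eta> x * u x)) x = \<eta> x * partial j (partial j u) x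
      + 2 * (partial j \<eta> x * partial j u x) + partial j (partial j \<eta>) x * u x" for j
    unfolding 1
    by (simp add: partial_add partial_mult differentiable_bilinear[OF bounded_bilinear_mult] d algebra_simps)
  then show ?thesis
    by (simp add: laplacian_def sum.distrib sum_distrib_left sum_distrib_right)
qed

lemma partial_scale:
  assumes "F differentiable (at (x /\<^sub>R \<rho>))"
  shows "partial i (\<lambda>x. F (x /\<^sub>R \<rho>)) x = partial i F (x /\<^sub>R \<rho>) /\<^sub>R \<rho>"
proof -
  have D: "(F has_derivative frechet_derivative F (at (x /\<^sub>R \<rho>))) (at (x /\<^sub>R \<rho>))"
    using assms by (simp add: frechet_derivative_works)
  have "((\<lambda>x. x /\<^sub>R \<rho>) has_derivative (\<lambda>v. v /\<^sub>R \<rho>)) (at x)"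
    by (intro has_derivative_scaleR_right has_derivative_ident)
  from partial_eqI[OF has_derivative_compose[OF this D]]
  show ?thesis by (simp add: partial_def linear_scale[OF has_derivative_linear[OF D]])
qed

section \<open>Uniform estimates for the cut-off error\<close>

lemma uniform_bound_3:
  fixes f :: "3 \<Rightarrow> 'a \<Rightarrow> 'b::real_normed_vector"
  assumes "\<And>i. \<exists>M. \<forall>x. norm (f i x) \<le> M"
  shows "\<exists>M. \<forall>i x. norm (f i x) \<le> M"
proof -
  obtain M where M: "\<And>i x. norm (f i x) \<le> M i" using choice[of "\<lambda>i M. \<forall>x. norm (f i x) \<le> M"] assms by blast
  have "norm (f i x) \<le> Max (range M)" for i x
    by (rule order_trans[OF M Max_ge]) auto
  then show ?thesis by blast
qed

text \<open>Third derivatives appear because the test field differentiates the commutator once more,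
  and the commutator already contains second derivatives of the cut-off.\<close>

lemma ccut_derivatives_bounded:
  obtains B where "B \<ge> 0" "\<And>i x. norm (partial i (ccut 0 1) x) \<le> B"
    "\<And>i j x. norm (partial i (partial j (ccut 0 1)) x) \<le> B"
    "\<And>i j l x. norm (partial i (partial j (partial l (ccut 0 1))) x) \<le> B"
proof -
  have bd: "\<exists>M. \<forall>x. norm (F x) \<le> M"
    if F: "smooth_on UNIV F" "\<And>x. x \<notin> cball 0 1 \<Longrightarrow> F x = 0" for F :: "real^3 \<Rightarrow> complex"
  proof -
    have "continuous_on (cball 0 1) F"
      by (rule continuous_on_subset[OF smooth_onD(3)[OF F(1)] subset_UNIV])
    then obtain M where "\<And>x. norm (F x) \<le> M"
      by (rule bounded_if_compact_support) (use F(2) in auto)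
    then show ?thesis by blast
  qed
  have s: "smooth_on UNIV (partial i (ccut 0 1))" "smooth_on UNIV (partial i (partial j (ccut 0 1)))"
    "smooth_on UNIV (partial i (partial j (partial l (ccut 0 1))))" for i j l
    by (intro smooth_onD(2) smooth_on_ccut)+
  have 1: "partial i (ccut 0 1) x = 0" if "x \<notin> cball 0 1" for i x
    by (rule partial_eq_0_outside[OF closed_cball _ that]) (rule ccut_outside, auto)
  have 2: "partial i (partial j (ccut 0 1)) x = 0" if "x \<notin> cball 0 1" for i j x
    by (rule partial_eq_0_outside[OF closed_cball 1 that])
  have 3: "partial i (partial j (partial l (ccut 0 1))) x = 0" if "x \<notin> cball 0 1" for i j l x
    by (rule partial_eq_0_outside[OF closed_cball 2 that])
  have b1: "\<exists>M. \<forall>x. norm (partial i (ccut 0 1) x) \<le> M" for i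
    by (rule bd[OF s(1)]) (rule 1)
  have b2: "\<exists>M. \<forall>x. norm (partial i (partial j (ccut 0 1)) x) \<le> M" for i j
    by (rule bd[OF s(2)]) (rule 2)
  have b3: "\<exists>M. \<forall>x. norm (partial i (partial j (partial l (ccut 0 1))) x) \<le> M" for i j l
    by (rule bd[OF s(3)]) (rule 3)
  have "\<exists>M. \<forall>i x. norm (partial i (ccut 0 1) x) \<le> M"
    by (rule uniform_bound_3) (rule b1)
  then obtain M1 where M1: "\<forall>i x. norm (partial i (ccut 0 1) x) \<le> M1" by blast
  have a2: "\<exists>M. \<forall>j x. norm (partial i (partial j (ccut 0 1)) x) \<le> M" for i
    by (rule uniform_bound_3) (rule b2)
  \<comment> \<open>The remaining index and the point are packed into a pair, so that the same
    exchange of quantifiers applies to the outer index.\<close>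
  have "\<exists>M. \<forall>i p. norm (partial i (partial (fst p) (ccut 0 1)) (snd p)) \<le> M"
    by (rule uniform_bound_3) (use a2 in auto)
  then obtain M2 where M2: "\<forall>i p. norm (partial i (partial (fst p) (ccut 0 1)) (snd p)) \<le> M2"
    by blast
  have a3: "\<exists>M. \<forall>l x. norm (partial i (partial j (partial l (ccut 0 1))) x) \<le> M" for i j
    by (rule uniform_bound_3) (rule b3)
  have c3: "\<exists>M. \<forall>j p. norm (partial i (partial j (partial (fst p) (ccut 0 1))) (snd p)) \<le> M" for i
    by (rule uniform_bound_3) (use a3 in auto)
  have "\<exists>M. \<forall>i p. norm (partial i (partial (fst p) (partial (fst (snd p)) (ccut 0 1))) (snd (snd p))) \<le> M"
    by (rule uniform_bound_3) (use c3 in auto)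
  then obtain M3 where M3:
    "\<forall>i p. norm (partial i (partial (fst p) (partial (fst (snd p)) (ccut 0 1))) (snd (snd p))) \<le> M3"
    by blast
  define B where "B = max M1 (max M2 M3)"
  have "norm (partial i (ccut 0 1) x) \<le> B" for i x using M1[rule_format, of i x] unfolding B_def by simp
  moreover have "norm (partial i (partial j (ccut 0 1)) x) \<le> B" for i j x
    using M2[rule_format, of i "(j, x)"] unfolding B_def by simp
  moreover have "norm (partial i (partial j (partial l (ccut 0 1))) x) \<le> B" for i j l x
    using M3[rule_format, of i "(j, l, x)"] unfolding B_def by simp
  moreover have "B \<ge> 0"
    using M1[rule_format, of 1 0] norm_ge_zero[of "partial 1 (ccut 0 1) 0"] unfolding B_def by linarith
  ultimately show thesis using that by blast
qed

text \<open>The cut-off of radius rho is a dilation of the unit one, so every derivative gains a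
  factor 1/rho and the bounds at radius 1 serve all radii.\<close>

lemma ccut_scaled_partials:
  assumes "\<rho> > 0"
  shows "partial i (ccut 0 \<rho>) x = partial i (ccut 0 1) (x /\<^sub>R \<rho>) /\<^sub>R \<rho>"
    "partial i (partial j (ccut 0 \<rho>)) x = partial i (partial j (ccut 0 1)) (x /\<^sub>R \<rho>) /\<^sub>R \<rho> /\<^sub>R \<rho>"
    "partial i (partial j (partial l (ccut 0 \<rho>))) x
      = partial i (partial j (partial l (ccut 0 1))) (x /\<^sub>R \<rho>) /\<^sub>R \<rho> /\<^sub>R \<rho> /\<^sub>R \<rho>"
proof -
  have step: "partial i (\<lambda>x. a *\<^sub>R F (x /\<^sub>R \<rho>)) x = a *\<^sub>R (partial i F (x /\<^sub>R \<rho>) /\<^sub>R \<rho>)"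
    if F: "smooth_on UNIV F" for a i x and F :: "real^3 \<Rightarrow> complex"
  proof -
    have "((\<lambda>x. x /\<^sub>R \<rho>) has_derivative (\<lambda>v. v /\<^sub>R \<rho>)) (at x)"
      by (intro has_derivative_scaleR_right has_derivative_ident)
    from has_derivative_compose[OF this smooth_onD(1)[OF F UNIV_I, unfolded frechet_derivative_works]]
    have d: "(\<lambda>x. F (x /\<^sub>R \<rho>)) differentiable (at x)" by (auto simp: differentiable_def)
    show ?thesis
      using partial_bounded_linear[OF bounded_linear_scaleR_right d, of i a]
        partial_scale[OF smooth_onD(1)[OF F UNIV_I], where i = i and x = x and \<rho> = \<rho>] by simp
  qed
  note s = smooth_on_ccut smooth_onD(2)[OF smooth_on_ccut] smooth_onD(2)[OF smooth_onD(2)[OF smooth_on_ccut]]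
  have 0: "ccut 0 \<rho> = (\<lambda>x. 1 *\<^sub>R ccut 0 1 (x /\<^sub>R \<rho>))"
    using cutoff_scale[OF assms] by (simp add: ccut_def fun_eq_iff)
  have 1: "partial i (ccut 0 \<rho>) = (\<lambda>x. inverse \<rho> *\<^sub>R partial i (ccut 0 1) (x /\<^sub>R \<rho>))" for i
    unfolding 0 using step[OF s(1)[of 0 1], of i 1] by (simp add: fun_eq_iff)
  have 2: "partial i (partial j (ccut 0 \<rho>))
      = (\<lambda>x. (inverse \<rho> * inverse \<rho>) *\<^sub>R partial i (partial j (ccut 0 1)) (x /\<^sub>R \<rho>))" for i j
    unfolding 1 using step[OF s(2)[of j 0 1], of i "inverse \<rho>"] by (simp add: fun_eq_iff)
  show "partial i (ccut 0 \<rho>) x = partial i (ccut 0 1) (x /\<^sub>R \<rho>) /\<^sub>R \<rho>"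
    by (simp add: 1)
  show "partial i (partial j (ccut 0 \<rho>)) x = partial i (partial j (ccut 0 1)) (x /\<^sub>R \<rho>) /\<^sub>R \<rho> /\<^sub>R \<rho>"
    by (simp add: 2)
  show "partial i (partial j (partial l (ccut 0 \<rho>))) x
      = partial i (partial j (partial l (ccut 0 1))) (x /\<^sub>R \<rho>) /\<^sub>R \<rho> /\<^sub>R \<rho> /\<^sub>R \<rho>"
    unfolding 2 using step[OF s(3)[of j l 0 1], of i "inverse \<rho> * inverse \<rho>"] by simp
qed


lemma norm_cdot_le: "cmod (cdot u v) \<le> norm u * (\<Sum>i\<in>UNIV. cmod (v $ i))"
proof -
  have "cmod (cdot u v) \<le> (\<Sum>i\<in>UNIV. norm u * cmod (v $ i))"
    unfolding cdot_def by (rule sum_norm_le) (simp add: norm_mult mult_right_mono Finite_Cartesian_Product.norm_nth_le)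
  then show ?thesis by (simp add: sum_distrib_left)
qed

text \<open>A cross product has three components with two products each, which is the factor
  6.\<close>

lemma cmod_cdot_ccross_le:
  assumes "\<And>i. cmod (g $ i) \<le> b"
  shows "cmod (cdot w (ccross g c)) \<le> 6 * norm c * b * norm w"
proof -
  have b: "b \<ge> 0" using assms[of 1] norm_ge_zero[of "g $ 1"] by linarith
  have 1: "cmod (g $ i * c $ j) \<le> b * norm c" for i j
    unfolding norm_mult by (rule mult_mono[OF assms Finite_Cartesian_Product.norm_nth_le b]) simp
  have 2: "cmod (g $ i * c $ j - g $ i' * c $ j') \<le> 2 * (b * norm c)" for i j i' j'
    using norm_triangle_ineq4[of "g $ i * c $ j" "g $ i' * c $ j'"] 1[of i j] 1[of i' j'] by linarith
  have "(\<Sum>i\<in>UNIV. cmod (ccross g c $ i)) \<le> 6 * (b * norm c)"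
    unfolding sum_3 ccross_nth using 2[of 2 3 3 2] 2[of 3 1 1 3] 2[of 1 2 2 1] by linarith
  then have "norm w * (\<Sum>i\<in>UNIV. cmod (ccross g c $ i)) \<le> norm w * (6 * (b * norm c))"
    by (rule mult_left_mono) simp
  with norm_cdot_le[of w "ccross g c"] show ?thesis by (simp add: mult_ac)
qed

text \<open>Second derivatives are included because the gradient of the cut-off error contains them.
  The radius \<open>r0\<close> leaves the behaviour near the origin free.\<close>

definition decays_inversely :: "(real ^ 3 \<Rightarrow> complex) \<Rightarrow> bool" where
  "decays_inversely u \<longleftrightarrow> (\<exists>C\<ge>0. \<exists>r0. \<forall>x. r0 \<le> norm x \<longrightarrow> (\<forall>i j. cmod (u x) \<le> C / norm x \<and>
     cmod (partial i u x) \<le> C / norm x \<and> cmod (partial i (partial j u) x) \<le> C / norm x))"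

text \<open>By the Helmholtz equation the terms without a derivative of the cut-off cancel. Every
  remaining term pairs a derivative of the cut-off, O(1/rho) and supported in the transition shell,
  with a factor from \<open>u\<close> of size O(1/rho).\<close>

lemma cutoff_commutator_bound:
  fixes u :: "real ^ 3 \<Rightarrow> complex"
  assumes u: "smooth_on UNIV u" and helmholtz: "\<And>x. laplacian u x = - a * u x"
    and decay_u: "decays_inversely u"
  obtains K r0 where "K \<ge> 0" "\<And>\<rho> x i. 1 \<le> \<rho> \<Longrightarrow> 2 * r0 \<le> \<rho> \<Longrightarrow>
    cmod (partial i (\<lambda>x. laplacian (\<lambda>x. ccut 0 \<rho> x * u x) x + a * (ccut 0 \<rho> x * u x)) x)
      \<le> indicator {x. \<rho> / 2 \<le> norm x \<and> norm x \<le> \<rho>} x * (K / \<rho>\<^sup>2)"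
proof -
  obtain C r0 where C0: "C \<ge> 0" and C: "\<And>x i j. r0 \<le> norm x \<Longrightarrow> cmod (u x) \<le> C / norm x \<and>
      cmod (partial i u x) \<le> C / norm x \<and> cmod (partial i (partial j u) x) \<le> C / norm x"
    using decay_u unfolding decays_inversely_def by blast
  obtain B where B: "B \<ge> 0" "\<And>i x. cmod (partial i (ccut 0 1) x) \<le> B"
    "\<And>i j x. cmod (partial i (partial j (ccut 0 1)) x) \<le> B"
    "\<And>i j l x. cmod (partial i (partial j (partial l (ccut 0 1))) x) \<le> B"
    by (rule ccut_derivatives_bounded) blast
  \<comment> \<open>Twice six products, plus three and three more, each bounded by 2 B C /
    rho^2.\<close>
  define K where "K = 36 * B * C"
  have "cmod (partial i (\<lambda>x. laplacian (\<lambda>x. ccut 0 \<rho> x * u x) x + a * (ccut 0 \<rho> x * u x)) x)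
      \<le> indicator {x. \<rho> / 2 \<le> norm x \<and> norm x \<le> \<rho>} x * (K / \<rho>\<^sup>2)"
    if \<rho>: "1 \<le> \<rho>" "2 * r0 \<le> \<rho>" for \<rho> x i
  proof -
    define \<eta> where "\<eta> = ccut 0 \<rho>"
    have \<eta>: "smooth_on UNIV \<eta>" unfolding \<eta>_def by (rule smooth_on_ccut)
    define v where "v x = 2 * (\<Sum>j\<in>UNIV. partial j \<eta> x * partial j u x) + laplacian \<eta> x * u x" for x
    have v: "(\<lambda>x. laplacian (\<lambda>x. ccut 0 \<rho> x * u x) x + a * (ccut 0 \<rho> x * u x)) = v"
      unfolding \<eta>_def[symmetric] laplacian_mult[OF \<eta> u] by (simp add: fun_eq_iff v_def helmholtz)
    show ?thesis
    proof (cases "\<rho> / 2 \<le> norm x \<and> norm x \<le> \<rho>")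
      case False
      \<comment> \<open>Off the closed transition shell the cut-off is locally constant, equal to 1
        or 0, so all its derivatives vanish on an open neighbourhood.\<close>
      define O1 where "O1 = {x::real^3. norm x < \<rho> / 2} \<union> {x. \<rho> < norm x}"
      have O1: "open O1" "x \<in> O1"
        using False unfolding O1_def by (auto intro!: open_Un open_Collect_less continuous_intros)
      have \<eta>1: "\<eta> y = 1" if "norm y < \<rho> / 2" for y
        using that \<rho> cutoff_inside[of y 0 \<rho>] by (simp add: \<eta>_def ccut_def)
      have \<eta>0: "\<eta> y = 0" if "\<rho> < norm y" for y
        using that \<rho> cutoff_outside[of \<rho> y 0] by (simp add: \<eta>_def ccut_def)
      have p0: "partial j \<eta> y = 0" if y: "y \<in> O1" for j y
      proof (cases "norm y < \<rho> / 2")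
        case True
        have "partial j \<eta> y = partial j (\<lambda>x. 1) y"
          by (rule partial_cong_open[of "ball 0 (\<rho> / 2)"]) (use True \<eta>1 in auto)
        then show ?thesis by simp
      next
        case False
        have "partial j \<eta> y = partial j (\<lambda>x. 0) y"
          by (rule partial_cong_open[of "- cball 0 \<rho>"])
            (use False y \<eta>0 in \<open>auto simp: O1_def\<close>)
        then show ?thesis by simp
      qed
      have "partial l (partial j \<eta>) y = 0" if y: "y \<in> O1" for l j y
        using partial_cong_open[OF O1(1) y, of "partial j \<eta>" "\<lambda>x. 0" l] p0 by simp
      then have "v y = 0" if "y \<in> O1" for y using p0 that by (simp add: v_def laplacian_def)
      then have "partial i v x = 0"
        using partial_cong_open[OF O1, of v "\<lambda>x. 0" i] by simp
      then show ?thesis using False by (simp add: v)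
    next
      case True
      define q where "q = 1 / \<rho>"
      have q: "0 < q" "q \<le> 1" using \<rho> by (auto simp: q_def)
      \<comment> \<open>Since rho >= 1, derivatives of order two and three are dominated by the
        first power of 1/rho as well.\<close>
      have Bq: "b / \<rho> \<le> B * q" "b / \<rho> / \<rho> \<le> B * q" "b / \<rho> / \<rho> / \<rho> \<le> B * q"
        if b: "0 \<le> b" "b \<le> B" for b
      proof -
        have dec: "c / \<rho> \<le> c" if "0 \<le> c" for c
          using that \<rho> divide_left_mono[of 1 \<rho> c] by simp
        show 1: "b / \<rho> \<le> B * q" using b \<rho> by (simp add: q_def divide_right_mono)
        then show 2: "b / \<rho> / \<rho> \<le> B * q" using dec[of "b / \<rho>"] b \<rho> by simp
        then show "b / \<rho> / \<rho> / \<rho> \<le> B * q" using dec[of "b / \<rho> / \<rho>"] b \<rho> by simp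
      qed
      have n: "norm (z /\<^sub>R \<rho>) = norm z / \<rho>" for z :: complex
        using \<rho> by (simp add: divide_inverse mult.commute)
      have \<rho>0: "\<rho> > 0" using \<rho> by simp
      have E: "cmod (partial j \<eta> x) \<le> B * q" "cmod (partial j (partial l \<eta>) x) \<le> B * q"
        "cmod (partial j (partial l (partial m \<eta>)) x) \<le> B * q" for j l m
        unfolding \<eta>_def ccut_scaled_partials[OF \<rho>0] n by (intro Bq norm_ge_zero B)+
      have Cq: "C / norm x \<le> 2 * C * q"
      proof -
        have "C / norm x \<le> C / (\<rho> / 2)" by (rule frac_le) (use True C0 \<rho> in auto)
        then show ?thesis by (simp add: q_def mult.commute)
      qed
      have r0: "r0 \<le> norm x" using True \<rho> by linarith
      have D: "cmod (u x) \<le> 2 * C * q" "cmod (partial j u x) \<le> 2 * C * q"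
        "cmod (partial j (partial l u) x) \<le> 2 * C * q" for j l
        using C[OF r0, of j l] Cq by (auto intro: order_trans)
      have prod: "cmod (s * t) \<le> 2 * B * C * q\<^sup>2" if "cmod s \<le> B * q" "cmod t \<le> 2 * C * q" for s t
      proof -
        have "cmod s * cmod t \<le> (B * q) * (2 * C * q)"
          using that B(1) q by (intro mult_mono) auto
        then show ?thesis by (simp add: norm_mult power2_eq_square mult_ac)
      qed
      have d: "\<eta> differentiable (at x)" "u differentiable (at x)" "partial j \<eta> differentiable (at x)"
        "partial j u differentiable (at x)" "partial l (partial j \<eta>) differentiable (at x)"
        "laplacian \<eta> differentiable (at x)" for j l
        using smooth_onD(1)[OF \<eta>] smooth_onD(1)[OF u] smooth_onD(1)[OF smooth_onD(2)[OF \<eta>]]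
          smooth_onD(1)[OF smooth_onD(2)[OF u]] smooth_onD(1)[OF smooth_onD(2)[OF smooth_onD(2)[OF \<eta>]]]
          smooth_onD(1)[OF smooth_on_laplacian[OF open_UNIV \<eta>]] by auto
      have dm: "(\<lambda>x. partial j \<eta> x * partial j u x) differentiable (at x)" for j
        by (rule differentiable_bilinear[OF bounded_bilinear_mult d(3) d(4)])
      have ds: "(\<lambda>x. \<Sum>j\<in>UNIV. partial j \<eta> x * partial j u x) differentiable (at x)"
        using dm by (intro differentiable_sum) auto
      have pl: "partial i (laplacian \<eta>) x = (\<Sum>j\<in>UNIV. partial i (partial j (partial j \<eta>)) x)"
        unfolding laplacian_def[abs_def] by (rule partial_sum) (rule d(5))
      have ps: "partial i (\<lambda>x. \<Sum>j\<in>UNIV. partial j \<eta> x * partial j u x) x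
          = (\<Sum>j\<in>UNIV. partial j \<eta> x * partial i (partial j u) x + partial i (partial j \<eta>) x * partial j u x)"
        by (subst partial_sum[OF dm]) (simp add: partial_mult[OF d(3,4)])
      have p1: "partial i (\<lambda>x. 2 * (\<Sum>j\<in>UNIV. partial j \<eta> x * partial j u x)) x
          = 2 * (\<Sum>j\<in>UNIV. partial j \<eta> x * partial i (partial j u) x + partial i (partial j \<eta>) x * partial j u x)"
        using partial_bounded_linear[OF bounded_linear_mult_right ds] ps by simp
      have dd: "(\<lambda>x. 2 * (\<Sum>j\<in>UNIV. partial j \<eta> x * partial j u x)) differentiable (at x)"
        by (rule differentiable_bounded_linear[OF bounded_linear_mult_right ds])
      have pv: "partial i v x
          = 2 * (\<Sum>j\<in>UNIV. partial j \<eta> x * partial i (partial j u) x + partial i (partial j \<eta>) x * partial j u x)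
            + ((\<Sum>j\<in>UNIV. partial j (partial j \<eta>) x * partial i u x)
              + (\<Sum>j\<in>UNIV. partial i (partial j (partial j \<eta>)) x * u x))"
        unfolding v_def[abs_def]
        by (subst partial_add[OF dd differentiable_bilinear[OF bounded_bilinear_mult d(6) d(2)]],
            unfold p1 partial_mult[OF d(6) d(2)] pl)
          (simp add: laplacian_def sum_distrib_right)
      define Q where "Q = 2 * B * C * q\<^sup>2"
      note P = prod[folded Q_def]
      have s1: "cmod (\<Sum>j\<in>UNIV. partial j \<eta> x * partial i (partial j u) x + partial i (partial j \<eta>) x * partial j u x)
          \<le> (\<Sum>j\<in>(UNIV::3 set). Q + Q)"
        by (intro sum_norm_le norm_triangle_le add_mono P E D)
      have s2: "cmod (\<Sum>j\<in>UNIV. partial j (partial j \<eta>) x * partial i u x) \<le> (\<Sum>j\<in>(UNIV::3 set). Q)"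
        by (intro sum_norm_le P E D)
      have s3: "cmod (\<Sum>j\<in>UNIV. partial i (partial j (partial j \<eta>)) x * u x) \<le> (\<Sum>j\<in>(UNIV::3 set). Q)"
        by (intro sum_norm_le P E D)
      have "cmod (partial i v x) \<le> 2 * (\<Sum>j\<in>(UNIV::3 set). Q + Q) + ((\<Sum>j\<in>(UNIV::3 set). Q) + (\<Sum>j\<in>(UNIV::3 set). Q))"
        unfolding pv using s1 s2 s3 by (intro norm_triangle_le add_mono) (simp_all add: norm_mult)
      also have "\<dots> = 36 * B * C * q\<^sup>2" by (simp add: Q_def)
      finally show ?thesis using True by (simp add: v K_def q_def power_divide)
    qed
  qed
  moreover have "K \<ge> 0" using B(1) C0 by (simp add: K_def)
  ultimately show thesis using that[of K r0] by blast
qed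

lemma borel_measurable_lebesgue_continuous:
  fixes F :: "real ^ 3 \<Rightarrow> 'b::euclidean_space"
  shows "continuous_on UNIV F \<Longrightarrow> F \<in> borel_measurable lebesgue"
  by (rule measurable_completion) (simp add: borel_measurable_continuous_onI)

lemma borel_measurable_cdot:
  assumes "F \<in> borel_measurable M" "G \<in> borel_measurable M"
  shows "(\<lambda>x. cdot (F x) (G x)) \<in> borel_measurable M"
proof -
  have nth: "(\<lambda>v::complex^3. v $ i) \<in> borel_measurable borel" for i
    by (intro borel_measurable_continuous_onI continuous_on_component continuous_on_id)
  have "(\<lambda>x. F x $ i) \<in> borel_measurable M" "(\<lambda>x. G x $ i) \<in> borel_measurable M" for i
    using measurable_compose[OF assms(1) nth] measurable_compose[OF assms(2) nth] .
  then show ?thesis unfolding cdot_def by (intro borel_measurable_sum borel_measurable_times)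
qed

text \<open>The commutator of the cut-off and the Maxwell operator is \<open>O(\<rho>\<^sup>-\<^sup>2)\<close> on a shell of volume
  \<open>O(\<rho>\<^sup>3)\<close>, where the square integral of the field is \<open>o(\<rho>)\<close>: by AM-GM its pairing with the
  field tends to zero.\<close>

lemma null_field_orthogonality:
  fixes W Jd :: "real ^ 3 \<Rightarrow> complex ^ 3" and u :: "real ^ 3 \<Rightarrow> complex"
  assumes U: "{x. R \<le> norm x} \<subseteq> U" and W: "smooth_on U W"
    and decay: "\<And>\<epsilon>. \<epsilon> > 0 \<Longrightarrow> \<exists>M>R. \<forall>\<rho>\<ge>M. shell_energy W \<rho> \<le> \<epsilon> * \<rho>"
    and weak: "\<And>\<phi>. test_function UNIV \<phi> \<Longrightarrow>
      (LINT x|lebesgue. cdot (W x) (curl (curl \<phi>) x - of_real (k\<^sup>2) *s \<phi> x))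
        = \<i> * of_real k * (LINT x|lebesgue. cdot (Jd x) (\<phi> x))"
    and k: "k > 0" and R: "R > 0"
    and Jd: "Jd \<in> borel_measurable lebesgue" "AE x in lebesgue. R \<le> norm x \<longrightarrow> Jd x = 0"
    and u: "smooth_on UNIV u" and helmholtz: "\<And>x. laplacian u x = - of_real (k\<^sup>2) * u x"
    and decay_u: "decays_inversely u"
  shows "(LINT x|lebesgue. cdot (Jd x) (ccross (grad u x) c)) = 0"
proof -
  obtain K r0 where K: "K \<ge> 0" "\<And>\<rho> x i. 1 \<le> \<rho> \<Longrightarrow> 2 * r0 \<le> \<rho> \<Longrightarrow>
    cmod (partial i (\<lambda>x. laplacian (\<lambda>x. ccut 0 \<rho> x * u x) x + of_real (k\<^sup>2) * (ccut 0 \<rho> x * u x)) x)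
      \<le> indicator {x. \<rho> / 2 \<le> norm x \<and> norm x \<le> \<rho>} x * (K / \<rho>\<^sup>2)"
    by (rule cutoff_commutator_bound[OF u helmholtz decay_u]) blast
  define I where "I = (LINT x|lebesgue. cdot (Jd x) (ccross (grad u x) c))"
  define vol where "vol = unit_ball_vol (real DIM(real^3))"
  have vol: "vol > 0" by (simp add: vol_def)
  define H where "H = 6 * norm c * K"
  have H: "H \<ge> 0" using K(1) by (simp add: H_def)
  have est: "k * cmod I \<le> H * (1/8 + 27 * vol / 8) * \<epsilon>" if \<epsilon>: "\<epsilon> > 0" for \<epsilon>
  proof -
    \<comment> \<open>The decay is used with \<epsilon>^2, so that \<epsilon> can serve as the
      balancing parameter in the AM-GM step.\<close>
    obtain M where M: "M > R" "\<And>\<sigma>. \<sigma> \<ge> M \<Longrightarrow> shell_energy W \<sigma> \<le> \<epsilon>\<^sup>2 * \<sigma>"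
      using decay[of "\<epsilon>\<^sup>2"] \<epsilon> by (auto simp del: scaleR_conv_of_real)
    define \<sigma> where "\<sigma> = max (max M 1) r0"
    define \<rho> where "\<rho> = 2 * \<sigma>"
    have \<sigma>: "\<sigma> \<ge> M" "\<sigma> \<ge> 1" "\<sigma> > R" and \<rho>: "1 \<le> \<rho>" "2 * r0 \<le> \<rho>" "\<rho> > 0"
      using M(1) by (auto simp: \<sigma>_def \<rho>_def)
    define \<psi> where "\<psi> x = ccut 0 \<rho> x * u x" for x
    have \<psi>: "smooth_on UNIV \<psi>" unfolding \<psi>_def[abs_def] by (intro smooth_on_mult open_UNIV smooth_on_ccut u)
    define \<phi> where "\<phi> x = ccross (grad \<psi> x) c" for x
    have \<psi>0: "\<psi> x = 0" if "x \<notin> cball 0 \<rho>" for x using ccut_outside[OF \<rho>(3) that] by (simp add: \<psi>_def)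
    have \<phi>_curl: "\<phi> = curl (\<lambda>x. \<psi> x *s c)" by (simp add: fun_eq_iff \<phi>_def curl_smult_const[OF \<psi>])
    have \<phi>s: "smooth_on UNIV \<phi>"
      unfolding \<phi>_curl by (intro smooth_on_curl smooth_on_smult_const open_UNIV \<psi>)
    have \<phi>0: "\<phi> x = 0" if "x \<notin> cball 0 \<rho>" for x
      unfolding \<phi>_curl by (rule curl_eq_0_outside[OF closed_cball _ that]) (simp add: \<psi>0)
    have \<phi>t: "test_function UNIV \<phi>" by (rule test_functionI[OF \<phi>s compact_cball subset_UNIV \<phi>0])
    define v where "v x = laplacian \<psi> x + of_real (k\<^sup>2) * \<psi> x" for x
    have eq: "curl (curl \<phi>) x - of_real (k\<^sup>2) *s \<phi> x = - ccross (grad v x) c" for x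
      unfolding \<phi>_def[abs_def] v_def[abs_def] by (rule grad_helmholtz[OF \<psi>])
    define T where "T = {x::real^3. \<sigma> \<le> norm x \<and> norm x < 3 * \<sigma>}"
    define A where "A = {x::real^3. \<sigma> \<le> norm x \<and> norm x \<le> 3 * \<sigma>}"
    have A: "compact A" unfolding A_def by (rule compact_shell)
    have TA: "T \<subseteq> A" "A \<subseteq> U" using U \<sigma> by (auto simp: T_def A_def)
    have "T = ball 0 (3 * \<sigma>) - ball 0 \<sigma>" by (auto simp: T_def)
    then have Tm: "T \<in> sets borel" by simp
    have Wc: "continuous_on A W" by (rule continuous_on_subset[OF smooth_onD(3)[OF W] TA(2)])
    have i2: "integrable lebesgue (\<lambda>x. indicator T x *\<^sub>R (norm (W x))\<^sup>2)"
      by (rule integrable_on_subset_compact[OF A _ TA(1) Tm]) (intro continuous_intros Wc)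
    have i3: "integrable lebesgue (\<lambda>x. indicator (cball (0::real^3) (3 * \<sigma>)) x *\<^sub>R (\<epsilon> / \<sigma>))"
      by (rule integrable_on_subset_compact[OF compact_cball]) auto
    define m where "m x = (H / \<rho>\<^sup>2) * ((\<sigma> / \<epsilon> * (indicator T x *\<^sub>R (norm (W x))\<^sup>2)
        + indicator (cball (0::real^3) (3 * \<sigma>)) x *\<^sub>R (\<epsilon> / \<sigma>)) / 2)" for x
    have mi: "integrable lebesgue m"
      unfolding m_def[abs_def] by (intro integrable_mult_right integrable_divide Bochner_Integration.integrable_add i2 i3)
    have m0: "m x \<ge> 0" for x using H \<epsilon> \<sigma> by (simp add: m_def)
    have pt: "cmod (cdot (W x) (curl (curl \<phi>) x - of_real (k\<^sup>2) *s \<phi> x)) \<le> m x" for x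
    proof -
      define b where "b = indicator {x. \<rho> / 2 \<le> norm x \<and> norm x \<le> \<rho>} x * (K / \<rho>\<^sup>2)"
      have "cmod (grad v x $ i) \<le> b" for i
        unfolding grad_def vec_lambda_beta v_def[abs_def] \<psi>_def[abs_def] b_def by (rule K(2)[OF \<rho>(1,2)])
      then have "cmod (cdot (W x) (ccross (grad v x) c)) \<le> 6 * norm c * b * norm (W x)"
        by (rule cmod_cdot_ccross_le)
      moreover have "cmod (cdot (W x) (- z)) = cmod (cdot (W x) z)" for z
        using cdot_diff_right[of "W x" 0 z] norm_minus_cancel[of "cdot (W x) z"]
        by (simp add: cdot_def del: norm_minus_cancel)
      ultimately have 1: "cmod (cdot (W x) (curl (curl \<phi>) x - of_real (k\<^sup>2) *s \<phi> x))
          \<le> 6 * norm c * b * norm (W x)" unfolding eq by simp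
      show ?thesis
      proof (cases "x \<in> T")
        case True
        define w where "w = norm (W x)"
        have "b \<le> K / \<rho>\<^sup>2" using K(1) by (simp add: b_def indicator_def)
        then have "6 * norm c * b * w \<le> 6 * norm c * (K / \<rho>\<^sup>2) * w"
          by (intro mult_right_mono mult_left_mono) (auto simp: w_def)
        also have "\<dots> = (H / \<rho>\<^sup>2) * w" by (simp add: H_def)
        also have "\<dots> \<le> (H / \<rho>\<^sup>2) * ((\<sigma> / \<epsilon> * w\<^sup>2 + \<epsilon> / \<sigma>) / 2)"
        proof (rule mult_left_mono)
          \<comment> \<open>With the weight s^2 = \<sigma>/\<epsilon> the energy term and the volume
            term are both of order \<epsilon> \<sigma>^2; the prefactor H / rho^2 with rho = 2
            \<sigma> cancels the power of \<sigma>.\<close>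
          define s where "s = sqrt (\<sigma> / \<epsilon>)"
          have s: "s > 0" "s\<^sup>2 = \<sigma> / \<epsilon>" using \<sigma> \<epsilon> by (auto simp: s_def)
          have "0 \<le> (s * w - 1 / s)\<^sup>2" by simp
          also have "\<dots> = s\<^sup>2 * w\<^sup>2 + 1 / s\<^sup>2 - 2 * w"
            using s(1) by (simp add: power2_diff power_mult_distrib power_divide)
          finally show "w \<le> (\<sigma> / \<epsilon> * w\<^sup>2 + \<epsilon> / \<sigma>) / 2" by (simp add: s(2))
        qed (use H in simp)
        also have "\<dots> = m x" using True by (simp add: m_def w_def T_def)
        finally show ?thesis using 1 by (simp add: w_def)
      next
        case False
        then have "\<not> (\<rho> / 2 \<le> norm x \<and> norm x \<le> \<rho>)" using \<sigma> by (auto simp: T_def \<rho>_def)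
        then have "b = 0" by (simp add: b_def)
        then show ?thesis using 1 m0[of x] by simp
      qed
    qed
    have "cmod (LINT x|lebesgue. cdot (W x) (curl (curl \<phi>) x - of_real (k\<^sup>2) *s \<phi> x))
        \<le> (LINT x|lebesgue. cmod (cdot (W x) (curl (curl \<phi>) x - of_real (k\<^sup>2) *s \<phi> x)))"
      by (rule integral_norm_bound)
    also have "\<dots> \<le> (LINT x|lebesgue. m x)"
      by (rule integral_mono'[OF mi pt m0])
    also have "\<dots> = (H / \<rho>\<^sup>2) * ((\<sigma> / \<epsilon> * (LINT x|lebesgue. indicator T x *\<^sub>R (norm (W x))\<^sup>2)
        + (LINT x|lebesgue. indicator (cball (0::real^3) (3 * \<sigma>)) x *\<^sub>R (\<epsilon> / \<sigma>))) / 2)"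
    proof -
      have "has_bochner_integral lebesgue m ((H / \<rho>\<^sup>2) * ((\<sigma> / \<epsilon> * (LINT x|lebesgue. indicator T x *\<^sub>R (norm (W x))\<^sup>2)
        + (LINT x|lebesgue. indicator (cball (0::real^3) (3 * \<sigma>)) x *\<^sub>R (\<epsilon> / \<sigma>))) / 2))"
        unfolding m_def[abs_def]
        by (intro has_bochner_integral_mult_right has_bochner_integral_divide has_bochner_integral_add
            has_bochner_integral_integrable i2 i3)
      then show ?thesis by (simp only: has_bochner_integral_integral_eq)
    qed
    also have "\<dots> \<le> (H / \<rho>\<^sup>2) * ((\<sigma> / \<epsilon> * (\<epsilon>\<^sup>2 * \<sigma>) + vol * (3 * \<sigma>) ^ 3 * (\<epsilon> / \<sigma>)) / 2)"
    proof (intro mult_left_mono divide_right_mono add_mono)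
      show "(LINT x|lebesgue. indicator T x *\<^sub>R (norm (W x))\<^sup>2) \<le> \<epsilon>\<^sup>2 * \<sigma>"
        unfolding T_def shell_energy_def[symmetric] by (rule M(2)[OF \<sigma>(1)])
      show "(LINT x|lebesgue. indicator (cball (0::real^3) (3 * \<sigma>)) x *\<^sub>R (\<epsilon> / \<sigma>)) \<le> vol * (3 * \<sigma>) ^ 3 * (\<epsilon> / \<sigma>)"
        using content_cball[of "3 * \<sigma>" "0::real^3"] \<sigma> by (simp add: vol_def)
    qed (use H \<sigma> \<epsilon> in auto)
    also have "\<dots> = H * (1/8 + 27 * vol / 8) * \<epsilon>"
      using \<sigma> \<epsilon> by (simp add: \<rho>_def field_simps power2_eq_square power3_eq_cube)
    finally have "k * cmod (LINT x|lebesgue. cdot (Jd x) (\<phi> x)) \<le> H * (1/8 + 27 * vol / 8) * \<epsilon>"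
      unfolding weak[OF \<phi>t] using k by (simp add: norm_mult)
    moreover have "(LINT x|lebesgue. cdot (Jd x) (\<phi> x)) = I"
      unfolding I_def
    proof (rule integral_cong_AE)
      show "(\<lambda>x. cdot (Jd x) (\<phi> x)) \<in> borel_measurable lebesgue"
        by (intro borel_measurable_cdot Jd(1) borel_measurable_lebesgue_continuous smooth_onD(3)[OF \<phi>s])
      have "continuous_on UNIV (\<lambda>x. ccross (grad u x) c)"
        unfolding curl_smult_const[OF u, symmetric]
        by (intro smooth_onD(3) smooth_on_curl smooth_on_smult_const open_UNIV u)
      then show "(\<lambda>x. cdot (Jd x) (ccross (grad u x) c)) \<in> borel_measurable lebesgue"
        by (intro borel_measurable_cdot Jd(1) borel_measurable_lebesgue_continuous)
      \<comment> \<open>On the ball of radius \<open>R\<close>, which carries the source, the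
        cut-off equals 1, so \<phi> agrees there with the field built from \<open>u\<close>.\<close>
      have in_ball: "\<phi> x = ccross (grad u x) c" if "norm x < R" for x
      proof -
        have "partial i \<psi> x = partial i u x" for i
        proof (rule partial_cong_open[of "ball 0 R"])
          show "\<psi> y = u y" if "y \<in> ball 0 R" for y
            using that \<sigma> cutoff_inside[of y 0 \<rho>] by (simp add: \<psi>_def ccut_def \<rho>_def)
        qed (use that in auto)
        then show ?thesis by (simp add: \<phi>_def grad_def)
      qed
      show "AE x in lebesgue. cdot (Jd x) (\<phi> x) = cdot (Jd x) (ccross (grad u x) c)"
        using Jd(2)
      proof eventually_elim
        case (elim x)
        then show ?case using in_ball[of x] by (cases "norm x < R") (auto simp: cdot_def)
      qed
    qed
    ultimately show ?thesis by simp
  qed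
  have "k * cmod I \<le> 0"
  proof (rule field_le_epsilon)
    fix e :: real assume "e > 0"
    \<comment> \<open>The summand 1 keeps the divisor positive even if the constant is zero.\<close>
    define c0 where "c0 = H * (1/8 + 27 * vol / 8) + 1"
    have c0: "c0 > 0" using H vol by (simp add: c0_def add_nonneg_pos)
    have "k * cmod I \<le> H * (1/8 + 27 * vol / 8) * (e / c0)" using est[of "e / c0"] \<open>e > 0\<close> c0 by simp
    also have "\<dots> \<le> c0 * (e / c0)" using \<open>e > 0\<close> c0 by (intro mult_right_mono) (auto simp: c0_def)
    also have "\<dots> = 0 + e" using c0 by simp
    finally show "k * cmod I \<le> 0 + e" .
  qed
  then show ?thesis using k mult_pos_pos[OF k, of "cmod I"] by (simp add: I_def mult_le_0_iff)
qed

section \<open>Complex source beams\<close>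

text \<open>\<open>sinc_deriv 0\<close> is the entire function with \<open>sinc_deriv 0 (z\<^sup>2) = sin z / z\<close>, and
  \<open>sinc_deriv m\<close> is its \<open>m\<close>-th derivative.\<close>

definition sinc_coeff :: "nat \<Rightarrow> complex" where
  "sinc_coeff n = (- 1) ^ n / fact (2 * n + 1)"

definition sinc_deriv :: "nat \<Rightarrow> complex \<Rightarrow> complex" where
  "sinc_deriv m w = (\<Sum>n. (diffs ^^ m) sinc_coeff n * w ^ n)"

text \<open>The coefficients are dominated by those of the exponential series, and termwise
  differentiation preserves convergence everywhere.\<close>

lemma summable_sinc_coeff: "summable (\<lambda>n. (diffs ^^ m) sinc_coeff n * w ^ n)"
proof (induction m arbitrary: w)
  case 0
  show ?case
  proof (rule summable_comparison_test')
    show "summable (\<lambda>n. inverse (fact n) * norm w ^ n)" by (rule summable_exp)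
    show "norm ((diffs ^^ 0) sinc_coeff n * w ^ n) \<le> inverse (fact n) * norm w ^ n" for n
    proof -
      have "fact n \<le> (fact (2 * n + 1) :: real)" by (rule fact_mono) simp
      then have "inverse (fact (2 * n + 1)) \<le> (inverse (fact n) :: real)"
        by (intro le_imp_inverse_le) simp_all
      then show ?thesis
        by (simp add: sinc_coeff_def norm_mult norm_divide norm_power divide_inverse norm_inverse norm_fact mult_right_mono
            del: fact_Suc)
    qed
  qed
next
  case (Suc m)
  then show ?case using termdiff_converges_all[of "(diffs ^^ m) sinc_coeff"] by simp
qed

lemma sinc_deriv_has_derivative: "(sinc_deriv m has_field_derivative sinc_deriv (Suc m) w) (at w)"
  using termdiffs_strong_converges_everywhere[OF summable_sinc_coeff]
  by (simp add: sinc_deriv_def[abs_def])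

text \<open>The sine series is grouped in pairs: the even terms vanish and the odd ones carry the
  factor z.\<close>

lemma sinc_deriv_0: "z * sinc_deriv 0 (z\<^sup>2) = sin z"
proof -
  have "(\<lambda>n. \<Sum>m = n * 2..<n * 2 + 2. sin_coeff m *\<^sub>R z ^ m) sums sin z"
    by (rule sums_group[OF sin_converges]) simp
  moreover have "(\<Sum>m = n * 2..<n * 2 + 2. sin_coeff m *\<^sub>R z ^ m) = z * (sinc_coeff n * (z\<^sup>2) ^ n)" for n
  proof -
    have "{n * 2..<n * 2 + 2} = {2 * n, 2 * n + 1}" by auto
    then show ?thesis
      by (simp add: sin_coeff_def sinc_coeff_def power_mult scaleR_conv_of_real del: fact_Suc)
  qed
  ultimately have "(\<lambda>n. z * (sinc_coeff n * (z\<^sup>2) ^ n)) sums sin z" by simp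
  moreover have "(\<lambda>n. z * (sinc_coeff n * (z\<^sup>2) ^ n)) sums (z * sinc_deriv 0 (z\<^sup>2))"
    using summable_sums[OF summable_sinc_coeff[of 0 "z\<^sup>2"]]
    by (intro sums_mult) (simp add: sinc_deriv_def)
  ultimately show ?thesis using sums_unique2 by blast
qed

lemma sinc_deriv_square_has_derivative:
  "((\<lambda>z. sinc_deriv m (z\<^sup>2)) has_field_derivative sinc_deriv (Suc m) (z\<^sup>2) * (2 * z)) (at z)"
proof -
  have "((\<lambda>z. z\<^sup>2) has_field_derivative 2 * z) (at z)" by (auto intro!: derivative_eq_intros)
  from DERIV_chain2[OF sinc_deriv_has_derivative this] show ?thesis .
qed

text \<open>The derivative of z S(z^2) = sin z, with S the entire function
  \<open>sinc_deriv 0\<close>.\<close>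

lemma sinc_deriv_1: "2 * z\<^sup>2 * sinc_deriv 1 (z\<^sup>2) + sinc_deriv 0 (z\<^sup>2) = cos z"
proof -
  have "((\<lambda>z. z * sinc_deriv 0 (z\<^sup>2)) has_field_derivative
      1 * sinc_deriv 0 (z\<^sup>2) + (sinc_deriv (Suc 0) (z\<^sup>2) * (2 * z)) * z) (at z)"
    by (rule DERIV_mult[OF DERIV_ident sinc_deriv_square_has_derivative])
  moreover have "(\<lambda>z. z * sinc_deriv 0 (z\<^sup>2)) = sin" using sinc_deriv_0 by (simp add: fun_eq_iff)
  ultimately have "1 * sinc_deriv 0 (z\<^sup>2) + (sinc_deriv (Suc 0) (z\<^sup>2) * (2 * z)) * z = cos z"
    using DERIV_unique[OF _ DERIV_sin] by simp
  then show ?thesis by (simp add: power2_eq_square mult_ac add.commute)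
qed

lemma sinc_deriv_2: "4 * z ^ 3 * sinc_deriv 2 (z\<^sup>2) + 6 * z * sinc_deriv 1 (z\<^sup>2) = - sin z"
proof -
  have z2: "((\<lambda>z. 2 * z\<^sup>2) has_field_derivative 4 * z) (at z)" by (auto intro!: derivative_eq_intros)
  have "((\<lambda>z. 2 * z\<^sup>2 * sinc_deriv 1 (z\<^sup>2) + sinc_deriv 0 (z\<^sup>2)) has_field_derivative
      (4 * z * sinc_deriv 1 (z\<^sup>2) + (sinc_deriv (Suc 1) (z\<^sup>2) * (2 * z)) * (2 * z\<^sup>2))
      + sinc_deriv (Suc 0) (z\<^sup>2) * (2 * z)) (at z)"
    by (rule DERIV_add[OF DERIV_mult[OF z2 sinc_deriv_square_has_derivative] sinc_deriv_square_has_derivative])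
  moreover have "(\<lambda>z. 2 * z\<^sup>2 * sinc_deriv 1 (z\<^sup>2) + sinc_deriv 0 (z\<^sup>2)) = cos"
    using sinc_deriv_1 by (simp add: fun_eq_iff)
  ultimately have "(4 * z * sinc_deriv 1 (z\<^sup>2) + (sinc_deriv (Suc 1) (z\<^sup>2) * (2 * z)) * (2 * z\<^sup>2))
      + sinc_deriv (Suc 0) (z\<^sup>2) * (2 * z) = - sin z"
    using DERIV_unique[OF _ DERIV_cos] by simp
  then show ?thesis
    by (simp add: power2_eq_square power3_eq_cube numeral_2_eq_2 algebra_simps)
qed

text \<open>The radial Helmholtz equation in three dimensions, written in the variable w = z^2. Away
  from 0 the sine is eliminated from the identities above; at 0, where division by z fails, the
  coefficients 1 and -1/6 decide.\<close>

lemma sinc_deriv_ode: "4 * w * sinc_deriv 2 w + 6 * sinc_deriv 1 w + sinc_deriv 0 w = 0"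
proof (cases "w = 0")
  case True
  have "sinc_deriv m 0 = (diffs ^^ m) sinc_coeff 0" for m
    unfolding sinc_deriv_def by (rule powser_zero)
  then show ?thesis using True by (simp add: diffs_def sinc_coeff_def fact_numeral)
next
  case False
  define z where "z = csqrt w"
  have z: "z\<^sup>2 = w" "z \<noteq> 0" using False by (auto simp: z_def)
  have "z * (4 * w * sinc_deriv 2 w + 6 * sinc_deriv 1 w + sinc_deriv 0 w) = 0"
    using sinc_deriv_2[of z] sinc_deriv_0[of z]
    by (simp add: z(1) power2_eq_square power3_eq_cube algebra_simps flip: z(1))
  then show ?thesis using z by simp
qed

lemma cmod_sin_le: "cmod (sin z) \<le> exp \<bar>Im z\<bar>" and cmod_cos_le: "cmod (cos z) \<le> exp \<bar>Im z\<bar>"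
  using cmod_sin_le_exp[of 1 z] cmod_cos_le_exp[of 1 z] by simp_all

text \<open>The identities for sine and cosine are solved for the derivatives in turn, each gaining
  a power of 1/|z|. Only Im z enters the constant, so these are decay estimates wherever Im z stays
  bounded.\<close>

lemma sinc_deriv_bounds:
  assumes z: "cmod z \<ge> 1" and E: "exp \<bar>Im z\<bar> \<le> E"
  shows "cmod (sinc_deriv 0 (z\<^sup>2)) \<le> E / cmod z"
    "cmod (sinc_deriv 1 (z\<^sup>2)) \<le> E / (cmod z)\<^sup>2"
    "cmod (sinc_deriv 2 (z\<^sup>2)) \<le> 2 * E / (cmod z) ^ 3"
proof -
  define r where "r = cmod z"
  have r: "r \<ge> 1" using z by (simp add: r_def)
  have E0: "E \<ge> 0" using E exp_ge_zero[of "\<bar>Im z\<bar>"] by linarith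
  have s: "cmod (sin z) \<le> E" and c: "cmod (cos z) \<le> E"
    using cmod_sin_le[of z] cmod_cos_le[of z] E by linarith+
  have b0: "r * cmod (sinc_deriv 0 (z\<^sup>2)) \<le> E"
    using s by (simp add: r_def flip: norm_mult sinc_deriv_0)
  have b0': "cmod (sinc_deriv 0 (z\<^sup>2)) \<le> r * cmod (sinc_deriv 0 (z\<^sup>2))"
    using mult_right_mono[OF r, of "cmod (sinc_deriv 0 (z\<^sup>2))"] by simp
  have "2 * z\<^sup>2 * sinc_deriv 1 (z\<^sup>2) = cos z - sinc_deriv 0 (z\<^sup>2)" using sinc_deriv_1[of z] by (simp add: algebra_simps)
  then have "cmod (2 * z\<^sup>2 * sinc_deriv 1 (z\<^sup>2)) \<le> E + E"
    using norm_triangle_ineq4[of "cos z" "sinc_deriv 0 (z\<^sup>2)"] c b0 b0' by simp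
  then have b1: "r\<^sup>2 * cmod (sinc_deriv 1 (z\<^sup>2)) \<le> E" by (simp add: norm_mult norm_power r_def)
  have b1': "r * cmod (sinc_deriv 1 (z\<^sup>2)) \<le> r\<^sup>2 * cmod (sinc_deriv 1 (z\<^sup>2))"
    using r by (intro mult_right_mono) (auto simp: power2_eq_square)
  have "4 * z ^ 3 * sinc_deriv 2 (z\<^sup>2) = - sin z - 6 * z * sinc_deriv 1 (z\<^sup>2)"
    using sinc_deriv_2[of z] by (simp add: algebra_simps)
  then have "cmod (4 * z ^ 3 * sinc_deriv 2 (z\<^sup>2)) \<le> E + 6 * E"
    using norm_triangle_ineq4[of "- sin z" "6 * z * sinc_deriv 1 (z\<^sup>2)"] s b1 b1'
    by (simp add: norm_mult r_def)
  \<comment> \<open>The constant 7/4 is rounded up to 2.\<close>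
  then have b2: "r ^ 3 * cmod (sinc_deriv 2 (z\<^sup>2)) \<le> 2 * E"
    using E0 by (simp add: norm_mult norm_power r_def)
  have zp: "0 < cmod z" "0 < (cmod z)\<^sup>2" "0 < (cmod z) ^ 3" using z by (auto intro!: zero_less_power)
  show "cmod (sinc_deriv 0 (z\<^sup>2)) \<le> E / cmod z"
    unfolding pos_le_divide_eq[OF zp(1)] using b0 by (simp add: r_def mult.commute)
  show "cmod (sinc_deriv 1 (z\<^sup>2)) \<le> E / (cmod z)\<^sup>2"
    unfolding pos_le_divide_eq[OF zp(2)] using b1 by (simp add: r_def mult.commute)
  show "cmod (sinc_deriv 2 (z\<^sup>2)) \<le> 2 * E / (cmod z) ^ 3"
    unfolding pos_le_divide_eq[OF zp(3)] using b2 by (simp add: r_def mult.commute)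
qed

text \<open>The spherical wave \<open>sin (k r) / (k r)\<close> with its source moved to the complex point
  \<open>\<i> t d\<close>. For fixed \<open>t\<close> it decays like \<open>1 / |x|\<close>; as \<open>t \<rightarrow> \<infinity>\<close> it becomes, after
  normalization, the plane wave in direction \<open>d\<close>.\<close>

definition beam_arg :: "real \<Rightarrow> real ^ 3 \<Rightarrow> real \<Rightarrow> real ^ 3 \<Rightarrow> complex" where
  "beam_arg k d t x = of_real (k\<^sup>2) *
     (\<Sum>j\<in>UNIV. (of_real (x $ j) - \<i> * of_real (t * d $ j)) * (of_real (x $ j) - \<i> * of_real (t * d $ j)))"

definition beam :: "real \<Rightarrow> real ^ 3 \<Rightarrow> real \<Rightarrow> real ^ 3 \<Rightarrow> complex" where
  "beam k d t x = sinc_deriv 0 (beam_arg k d t x)"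

lemma smooth_on_of_real_nth: "smooth_on UNIV (\<lambda>x. complex_of_real (x $ j))"
  by (rule smooth_on_bounded_linear[OF bounded_linear_of_real open_UNIV smooth_on_nth])

lemma partial_of_real_nth: "partial i (\<lambda>x. complex_of_real (x $ j)) x = (if i = j then 1 else 0)"
proof -
  have "bounded_linear (\<lambda>x::real^3. complex_of_real (x $ j))"
    by (rule bounded_linear_compose[OF bounded_linear_of_real bounded_linear_vec_nth])
  from partial_eqI[OF bounded_linear_imp_has_derivative[OF this]]
  show ?thesis by (simp add: axis_def)
qed

lemma smooth_on_beam_arg: "smooth_on UNIV (beam_arg k d t)"
  unfolding beam_arg_def[abs_def]
  by (intro smooth_on_mult smooth_on_const smooth_on_sum smooth_on_diff smooth_on_of_real_nth open_UNIV)

lemma partial_beam_arg: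
  "partial i (beam_arg k d t) x = 2 * of_real (k\<^sup>2) * (of_real (x $ i) - \<i> * of_real (t * d $ i))"
proof -
  define f where "f j x = complex_of_real (x $ j) - \<i> * of_real (t * d $ j)" for j and x :: "real^3"
  have fs: "smooth_on UNIV (f j)" for j
    unfolding f_def[abs_def] by (intro smooth_on_diff smooth_on_const smooth_on_of_real_nth open_UNIV)
  have fd: "f j differentiable (at x)" for j x by (rule smooth_onD(1)[OF fs UNIV_I])
  have fp: "partial i (f j) x = (if i = j then 1 else 0)" for i j x
    unfolding f_def[abs_def]
    by (subst partial_diff[OF smooth_onD(1)[OF smooth_on_of_real_nth UNIV_I] differentiable_const])
      (simp add: partial_of_real_nth)
  have ffd: "(\<lambda>x. f j x * f j x) differentiable (at x)" for j x
    by (rule differentiable_bilinear[OF bounded_bilinear_mult fd fd])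
  have sd: "(\<lambda>x. \<Sum>j\<in>UNIV. f j x * f j x) differentiable (at x)"
    using ffd by (intro differentiable_sum) auto
  have "partial i (\<lambda>x. of_real (k\<^sup>2) * (\<Sum>j\<in>UNIV. f j x * f j x)) x
      = of_real (k\<^sup>2) * (\<Sum>j\<in>UNIV. partial i (\<lambda>x. f j x * f j x) x)"
    unfolding partial_bounded_linear[OF bounded_linear_mult_right sd] partial_sum[OF ffd] ..
  also have "(\<Sum>j\<in>UNIV. partial i (\<lambda>x. f j x * f j x) x) = (\<Sum>j\<in>UNIV. if i = j then 2 * f j x else 0)"
    by (rule sum.cong) (auto simp: partial_mult[OF fd fd] fp)
  finally show ?thesis unfolding beam_arg_def[abs_def] f_def by simp
qed

lemma smooth_on_beam: "smooth_on UNIV (beam k d t)"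
  unfolding beam_def[abs_def]
  by (rule smooth_on_compose_field[where D = sinc_deriv, OF open_UNIV sinc_deriv_has_derivative smooth_on_beam_arg])

lemma partial_sinc_deriv_beam_arg:
  "partial i (\<lambda>x. sinc_deriv m (beam_arg k d t x)) x
    = sinc_deriv (Suc m) (beam_arg k d t x) * (2 * of_real (k\<^sup>2) * (of_real (x $ i) - \<i> * of_real (t * d $ i)))"
  using partial_compose_field(1)[OF sinc_deriv_has_derivative smooth_onD(1)[OF smooth_on_beam_arg UNIV_I]]
  by (simp add: partial_beam_arg)

lemma partial_beam:
  "partial i (beam k d t) x
    = sinc_deriv 1 (beam_arg k d t x) * (2 * of_real (k\<^sup>2) * (of_real (x $ i) - \<i> * of_real (t * d $ i)))"
  unfolding beam_def[abs_def] partial_sinc_deriv_beam_arg by simp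

lemma partial_partial_beam:
  "partial i (partial j (beam k d t)) x
    = sinc_deriv 2 (beam_arg k d t x) * (2 * of_real (k\<^sup>2) * (of_real (x $ i) - \<i> * of_real (t * d $ i)))
        * (2 * of_real (k\<^sup>2) * (of_real (x $ j) - \<i> * of_real (t * d $ j)))
      + sinc_deriv 1 (beam_arg k d t x) * (if i = j then 2 * of_real (k\<^sup>2) else 0)"
proof -
  have s1: "smooth_on UNIV (\<lambda>x. sinc_deriv 1 (beam_arg k d t x))"
    by (rule smooth_on_compose_field[where D = sinc_deriv, OF open_UNIV sinc_deriv_has_derivative smooth_on_beam_arg])
  have s2: "smooth_on UNIV (\<lambda>x. complex_of_real (x $ j) - \<i> * of_real (t * d $ j))"
    by (intro smooth_on_diff smooth_on_const smooth_on_of_real_nth open_UNIV)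
  have p2: "partial i (\<lambda>x. complex_of_real (x $ j) - \<i> * of_real (t * d $ j)) x = (if i = j then 1 else 0)"
    by (subst partial_diff[OF smooth_onD(1)[OF smooth_on_of_real_nth UNIV_I] differentiable_const])
      (simp add: partial_of_real_nth)
  have s3: "smooth_on UNIV (\<lambda>x. 2 * of_real (k\<^sup>2) * (complex_of_real (x $ j) - \<i> * of_real (t * d $ j)))"
    by (intro smooth_on_mult smooth_on_const s2 open_UNIV)
  have p3: "partial i (\<lambda>x. 2 * of_real (k\<^sup>2) * (complex_of_real (x $ j) - \<i> * of_real (t * d $ j))) x
      = (if i = j then 2 * of_real (k\<^sup>2) else 0)"
    using partial_bounded_linear[OF bounded_linear_mult_right smooth_onD(1)[OF s2 UNIV_I], of i "2 * of_real (k\<^sup>2)" x] p2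
    by simp
  have pj: "partial j (beam k d t) = (\<lambda>x. sinc_deriv 1 (beam_arg k d t x)
      * (2 * of_real (k\<^sup>2) * (complex_of_real (x $ j) - \<i> * of_real (t * d $ j))))"
    by (rule ext) (rule partial_beam)
  show ?thesis
    unfolding pj partial_mult[OF smooth_onD(1)[OF s1 UNIV_I] smooth_onD(1)[OF s3 UNIV_I]] p3
      partial_sinc_deriv_beam_arg Suc_1
    by (rule add.commute)
qed

text \<open>With q the argument and S the sinc function, the squared gradient of the argument is 4
  k^2 q and its Laplacian 6 k^2. The sum is therefore k^2 (4 q S'' + 6 S'), which the differential
  equation turns into -k^2 S.\<close>

lemma laplacian_beam: "laplacian (beam k d t) x = - of_real (k\<^sup>2) * beam k d t x"
proof -
  define q where "q = beam_arg k d t x"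
  define v where "v j = complex_of_real (x $ j) - \<i> * of_real (t * d $ j)" for j
  have "laplacian (beam k d t) x
      = (\<Sum>i\<in>UNIV. 4 * of_real (k\<^sup>2) * sinc_deriv 2 q * (of_real (k\<^sup>2) * (v i * v i)) + 2 * of_real (k\<^sup>2) * sinc_deriv 1 q)"
    unfolding laplacian_def partial_partial_beam q_def[symmetric] v_def[symmetric]
    by (rule sum.cong) (simp_all add: algebra_simps)
  also have "\<dots> = 4 * of_real (k\<^sup>2) * sinc_deriv 2 q * (\<Sum>i\<in>UNIV. of_real (k\<^sup>2) * (v i * v i)) + 6 * of_real (k\<^sup>2) * sinc_deriv 1 q"
    unfolding sum.distrib sum_distrib_left[symmetric] by simp
  also have "(\<Sum>i\<in>UNIV. of_real (k\<^sup>2) * (v i * v i)) = q"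
    by (simp add: q_def beam_arg_def v_def sum_distrib_left)
  also have "4 * of_real (k\<^sup>2) * sinc_deriv 2 q * q + 6 * of_real (k\<^sup>2) * sinc_deriv 1 q
      = of_real (k\<^sup>2) * (4 * q * sinc_deriv 2 q + 6 * sinc_deriv 1 q)" by (simp add: algebra_simps)
  also have "4 * q * sinc_deriv 2 q + 6 * sinc_deriv 1 q = - sinc_deriv 0 q"
    using sinc_deriv_ode[of q] by (simp add: eq_neg_iff_add_eq_0)
  finally have "laplacian (beam k d t) x = of_real (k\<^sup>2) * - sinc_deriv 0 q" .
  moreover have "beam k d t x = sinc_deriv 0 q" by (simp add: beam_def q_def)
  ultimately show ?thesis by simp
qed

lemma beam_arg_eq:
  assumes "norm d = 1"
  shows "beam_arg k d t x = of_real (k\<^sup>2) * (of_real ((norm x)\<^sup>2 - t\<^sup>2) - 2 * \<i> * of_real (t * (x \<bullet> d)))"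
proof -
  have d: "(d $ 1)\<^sup>2 + (d $ 2)\<^sup>2 + (d $ 3)\<^sup>2 = 1"
    using assms power2_norm_eq_inner[of d] by (simp add: inner_vec_def sum_3 power2_eq_square)
  have "(\<Sum>j\<in>UNIV. (complex_of_real (x $ j) - \<i> * of_real (t * d $ j)) * (of_real (x $ j) - \<i> * of_real (t * d $ j)))
      = of_real ((x $ 1)\<^sup>2 + (x $ 2)\<^sup>2 + (x $ 3)\<^sup>2 - t\<^sup>2 * ((d $ 1)\<^sup>2 + (d $ 2)\<^sup>2 + (d $ 3)\<^sup>2))
        - 2 * \<i> * of_real (t * (x $ 1 * d $ 1 + x $ 2 * d $ 2 + x $ 3 * d $ 3))"
    by (simp add: sum_3 power2_eq_square algebra_simps)
  moreover have "(norm x)\<^sup>2 = (x $ 1)\<^sup>2 + (x $ 2)\<^sup>2 + (x $ 3)\<^sup>2"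
    "x \<bullet> d = x $ 1 * d $ 1 + x $ 2 * d $ 2 + x $ 3 * d $ 3"
    unfolding power2_norm_eq_inner by (simp_all add: inner_vec_def sum_3 power2_eq_square)
  ultimately show ?thesis unfolding beam_arg_def d by (simp only: mult_1_right)
qed

text \<open>For |x| >= 2 t the argument q has real part comparable to (k |x|)^2 and imaginary part
  of order k^2 t |x|. Its root z thus has modulus at least k |x| / 2 and bounded imaginary part, so
  the exponential growth off the real axis only costs a constant depending on t.\<close>

lemma beam_decay:
  assumes d: "norm d = 1" and k: "k > 0" and t: "t > 0"
  shows "decays_inversely (beam k d t)"
proof -
  define E where "E = exp (4 * k * t)"
  \<comment> \<open>r >= 2 t gives Re q >= (k r)^2 / 4, r >= 2 / k gives |z| >= 1, and r >= 1 lets 1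
    / r^2 be replaced by 1 / r.\<close>
  define r0 where "r0 = max (2 * t) (max 1 (2 / k))"
  define C where "C = 2 * E / k + 16 * E + 256 * k * E + 8 * E"
  have E: "E > 0" by (simp add: E_def)
  have all: "cmod (beam k d t x) \<le> C / norm x \<and> cmod (partial i (beam k d t) x) \<le> C / norm x
    \<and> cmod (partial i (partial j (beam k d t)) x) \<le> C / norm x" if x: "r0 \<le> norm x" for x i j
  proof -
    define r where "r = norm x"
    have r: "2 * t \<le> r" "1 \<le> r" "2 / k \<le> r" using x by (auto simp: r_def r0_def)
    have kr: "k * r \<ge> 2" using r(3) k by (simp add: pos_divide_le_eq mult.commute)
    define q where "q = beam_arg k d t x"
    define z where "z = csqrt q"
    have z2: "z\<^sup>2 = q" by (simp add: z_def)
    have Req: "Re q = k\<^sup>2 * (r\<^sup>2 - t\<^sup>2)" and Imq: "Im q = - (k\<^sup>2 * (2 * t * (x \<bullet> d)))"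
      unfolding q_def beam_arg_eq[OF d] r_def by (simp_all add: power2_eq_square algebra_simps)
    have "(2 * t)\<^sup>2 \<le> r\<^sup>2" using r t by (intro power_mono) auto
    then have "4 * t\<^sup>2 \<le> r\<^sup>2" by (simp add: power_mult_distrib)
    then have "r\<^sup>2 / 4 \<le> r\<^sup>2 - t\<^sup>2" using zero_le_power2[of r] by linarith
    then have Req4: "k\<^sup>2 * (r\<^sup>2 / 4) \<le> Re q" unfolding Req by (rule mult_left_mono) simp
    have "(k * r / 2)\<^sup>2 \<le> (cmod z)\<^sup>2"
      using Req4 complex_Re_le_cmod[of q] z2 by (simp add: power_mult_distrib power_divide flip: norm_power)
    then have zr: "k * r / 2 \<le> cmod z" by (rule power2_le_imp_le) simp
    have z1: "1 \<le> cmod z" using zr kr by linarith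
    have Rez0: "0 \<le> Re z" unfolding z_def by (rule Re_csqrt)
    have "Re q = (Re z)\<^sup>2 - (Im z)\<^sup>2" "Im q = 2 * Re z * Im z"
      unfolding z2[symmetric] by (simp_all add: power2_eq_square)
    note Rq = this
    have "0 \<le> Re q" using Req4 by (rule order_trans[rotated]) simp
    then have "(cmod z)\<^sup>2 \<le> 2 * (Re z)\<^sup>2" using Rq(1) by (simp add: cmod_power2)
    moreover have "(2 * Re z)\<^sup>2 = 4 * (Re z)\<^sup>2" by (simp add: power_mult_distrib)
    ultimately have "(cmod z)\<^sup>2 \<le> (2 * Re z)\<^sup>2" using zero_le_power2[of "Re z"] by linarith
    then have "cmod z \<le> 2 * Re z" by (rule power2_le_imp_le) (use Rez0 in simp)
    then have Rez: "k * r / 4 \<le> Re z" using zr by linarith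
    \<comment> \<open>Im q = 2 Re z Im z is divided by the lower bound on 2 Re z.\<close>
    have "\<bar>Im z\<bar> \<le> 4 * k * t"
    proof -
      have "(k * r / 2) * \<bar>Im z\<bar> \<le> (2 * Re z) * \<bar>Im z\<bar>" using Rez by (intro mult_right_mono) auto
      also have "\<dots> = \<bar>Im q\<bar>" using Rq(2) Rez0 by (simp add: abs_mult)
      also have "\<dots> = k\<^sup>2 * (2 * t * \<bar>x \<bullet> d\<bar>)" using t unfolding Imq by (simp add: abs_mult)
      also have "\<dots> \<le> k\<^sup>2 * (2 * t * r)"
        using Cauchy_Schwarz_ineq2[of x d] d t by (intro mult_left_mono) (auto simp: r_def)
      also have "\<dots> = (k * r / 2) * (4 * k * t)" by (simp add: power2_eq_square)
      finally show ?thesis by (rule mult_left_le_imp_le) (use kr in simp)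
    qed
    then have "exp \<bar>Im z\<bar> \<le> E" by (simp add: E_def)
    note S = sinc_deriv_bounds[OF z1 this, unfolded z2]
    have rp: "r > 0" using r by simp
    have krp: "k * r / 2 > 0" using kr by simp
    have S0: "cmod (sinc_deriv 0 q) \<le> E / (k * r / 2)"
      by (rule order_trans[OF S(1)]) (intro frac_le zr order_refl krp less_imp_le[OF E])
    have S1: "cmod (sinc_deriv 1 q) \<le> E / (k * r / 2)\<^sup>2"
      by (rule order_trans[OF S(2)]) (intro frac_le power_mono zr order_refl zero_less_power krp less_imp_le[OF E] less_imp_le[OF krp])
    have S2: "cmod (sinc_deriv 2 q) \<le> 2 * E / (k * r / 2) ^ 3"
      by (rule order_trans[OF S(3)])
        (use E in \<open>intro frac_le power_mono zr order_refl zero_less_power krp less_imp_le[OF krp]; simp\<close>)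
    define v where "v j = complex_of_real (x $ j) - \<i> * of_real (t * d $ j)" for j
    have v: "cmod (v j) \<le> 2 * r" for j
    proof -
      have "cmod (v j) \<le> \<bar>x $ j\<bar> + \<bar>t * d $ j\<bar>"
        using norm_triangle_ineq4[of "complex_of_real (x $ j)" "\<i> * of_real (t * d $ j)"] by (simp add: v_def norm_mult abs_mult)
      also have "\<dots> \<le> r + t * 1"
        unfolding abs_mult r_def using component_le_norm_cart[of x j] component_le_norm_cart[of d j] d t
        by (intro add_mono mult_mono) auto
      finally show ?thesis using r t by simp
    qed
    have w: "cmod (2 * of_real (k\<^sup>2) * v j) \<le> 4 * k\<^sup>2 * r" for j
      using mult_left_mono[OF v[of j], of "2 * k\<^sup>2"] by (simp add: norm_mult norm_power)
    have b0: "cmod (beam k d t x) \<le> 2 * E / k / r"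
      using S0 by (simp add: beam_def q_def[symmetric] mult_ac)
    have b1: "cmod (partial i (beam k d t) x) \<le> 16 * E / r" for i
    proof -
      have "cmod (partial i (beam k d t) x) \<le> E / (k * r / 2)\<^sup>2 * (4 * k\<^sup>2 * r)"
        unfolding partial_beam norm_mult[of "sinc_deriv 1 _"] q_def[symmetric] v_def[symmetric]
        by (intro mult_mono S1 w) (use E in auto)
      also have "\<dots> = 16 * E / r" using k rp by (simp add: field_simps power2_eq_square)
      finally show ?thesis .
    qed
    have b2: "cmod (partial i (partial j (beam k d t)) x) \<le> 256 * k * E / r + 8 * E / r" for i j
    proof -
      have "cmod (sinc_deriv 2 q * (2 * of_real (k\<^sup>2) * v i) * (2 * of_real (k\<^sup>2) * v j))
          \<le> 2 * E / (k * r / 2) ^ 3 * (4 * k\<^sup>2 * r) * (4 * k\<^sup>2 * r)"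
        unfolding norm_mult[of _ "2 * of_real (k\<^sup>2) * v j"] norm_mult[of "sinc_deriv 2 q"]
        by (intro mult_mono S2 w) (use E kr rp in auto)
      also have "\<dots> = 256 * k * E / r" using k rp by (simp add: field_simps power2_eq_square power3_eq_cube)
      finally have 1: "cmod (sinc_deriv 2 q * (2 * of_real (k\<^sup>2) * v i) * (2 * of_real (k\<^sup>2) * v j)) \<le> 256 * k * E / r" .
      have "cmod (sinc_deriv 1 q * (if i = j then 2 * of_real (k\<^sup>2) else 0)) \<le> E / (k * r / 2)\<^sup>2 * (2 * k\<^sup>2)"
        unfolding norm_mult by (intro mult_mono S1) (use E in \<open>auto simp: norm_mult norm_power\<close>)
      also have "\<dots> = 8 * E / r / r" using k rp by (simp add: field_simps power2_eq_square)
      also have "\<dots> \<le> 8 * E / r / 1" using r E by (intro divide_left_mono) auto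
      finally have 2: "cmod (sinc_deriv 1 q * (if i = j then 2 * of_real (k\<^sup>2) else 0)) \<le> 8 * E / r" by simp
      show ?thesis
        unfolding partial_partial_beam q_def[symmetric] v_def[symmetric]
        by (rule norm_triangle_le) (intro add_mono 1 2)
    qed
    have Cr: "C / r = 2 * E / k / r + 16 * E / r + 256 * k * E / r + 8 * E / r" by (simp add: C_def add_divide_distrib)
    have nn: "0 \<le> 2 * E / k / r" "0 \<le> 16 * E / r" "0 \<le> 256 * k * E / r" "0 \<le> 8 * E / r" using E k rp by auto
    show ?thesis
      unfolding r_def[symmetric] Cr
      using b0 b1[of i] b2[of i j] nn by linarith
  qed
  have "C \<ge> 0" using E k by (simp add: C_def)
  with all show ?thesis unfolding decays_inversely_def by blast
qed

section \<open>Plane-wave limit of the beams\<close>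

definition beam_eps :: "real ^ 3 \<Rightarrow> real \<Rightarrow> real ^ 3 \<Rightarrow> complex" where
  "beam_eps d t x = 2 * \<i> * of_real (x \<bullet> d) * of_real (inverse t) - of_real ((norm x)\<^sup>2) * (of_real (inverse t))\<^sup>2"

text \<open>The square root of \<open>beam_arg\<close> on the branch close to \<i> k t: factoring
  out -(k t)^2 leaves 1 + \<open>beam_eps\<close>, which tends to 1, away from the cut of
  \<open>csqrt\<close>.\<close>

definition beam_root :: "real \<Rightarrow> real ^ 3 \<Rightarrow> real \<Rightarrow> real ^ 3 \<Rightarrow> complex" where
  "beam_root k d t x = \<i> * of_real (k * t) * csqrt (1 + beam_eps d t x)"

lemma beam_root_square:
  assumes "norm d = 1" "t > 0"
  shows "(beam_root k d t x)\<^sup>2 = beam_arg k d t x"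
    "beam_arg k d t x = - of_real ((k * t)\<^sup>2) * (1 + beam_eps d t x)"
proof -
  have t: "complex_of_real t * complex_of_real (inverse t) = 1"
    using assms(2) by (simp flip: of_real_mult)
  have "of_real ((k * t)\<^sup>2) * (1 + beam_eps d t x)
      = of_real (k\<^sup>2) * (of_real (t\<^sup>2) + 2 * \<i> * of_real (x \<bullet> d) * of_real t * (of_real t * of_real (inverse t))
        - of_real ((norm x)\<^sup>2) * (of_real t * of_real (inverse t))\<^sup>2)"
    by (simp only: beam_eps_def of_real_mult of_real_power) (simp add: algebra_simps power2_eq_square)
  then show 2: "beam_arg k d t x = - of_real ((k * t)\<^sup>2) * (1 + beam_eps d t x)"
    unfolding t beam_arg_eq[OF assms(1)] by (simp add: algebra_simps)
  show "(beam_root k d t x)\<^sup>2 = beam_arg k d t x"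
    unfolding 2 beam_root_def by (simp add: power_mult_distrib)
qed

text \<open>The derivative S' of the sinc function is eliminated by 2 q S' + S = cos z; in the
  resulting product every factor has a limit as t grows.\<close>

lemma normalized_beam_gradient:
  assumes d: "norm d = 1" and t: "t > 0" and k: "k > 0" and nz: "1 + beam_eps d t x \<noteq> 0"
  shows "of_real (t * exp (- (k * t))) * partial i (beam k d t) x
    = (of_real (exp (- (k * t))) * cos (beam_root k d t x)
        - of_real (exp (- (k * t))) * sinc_deriv 0 (beam_arg k d t x))
      * ((\<i> * of_real (d $ i) - of_real (x $ i) * of_real (inverse t)) / (1 + beam_eps d t x))"
proof -
  define q where "q = beam_arg k d t x"
  define e where "e = 1 + beam_eps d t x"
  define T where "T = complex_of_real t"
  define K where "K = complex_of_real k"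
  define X where "X = complex_of_real (exp (- (k * t)))"
  have q: "q = - (K\<^sup>2 * T\<^sup>2) * e"
    using beam_root_square(2)[OF d t] by (simp add: q_def e_def K_def T_def power_mult_distrib)
  have nz': "e \<noteq> 0" "K \<noteq> 0" "T \<noteq> 0" using nz k t by (auto simp: e_def K_def T_def)
  define s1 where "s1 = sinc_deriv 1 q"
  have "2 * q * s1 + sinc_deriv 0 q = cos (beam_root k d t x)"
    using sinc_deriv_1[of "beam_root k d t x"] unfolding beam_root_square(1)[OF d t] q_def s1_def .
  then have "cos (beam_root k d t x) - sinc_deriv 0 q = 2 * q * s1" by (simp add: algebra_simps)
  also have "2 * q * s1 = - 2 * (K\<^sup>2 * T\<^sup>2) * e * s1" by (subst q) simp
  finally have S: "cos (beam_root k d t x) - sinc_deriv 0 q = - 2 * (K\<^sup>2 * T\<^sup>2) * e * s1" .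
  have "of_real (t * exp (- (k * t))) * partial i (beam k d t) x
      = T * X * (s1 * (2 * K\<^sup>2 * (of_real (x $ i) - \<i> * (T * of_real (d $ i)))))"
    unfolding partial_beam q_def[symmetric] s1_def[symmetric] by (simp add: T_def X_def K_def)
  moreover have "X * (- 2 * (K\<^sup>2 * T\<^sup>2) * e * s1) * ((\<i> * of_real (d $ i) - of_real (x $ i) * inverse T) / e)
      = T * X * (s1 * (2 * K\<^sup>2 * (of_real (x $ i) - \<i> * (T * of_real (d $ i)))))"
    using nz' by (simp add: field_simps power2_eq_square)
  ultimately have "of_real (t * exp (- (k * t))) * partial i (beam k d t) x
      = X * (cos (beam_root k d t x) - sinc_deriv 0 q) * ((\<i> * of_real (d $ i) - of_real (x $ i) * inverse T) / e)"
    unfolding S by simp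
  then show ?thesis by (simp add: q_def e_def X_def T_def right_diff_distrib)
qed

text \<open>As \<open>beam_eps\<close> is about 2 \<i> (x . d) / t, the root z is about \<i> k t - k
  (x . d). Of the two exponentials in cos z only exp(-\<i> z) grows, like exp(k t + \<i> k (x . d)),
  and the normalization removes exp(k t). The sinc term has an additional factor 1/z and
  disappears.\<close>

lemma beam_gradient_tendsto_plane_wave:
  assumes d: "norm d = 1" and k: "k > 0"
  shows "((\<lambda>t. of_real (t * exp (- (k * t))) * partial i (beam k d t) x)
    \<longlongrightarrow> \<i> / 2 * exp (\<i> * of_real (k * (x \<bullet> d))) * of_real (d $ i)) at_top"
proof -
  define s where "s = complex_of_real (x \<bullet> d)"
  define \<rho> where "\<rho> = complex_of_real ((norm x)\<^sup>2)"
  define K where "K = complex_of_real k"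
  define w where "w t = complex_of_real (inverse t)" for t
  define \<epsilon> where "\<epsilon> t = beam_eps d t x" for t
  define \<zeta> where "\<zeta> t = csqrt (1 + \<epsilon> t)" for t
  define X where "X t = complex_of_real (exp (- (k * t)))" for t
  define z where "z t = beam_root k d t x" for t
  have w: "(w \<longlongrightarrow> 0) at_top"
  proof -
    have "((\<lambda>t. complex_of_real (inverse t)) \<longlongrightarrow> of_real 0) at_top"
      by (intro tendsto_of_real tendsto_inverse_0_at_top filterlim_ident)
    then show ?thesis by (simp only: w_def[abs_def] of_real_0)
  qed
  have \<epsilon>_eq: "\<epsilon> t = 2 * \<i> * s * w t - \<rho> * (w t)\<^sup>2" for t
    by (simp add: \<epsilon>_def beam_eps_def s_def \<rho>_def w_def)
  have \<epsilon>: "(\<epsilon> \<longlongrightarrow> 0) at_top"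
    unfolding \<epsilon>_eq[abs_def] using w by (auto intro!: tendsto_eq_intros)
  have one_eps: "((\<lambda>t. 1 + \<epsilon> t) \<longlongrightarrow> 1) at_top" using \<epsilon> by (auto intro!: tendsto_eq_intros)
  have "isCont csqrt 1" by (intro continuous_at_csqrt) (auto simp: complex_nonpos_Reals_iff)
  from isCont_tendsto_compose[OF this one_eps] have \<zeta>: "(\<zeta> \<longlongrightarrow> 1) at_top" by (simp add: \<zeta>_def[abs_def])
  have pos: "\<forall>\<^sub>F t::real in at_top. t > 0" by (rule eventually_gt_at_top)
  have \<zeta>1: "\<zeta> t + 1 \<noteq> 0" for t
  proof
    assume "\<zeta> t + 1 = 0"
    from arg_cong[OF this, of Re] have "Re (\<zeta> t) + 1 = 0" by simp
    moreover have "Re (\<zeta> t) \<ge> 0" unfolding \<zeta>_def by (rule Re_csqrt)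
    ultimately show False by linarith
  qed
  have tw: "of_real t * w t = 1" if "t > 0" for t using that by (simp add: w_def flip: of_real_mult)
  \<comment> \<open>The identity (\<zeta> - 1)(\<zeta> + 1) = \<epsilon> replaces a Taylor expansion
    of the square root; the denominator \<zeta> + 1 tends to 2.\<close>
  have phase: "((\<lambda>t. K * of_real t * (\<zeta> t - 1)) \<longlongrightarrow> \<i> * K * s) at_top"
  proof (rule Lim_transform_eventually)
    show "((\<lambda>t. K * (2 * \<i> * s - \<rho> * w t) / (\<zeta> t + 1)) \<longlongrightarrow> \<i> * K * s) at_top"
      using w \<zeta> by (auto intro!: tendsto_eq_intros)
    show "\<forall>\<^sub>F t in at_top. K * (2 * \<i> * s - \<rho> * w t) / (\<zeta> t + 1) = K * of_real t * (\<zeta> t - 1)"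
      using pos
    proof eventually_elim
      case (elim t)
      have "(\<zeta> t - 1) * (\<zeta> t + 1) = \<epsilon> t"
        using power2_csqrt[of "1 + \<epsilon> t"] by (simp add: \<zeta>_def algebra_simps power2_eq_square)
      have "of_real t * ((\<zeta> t - 1) * (\<zeta> t + 1)) = 2 * \<i> * s * (of_real t * w t) - \<rho> * w t * (of_real t * w t)"
        unfolding \<open>(\<zeta> t - 1) * (\<zeta> t + 1) = \<epsilon> t\<close> by (simp add: \<epsilon>_eq algebra_simps power2_eq_square)
      then have "2 * \<i> * s - \<rho> * w t = of_real t * (\<zeta> t - 1) * (\<zeta> t + 1)"
        unfolding tw[OF elim] by (simp add: mult.assoc)
      then show ?case using \<zeta>1[of t] by (simp add: mult.assoc)
    qed
  qed
  have grow: "((\<lambda>t. X t * exp (- (\<i> * z t))) \<longlongrightarrow> exp (\<i> * K * s)) at_top"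
  proof -
    have "X t * exp (- (\<i> * z t)) = exp (K * of_real t * (\<zeta> t - 1))" for t
    proof -
      have "X t * exp (- (\<i> * z t)) = exp (- (K * of_real t)) * exp (- (\<i> * z t))"
        by (simp add: X_def K_def exp_of_real[symmetric])
      also have "\<dots> = exp (- (K * of_real t) - \<i> * z t)" by (simp add: exp_add[symmetric])
      also have "- (K * of_real t) - \<i> * z t = K * of_real t * (\<zeta> t - 1)"
        by (simp add: z_def beam_root_def \<zeta>_def \<epsilon>_def K_def algebra_simps)
      finally show ?thesis .
    qed
    then show ?thesis using tendsto_exp[OF phase] by simp
  qed
  \<comment> \<open>\<open>csqrt\<close> has nonnegative real part, so exp(\<i> z) is bounded by 1
    and the normalization makes it vanish.\<close>
  have decay: "((\<lambda>t. X t * exp (\<i> * z t)) \<longlongrightarrow> 0) at_top"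
  proof (rule Lim_null_comparison)
    show "\<forall>\<^sub>F t in at_top. norm (X t * exp (\<i> * z t)) \<le> exp (- (k * t))"
      using pos
    proof eventually_elim
      case (elim t)
      have "Re (\<i> * z t) = - (k * t * Re (\<zeta> t))" by (simp add: z_def beam_root_def \<zeta>_def \<epsilon>_def)
      moreover have "Re (\<zeta> t) \<ge> 0" unfolding \<zeta>_def by (rule Re_csqrt)
      ultimately have "exp (Re (\<i> * z t)) \<le> 1" using k elim by simp
      then show ?case by (simp add: norm_mult X_def)
    qed
    have "filterlim (\<lambda>t. k * t) at_top at_top" using k by (simp add: filterlim_tendsto_pos_mult_at_top[OF tendsto_const] filterlim_ident)
    then show "((\<lambda>t. exp (- (k * t))) \<longlongrightarrow> 0) at_top"
      by (intro filterlim_compose[OF exp_at_bot] filterlim_compose[OF filterlim_uminus_at_bot_at_top])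
  qed
  have cosl: "((\<lambda>t. X t * cos (z t)) \<longlongrightarrow> exp (\<i> * K * s) / 2) at_top"
  proof -
    have eq: "(\<lambda>t. X t * cos (z t)) = (\<lambda>t. (X t * exp (\<i> * z t) + X t * exp (- (\<i> * z t))) / 2)"
      by (simp add: fun_eq_iff cos_exp_eq algebra_simps)
    have "((\<lambda>t. (X t * exp (\<i> * z t) + X t * exp (- (\<i> * z t))) / 2) \<longlongrightarrow> (0 + exp (\<i> * K * s)) / 2) at_top"
      by (intro tendsto_divide tendsto_add decay grow tendsto_const) simp
    then show ?thesis by (simp only: eq add_0)
  qed
  have sinl: "((\<lambda>t. X t * sin (z t)) \<longlongrightarrow> \<i> * exp (\<i> * K * s) / 2) at_top"
  proof -
    have eq: "(\<lambda>t. X t * sin (z t)) = (\<lambda>t. \<i> * (X t * exp (- (\<i> * z t)) - X t * exp (\<i> * z t)) / 2)"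
      by (simp add: fun_eq_iff sin_exp_eq' algebra_simps)
    have "((\<lambda>t. \<i> * (X t * exp (- (\<i> * z t)) - X t * exp (\<i> * z t)) / 2)
        \<longlongrightarrow> \<i> * (exp (\<i> * K * s) - 0) / 2) at_top"
      by (intro tendsto_divide tendsto_mult tendsto_diff decay grow tendsto_const) simp
    then show ?thesis by (simp only: eq diff_0_right)
  qed
  have Sl: "((\<lambda>t. X t * sinc_deriv 0 (beam_arg k d t x)) \<longlongrightarrow> 0) at_top"
  proof (rule Lim_transform_eventually)
    have "((\<lambda>t. (X t * sin (z t)) * (w t / (\<i> * K * \<zeta> t))) \<longlongrightarrow> (\<i> * exp (\<i> * K * s) / 2) * (0 / (\<i> * K * 1))) at_top"
      using k by (intro tendsto_mult tendsto_divide tendsto_const sinl w \<zeta>) (simp add: K_def)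
    then show "((\<lambda>t. (X t * sin (z t)) * (w t / (\<i> * K * \<zeta> t))) \<longlongrightarrow> 0) at_top" by simp
    have "\<forall>\<^sub>F t in at_top. \<zeta> t \<noteq> 0" using tendsto_imp_eventually_ne[OF \<zeta>, of 0] by simp
    with pos show "\<forall>\<^sub>F t in at_top. (X t * sin (z t)) * (w t / (\<i> * K * \<zeta> t)) = X t * sinc_deriv 0 (beam_arg k d t x)"
    proof eventually_elim
      case (elim t)
      have sin: "sin (z t) = z t * sinc_deriv 0 (beam_arg k d t x)"
        using sinc_deriv_0[of "z t"] beam_root_square(1)[OF d elim(1)] by (simp add: z_def)
      have one: "z t * (w t / (\<i> * K * \<zeta> t)) = 1"
        using elim k by (simp add: z_def beam_root_def \<zeta>_def \<epsilon>_def K_def w_def)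
      have "(X t * sin (z t)) * (w t / (\<i> * K * \<zeta> t))
          = X t * sinc_deriv 0 (beam_arg k d t x) * (z t * (w t / (\<i> * K * \<zeta> t)))"
        unfolding sin by (simp only: mult_ac)
      then show ?case unfolding one by simp
    qed
  qed
  have "((\<lambda>t. (X t * cos (z t) - X t * sinc_deriv 0 (beam_arg k d t x))
      * ((\<i> * of_real (d $ i) - of_real (x $ i) * w t) / (1 + \<epsilon> t)))
      \<longlongrightarrow> (exp (\<i> * K * s) / 2 - 0) * ((\<i> * of_real (d $ i) - of_real (x $ i) * 0) / 1)) at_top"
    by (intro tendsto_mult tendsto_diff tendsto_divide tendsto_const cosl Sl w one_eps) simp
  moreover have "\<forall>\<^sub>F t in at_top. 1 + \<epsilon> t \<noteq> 0" using tendsto_imp_eventually_ne[OF one_eps, of 0] by simp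
  with pos have "\<forall>\<^sub>F t in at_top. (X t * cos (z t) - X t * sinc_deriv 0 (beam_arg k d t x))
      * ((\<i> * of_real (d $ i) - of_real (x $ i) * w t) / (1 + \<epsilon> t))
      = of_real (t * exp (- (k * t))) * partial i (beam k d t) x"
  proof eventually_elim
    case (elim t)
    then show ?case
      using normalized_beam_gradient[OF d elim(1) k, of x i]
      by (simp add: X_def z_def w_def \<epsilon>_def)
  qed
  ultimately have "((\<lambda>t. of_real (t * exp (- (k * t))) * partial i (beam k d t) x)
      \<longlongrightarrow> (exp (\<i> * K * s) / 2 - 0) * ((\<i> * of_real (d $ i) - of_real (x $ i) * 0) / 1)) at_top"
    by (rule Lim_transform_eventually)
  then show ?thesis by (simp add: K_def s_def mult_ac)
qed

text \<open>Dominated convergence asks for a bound on the ball that is independent of t. Here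
  \<open>beam_eps\<close> is at most M/t in modulus with M = 2 R + R^2, so |z| exceeds k t by at
  most k M / 2, and exp(-k t) absorbs all growth in t.\<close>

lemma normalized_beam_gradient_bound:
  assumes d: "norm d = 1" and k: "k > 0" and R: "R > 0" "norm x \<le> R"
    and t: "t \<ge> 1" "t \<ge> 2 * (2 * R + R\<^sup>2)" "t \<ge> 2 / k"
  shows "cmod (of_real (t * exp (- (k * t))) * partial i (beam k d t) x)
    \<le> 4 * exp (k * (2 * R + R\<^sup>2) / 2) * (R + 1)"
proof -
  define \<epsilon> where "\<epsilon> = beam_eps d t x"
  define z where "z = beam_root k d t x"
  define M where "M = 2 * R + R\<^sup>2"
  have t0: "t > 0" using t by simp
  have kt: "k * t \<ge> 2" using t(3) k by (simp add: pos_divide_le_eq mult.commute)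
  have xd: "\<bar>x \<bullet> d\<bar> \<le> R" using Cauchy_Schwarz_ineq2[of x d] d R by simp
  have \<epsilon>M: "cmod \<epsilon> \<le> M / t"
  proof -
    have "cmod \<epsilon> \<le> 2 * \<bar>x \<bullet> d\<bar> * inverse t + (norm x)\<^sup>2 * (inverse t)\<^sup>2"
      unfolding \<epsilon>_def beam_eps_def using t0
      by (intro order_trans[OF norm_triangle_ineq4]) (simp add: norm_mult norm_power norm_inverse)
    also have "\<dots> \<le> 2 * R * inverse t + R\<^sup>2 * (inverse t)"
    proof (intro add_mono mult_mono)
      have "inverse t \<le> 1" using t(1) by (simp add: inverse_le_1_iff)
      then have "inverse t * inverse t \<le> 1 * inverse t" using t0 by (intro mult_right_mono) auto
      then show "(inverse t)\<^sup>2 \<le> inverse t" by (simp add: power2_eq_square)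
      show "(norm x)\<^sup>2 \<le> R\<^sup>2" using R by (intro power_mono) auto
    qed (use xd t0 R in auto)
    finally show ?thesis by (simp add: M_def divide_inverse distrib_right)
  qed
  have "M / t \<le> 1 / 2" using t(2) t0 by (simp add: M_def pos_divide_le_eq)
  then have \<epsilon>2: "cmod \<epsilon> \<le> 1 / 2" using \<epsilon>M by linarith
  have e_lower: "1 / 2 \<le> cmod (1 + \<epsilon>)" using norm_triangle_ineq4[of "1 + \<epsilon>" \<epsilon>] \<epsilon>2 by simp
  have nz: "1 + \<epsilon> \<noteq> 0" using e_lower by auto
  have cz: "cmod z = k * t * sqrt (cmod (1 + \<epsilon>))"
    using k t0 by (simp add: z_def beam_root_def \<epsilon>_def norm_mult abs_mult)
  have z1: "cmod z \<ge> 1"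
  proof -
    \<comment> \<open>1/2 is weakened to the perfect square 1/4; with k t >= 2 the modulus of z is
      then at least 1.\<close>
    have "sqrt (cmod (1 + \<epsilon>)) \<ge> sqrt (1 / 4)" using e_lower by (intro real_sqrt_le_mono) linarith
    then have "sqrt (cmod (1 + \<epsilon>)) \<ge> 1 / 2" by (simp add: real_sqrt_divide)
    then have "(k * t) * sqrt (cmod (1 + \<epsilon>)) \<ge> 2 * (1 / 2)" using kt by (intro mult_mono) auto
    then show ?thesis by (simp add: cz)
  qed
  have "\<bar>Im z\<bar> \<le> k * t + k * M / 2"
  proof -
    have "cmod (1 + \<epsilon>) \<le> 1 + cmod \<epsilon>" using norm_triangle_ineq[of 1 \<epsilon>] by simp
    \<comment> \<open>The square root is bounded by its tangent at 1, so that the leading term k t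
      is kept with its exact constant.\<close>
    also have "\<dots> \<le> (1 + cmod \<epsilon> / 2)\<^sup>2" by (simp add: power2_eq_square algebra_simps)
    finally have "sqrt (cmod (1 + \<epsilon>)) \<le> 1 + cmod \<epsilon> / 2" by (intro real_le_lsqrt) auto
    also have "\<dots> \<le> 1 + M / t / 2" using \<epsilon>M by simp
    finally have "cmod z \<le> k * t * (1 + M / t / 2)" unfolding cz using k t0 by (intro mult_left_mono) auto
    also have "\<dots> = k * t + k * M / 2" using t0 by (simp add: field_simps)
    finally show ?thesis using abs_Im_le_cmod[of z] by linarith
  qed
  then have "exp \<bar>Im z\<bar> \<le> exp (k * t + k * M / 2)" by simp
  note E = this
  have "cmod (sinc_deriv 0 (beam_arg k d t x)) \<le> exp (k * t + k * M / 2) / cmod z"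
    using sinc_deriv_bounds(1)[OF z1 E] by (simp add: z_def beam_root_square(1)[OF d t0])
  also have "\<dots> \<le> exp (k * t + k * M / 2) / 1" using z1 by (intro divide_left_mono) auto
  finally have S: "cmod (sinc_deriv 0 (beam_arg k d t x)) \<le> exp (k * t + k * M / 2)" by simp
  have c: "cmod (cos z) \<le> exp (k * t + k * M / 2)" using cmod_cos_le[of z] E by linarith
  define X where "X = complex_of_real (exp (- (k * t)))"
  have X: "cmod X = exp (- (k * t))" by (simp add: X_def)
  have XE: "exp (- (k * t)) * exp (k * t + k * M / 2) = exp (k * M / 2)" by (simp flip: exp_add)
  have f1: "cmod (X * cos z - X * sinc_deriv 0 (beam_arg k d t x)) \<le> 2 * exp (k * M / 2)"
  proof -
    have "cmod (X * cos z) \<le> exp (k * M / 2)" "cmod (X * sinc_deriv 0 (beam_arg k d t x)) \<le> exp (k * M / 2)"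
      unfolding norm_mult X XE[symmetric] using c S by (auto intro: mult_left_mono)
    then show ?thesis using norm_triangle_ineq4[of "X * cos z" "X * sinc_deriv 0 (beam_arg k d t x)"] by linarith
  qed
  have f2: "cmod ((\<i> * of_real (d $ i) - of_real (x $ i) * of_real (inverse t)) / (1 + \<epsilon>)) \<le> (R + 1) / (1 / 2)"
    unfolding norm_divide
  proof (rule frac_le)
    have "cmod (\<i> * of_real (d $ i) - of_real (x $ i) * of_real (inverse t)) \<le> \<bar>d $ i\<bar> + \<bar>x $ i\<bar> * inverse t"
      using t0 by (intro order_trans[OF norm_triangle_ineq4]) (simp add: norm_mult norm_inverse)
    also have "\<bar>x $ i\<bar> * inverse t \<le> R * 1"
    proof (intro mult_mono)
      show "inverse t \<le> 1" using t(1) by (simp add: inverse_le_1_iff)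
    qed (use component_le_norm_cart[of x i] R t0 in auto)
    also have "\<bar>d $ i\<bar> \<le> 1" using component_le_norm_cart[of d i] d by simp
    finally show "cmod (\<i> * of_real (d $ i) - of_real (x $ i) * of_real (inverse t)) \<le> R + 1" by simp
  qed (use R e_lower in auto)
  have "cmod (of_real (t * exp (- (k * t))) * partial i (beam k d t) x)
      \<le> (2 * exp (k * M / 2)) * ((R + 1) / (1 / 2))"
    unfolding normalized_beam_gradient[OF d t0 k nz[unfolded \<epsilon>_def]] norm_mult
      X_def[symmetric] z_def[symmetric] \<epsilon>_def[symmetric]
    by (rule mult_mono[OF f1 f2]) auto
  also have "\<dots> = 4 * exp (k * (2 * R + R\<^sup>2) / 2) * (R + 1)" by (simp add: M_def)
  finally show ?thesis .
qed

lemma ccross_smult_cdot: "cdot w (ccross (a *s u) c) = a * cdot w (ccross u c)"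
  by (simp add: ccross_smult_left cdot_smult_right)

text \<open>The normalized beam gradients converge pointwise to a multiple of the plane wave times
  \<open>d\<close> and are uniformly bounded on the ball that carries \<open>Jd\<close>, so the
  orthogonality passes to the limit.\<close>

lemma plane_wave_orthogonality:
  fixes Jd :: "real ^ 3 \<Rightarrow> complex ^ 3"
  assumes d: "norm d = 1" and k: "k > 0" and R: "R > 0"
    and Jd: "integrable lebesgue (\<lambda>x. norm (Jd x))" "Jd \<in> borel_measurable lebesgue"
      "AE x in lebesgue. R \<le> norm x \<longrightarrow> Jd x = 0"
    and beams: "\<And>t. t > 0 \<Longrightarrow> (LINT x|lebesgue. cdot (Jd x) (ccross (grad (beam k d t) x) c)) = 0"
  shows "(LINT x|lebesgue. exp (\<i> * of_real (k * (x \<bullet> d))) * cdot (Jd x) (ccross (cvec d) c)) = 0"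
proof -
  define G where "G t x = of_real (t * exp (- (k * t))) *s grad (beam k d t) x" for t x
  define P where "P x = (\<i> / 2 * exp (\<i> * of_real (k * (x \<bullet> d)))) *s cvec d" for x
  define H where "H = 4 * exp (k * (2 * R + R\<^sup>2) / 2) * (R + 1)"
  have H: "H \<ge> 0" using R by (simp add: H_def)
  have P_smooth_cross: "continuous_on UNIV (\<lambda>x. ccross (P x) c)"
    unfolding P_def ccross_smult_left
    unfolding vector_scalar_mult_def by (intro continuous_on_vec_lambda continuous_intros)
  have "((\<lambda>t. LINT x|lebesgue. cdot (Jd x) (ccross (G t x) c)) \<longlongrightarrow> (LINT x|lebesgue. cdot (Jd x) (ccross (P x) c))) at_top"
  proof (rule integral_dominated_convergence_at_top[where w = "\<lambda>x. 6 * norm c * H * norm (Jd x)"])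
    show "(\<lambda>x. cdot (Jd x) (ccross (P x) c)) \<in> borel_measurable lebesgue"
      by (intro borel_measurable_cdot Jd(2) borel_measurable_lebesgue_continuous P_smooth_cross)
    show "(\<lambda>x. cdot (Jd x) (ccross (G t x) c)) \<in> borel_measurable lebesgue" for t
    proof -
      have "continuous_on UNIV (\<lambda>x. ccross (grad (beam k d t) x) c)"
        unfolding curl_smult_const[OF smooth_on_beam, symmetric]
        by (intro smooth_onD(3) smooth_on_curl smooth_on_smult_const open_UNIV smooth_on_beam)
      then show ?thesis
        unfolding G_def ccross_smult_cdot
        by (intro borel_measurable_times borel_measurable_const borel_measurable_cdot Jd(2)
            borel_measurable_lebesgue_continuous)
    qed
    show "integrable lebesgue (\<lambda>x. 6 * norm c * H * norm (Jd x))" by (intro integrable_mult_right Jd(1))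
    show "AE x in lebesgue. ((\<lambda>t. cdot (Jd x) (ccross (G t x) c)) \<longlongrightarrow> cdot (Jd x) (ccross (P x) c)) at_top"
    proof (rule AE_I2)
      fix x
      have "((\<lambda>t. G t x $ i) \<longlongrightarrow> P x $ i) at_top" for i
        using beam_gradient_tendsto_plane_wave[OF d k, of i x]
        by (simp add: G_def P_def grad_def cvec_def)
      then have "((\<lambda>t. G t x) \<longlongrightarrow> P x) at_top" by (rule vec_tendstoI)
      then show "((\<lambda>t. cdot (Jd x) (ccross (G t x) c)) \<longlongrightarrow> cdot (Jd x) (ccross (P x) c)) at_top"
        unfolding cdot_3 ccross_nth by (intro tendsto_intros)
    qed
    have "\<forall>\<^sub>F t in at_top. t \<ge> max 1 (max (2 * (2 * R + R\<^sup>2)) (2 / k))" by (rule eventually_ge_at_top)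
    then show "\<forall>\<^sub>F t in at_top. AE x in lebesgue. norm (cdot (Jd x) (ccross (G t x) c)) \<le> 6 * norm c * H * norm (Jd x)"
    proof eventually_elim
      case (elim t)
      show ?case
        using Jd(3)
      proof eventually_elim
        case (elim x)
        show ?case
        proof (cases "norm x \<le> R")
          case True
          have "cmod (G t x $ i) \<le> H" for i
            using normalized_beam_gradient_bound[OF d k R True, of t i] \<open>max 1 (max (2 * (2 * R + R\<^sup>2)) (2 / k)) \<le> t\<close>
            by (simp add: G_def grad_def H_def)
          then show ?thesis by (rule cmod_cdot_ccross_le)
        next
          case False
          then show ?thesis using elim by (simp add: cdot_def)
        qed
      qed
    qed
  qed
  moreover have "\<forall>\<^sub>F t in at_top. (LINT x|lebesgue. cdot (Jd x) (ccross (G t x) c)) = 0"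
    using eventually_gt_at_top[of 0]
  proof eventually_elim
    case (elim t)
    then show ?case unfolding G_def ccross_smult_cdot by (simp add: beams)
  qed
  ultimately have "(LINT x|lebesgue. cdot (Jd x) (ccross (P x) c)) = 0"
    using tendsto_unique[OF _ _ tendsto_eventually] trivial_limit_at_top_linorder by blast
  moreover have "cdot (Jd x) (ccross (P x) c) = \<i> / 2 * (exp (\<i> * of_real (k * (x \<bullet> d))) * cdot (Jd x) (ccross (cvec d) c))" for x
    unfolding P_def ccross_smult_cdot by (simp only: mult.assoc)
  ultimately show ?thesis by simp
qed

section \<open>Fourier coefficients\<close>

text \<open>Lebesgue measure is the image of the product of one-dimensional measures under the
  coordinate map, and for the product measure Fubini's theorem applies.\<close>

lemma lborel_integral_prod:
  fixes f :: "'a::euclidean_space \<Rightarrow> real \<Rightarrow> complex"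
  assumes "\<And>b. b \<in> Basis \<Longrightarrow> integrable lborel (f b)"
  shows "(LINT x|lborel. (\<Prod>b\<in>Basis. f b (x \<bullet> b))) = (\<Prod>b\<in>Basis. integral\<^sup>L lborel (f b))"
proof -
  interpret product_sigma_finite "\<lambda>b::'a. lborel :: real measure" ..
  have meas: "f b \<in> borel_measurable borel" if "b \<in> Basis" for b
    using borel_measurable_integrable[OF assms[OF that]] by simp
  have m: "(\<lambda>x::'a. \<Prod>b\<in>Basis. f b (x \<bullet> b)) \<in> borel_measurable borel"
    by (intro borel_measurable_prod measurable_compose[OF _ meas]) auto
  have "(LINT x|(lborel::'a measure). (\<Prod>b\<in>Basis. f b (x \<bullet> b)))
      = (LINT g|Pi\<^sub>M Basis (\<lambda>b::'a. lborel). (\<Prod>b\<in>Basis. f b ((\<Sum>b\<in>Basis. g b *\<^sub>R b) \<bullet> b)))"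
    by (subst lborel_eq, rule integral_distr) (use m in measurable)
  also have "\<dots> = (LINT g|Pi\<^sub>M Basis (\<lambda>b::'a. lborel). (\<Prod>b\<in>Basis. f b (g b)))"
    by (intro Bochner_Integration.integral_cong prod.cong) simp_all
  also have "\<dots> = (\<Prod>b\<in>Basis. integral\<^sup>L lborel (f b))"
    by (rule product_integral_prod) (use assms in auto)
  finally show ?thesis .
qed

lemma has_integral_fourier_1d:
  fixes m :: int
  assumes L: "L > 0"
  shows "has_bochner_integral lborel (\<lambda>t. indicator {- L / 2<..<L / 2} t *\<^sub>R exp (\<i> * of_real (2 * pi / L * (of_int m * t))))
    (if m = 0 then of_real L else 0)"
proof -
  define c where "c = \<i> * complex_of_real (2 * pi / L * of_int m)"
  define F where "F t = (if m = 0 then complex_of_real t else exp (c * of_real t) / c)" for t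
  have hb: "has_bochner_integral lborel (\<lambda>t. indicator {- L / 2..L / 2} t *\<^sub>R exp (c * of_real t)) (F (L / 2) - F (- L / 2))"
  proof (rule has_bochner_integral_FTC_Icc)
    show "- L / 2 \<le> L / 2" using L by simp
    show "(F has_vector_derivative exp (c * of_real t)) (at t within {- L / 2..L / 2})" for t
    proof (cases "m = 0")
      case True
      have "(complex_of_real has_vector_derivative 1) (at t within {- L / 2..L / 2})"
        using has_vector_derivative_of_real[OF DERIV_ident] by simp
      then show ?thesis using True by (simp add: F_def[abs_def] c_def)
    next
      case False
      have c0: "c \<noteq> 0" using False L by (simp add: c_def)
      have "((\<lambda>z. exp (c * z) / c) has_field_derivative exp (c * of_real t)) (at (of_real t))"
        using c0 by (auto intro!: derivative_eq_intros)
      from has_vector_derivative_real_field[OF this]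
      show ?thesis using False by (simp add: F_def[abs_def])
    qed
    show "continuous_on {- L / 2..L / 2} (\<lambda>t. exp (c * of_real t))" by (intro continuous_intros)
  qed
  have F: "F (L / 2) - F (- L / 2) = (if m = 0 then of_real L else 0)"
  proof (cases "m = 0")
    case True
    then show ?thesis by (simp add: F_def flip: of_real_diff)
  next
    case False
    \<comment> \<open>The antiderivative is periodic: its values at the endpoints differ by the
      factor exp(2 pi \<i> m) = 1.\<close>
    have "exp (c * of_real (L / 2)) = exp (c * of_real (- L / 2)) * exp (2 * of_int m * of_real pi * \<i>)"
      unfolding exp_add[symmetric] using L by (simp add: c_def field_simps)
    also have "exp (2 * of_int m * of_real pi * \<i>) = (1::complex)"
      using exp_integer_2pi[of "of_int m"] by (simp add: mult_ac)
    finally show ?thesis using False by (simp add: F_def)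
  qed
  \<comment> \<open>The fundamental theorem of calculus is applied on the closed interval, while the
    cube is open; the two endpoints are null.\<close>
  have ae: "AE t in lborel. indicator {- L / 2..L / 2} t *\<^sub>R exp (c * of_real t)
      = indicator {- L / 2<..<L / 2} t *\<^sub>R exp (\<i> * of_real (2 * pi / L * (of_int m * t)))"
    using AE_lborel_singleton[of "- L / 2"] AE_lborel_singleton[of "L / 2"]
    by eventually_elim (auto simp: indicator_def c_def mult_ac)
  have m: "(\<lambda>t. indicator {- L / 2<..<L / 2} t *\<^sub>R exp (\<i> * of_real (2 * pi / L * (of_int m * t)))) \<in> borel_measurable lborel"
    "(\<lambda>t. indicator {- L / 2..L / 2} t *\<^sub>R exp (c * of_real t)) \<in> borel_measurable lborel"
    by (auto intro!: borel_measurable_scaleR borel_measurable_indicator borel_measurable_continuous_onI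
        continuous_intros)
  show ?thesis using hb unfolding F has_bochner_integral_cong_AE[OF m(2,1) ae] .
qed

lemma cube_eq_box: "cube L = box (\<chi> i. - L / 2) (\<chi> i. L / 2)"
  by (auto simp: cube_def mem_box_cart)

lemma Basis_real3: "(Basis :: (real^3) set) = range (\<lambda>i. axis i 1)"
  by (auto simp: Basis_vec_def)

lemma prod_Basis_cart: "(\<Prod>b\<in>(Basis :: (real^3) set). h b) = (\<Prod>i\<in>UNIV. h (axis i 1))"
proof -
  have "inj (\<lambda>i::3. axis i (1::real))" by (auto simp: inj_on_def axis_eq_axis)
  from prod.reindex[OF this, of h] show ?thesis unfolding Basis_real3 by (simp add: comp_def)
qed

text \<open>The exponential and the indicator of the cube factor over the coordinates, and some
  factor integrates to zero unless all components of \<open>n\<close> are zero.\<close>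

lemma integral_fourier_basis:
  assumes L: "L > 0"
  shows "(LINT x:cube L|lebesgue. fourier_basis L n x) = (if n = 0 then of_real (L ^ 3) else 0)"
proof -
  define g where "g b t = indicator {- L / 2<..<L / 2} t *\<^sub>R
    exp (\<i> * of_real (2 * pi / L * ((rvec n \<bullet> b) * t)))" for b :: "real^3" and t
  have gi: "has_bochner_integral lborel (g (axis i 1)) (if n $ i = 0 then of_real L else 0)" for i
    using has_integral_fourier_1d[OF L, of "n $ i"]
    by (simp add: g_def[abs_def] inner_axis rvec_def)
  have prod: "indicator (cube L) x *\<^sub>R fourier_basis L n x = (\<Prod>b\<in>Basis. g b (x \<bullet> b))" for x
  proof -
    have e: "exp (\<i> * of_real (2 * pi / L * (rvec n \<bullet> x)))
        = (\<Prod>i\<in>UNIV. exp (\<i> * of_real (2 * pi / L * (rvec n $ i * x $ i))))"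
      unfolding exp_sum[OF finite, symmetric] by (simp add: inner_vec_def sum_distrib_left)
    show ?thesis
      unfolding prod_Basis_cart g_def inner_axis fourier_basis_def e
      by (auto simp: cube_def indicator_def prod_zero_iff)
  qed
  have "(LINT x:cube L|lebesgue. fourier_basis L n x) = (LINT x|lebesgue. (\<Prod>b\<in>Basis. g b (x \<bullet> b)))"
    by (simp add: set_lebesgue_integral_def prod)
  also have "\<dots> = (LINT x|lborel. (\<Prod>b\<in>Basis. g b (x \<bullet> b)))"
  proof (rule integral_completion)
    have "(\<lambda>x. indicator (cube L) x *\<^sub>R fourier_basis L n x) \<in> borel_measurable borel"
      unfolding fourier_basis_def cube_eq_box
      by (intro borel_measurable_scaleR borel_measurable_indicator borel_measurable_continuous_onI continuous_intros) simp
    then show "(\<lambda>x. \<Prod>b\<in>Basis. g b (x \<bullet> b)) \<in> borel_measurable lborel" by (simp add: prod)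
  qed
  also have "\<dots> = (\<Prod>b\<in>Basis. integral\<^sup>L lborel (g b))"
  proof (rule lborel_integral_prod)
    show "integrable lborel (g b)" if b: "b \<in> Basis" for b
    proof -
      obtain i where "b = axis i 1" using b unfolding Basis_real3 by blast
      then show ?thesis using gi by (auto simp: has_bochner_integral_iff)
    qed
  qed
  also have "\<dots> = (\<Prod>i\<in>UNIV. if n $ i = 0 then of_real L else 0)"
    unfolding prod_Basis_cart by (rule prod.cong) (use gi in \<open>auto simp: has_bochner_integral_iff\<close>)
  also have "\<dots> = (if n = 0 then of_real (L ^ 3) else 0)"
    by (auto simp: vec_eq_iff prod_zero_iff)
  finally show ?thesis .
qed

lemma fourier_basis_mult_cnj: "fourier_basis L m x * cnj (fourier_basis L l x) = fourier_basis L (m - l) x"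
proof -
  have "rvec (m - l) \<bullet> x = rvec m \<bullet> x - rvec l \<bullet> x"
    by (simp add: rvec_def inner_vec_def sum_subtractf[symmetric] left_diff_distrib)
  then show ?thesis
    by (simp add: fourier_basis_def exp_cnj exp_add[symmetric] right_diff_distrib)
qed

lemma continuous_on_fourier_basis: "continuous_on S (fourier_basis L n)"
  unfolding fourier_basis_def[abs_def] by (intro continuous_intros)

lemma integrable_cube_continuous:
  fixes f :: "real ^ 3 \<Rightarrow> 'b::euclidean_space"
  assumes "continuous_on UNIV f"
  shows "integrable lebesgue (\<lambda>x. indicator (cube L) x *\<^sub>R f x)"
  unfolding cube_eq_box
  by (rule integrable_on_subset_compact[OF compact_cbox continuous_on_subset[OF assms subset_UNIV]
        box_subset_cbox]) simp

lemma has_integral_fourier_basis: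
  assumes "L > 0"
  shows "has_bochner_integral lebesgue (\<lambda>x. indicator (cube L) x *\<^sub>R fourier_basis L n x)
    (if n = 0 then of_real (L ^ 3) else 0)"
  using integral_fourier_basis[OF assms, of n] integrable_cube_continuous[OF continuous_on_fourier_basis, of L L n]
  by (simp add: has_bochner_integral_iff set_lebesgue_integral_def)

lemma L2_on_UNIV:
  assumes "L2_on UNIV J"
  shows "J \<in> borel_measurable lebesgue" "integrable lebesgue (\<lambda>x. (norm (J x))\<^sup>2)"
  using assms by (simp_all add: L2_on_def set_borel_measurable_def set_integrable_def)

lemma le_one_plus_square: "(x::real) \<le> 1 + x\<^sup>2"
proof -
  have "0 \<le> (x - 1/2)\<^sup>2 + 3/4" by (rule add_nonneg_nonneg) simp_all
  also have "\<dots> = 1 + x\<^sup>2 - x" by (simp add: power2_eq_square algebra_simps)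
  finally show ?thesis by simp
qed

text \<open>On a set of finite measure the bound |J| <= 1 + |J|^2 takes the place of the
  Cauchy-Schwarz inequality.\<close>

lemma integrable_square_integrable_on_bounded:
  fixes J :: "real ^ 3 \<Rightarrow> 'b::euclidean_space"
  assumes J: "J \<in> borel_measurable lebesgue" "integrable lebesgue (\<lambda>x. (norm (J x))\<^sup>2)"
    and A: "A \<in> sets borel" "bounded A"
  shows "integrable lebesgue (\<lambda>x. indicator A x *\<^sub>R J x)"
proof -
  have m: "A \<in> sets lebesgue" using A(1) by simp
  have "emeasure lborel A < \<infinity>" by (rule emeasure_bounded_finite[OF A(2)])
  then have "integrable lebesgue (\<lambda>x. indicator A x :: real)"
    using A(1) m by (intro integrable_real_indicator) (simp_all add: emeasure_completion)
  moreover have "integrable lebesgue (\<lambda>x. indicator A x *\<^sub>R (norm (J x))\<^sup>2)"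
    by (rule integrable_mult_indicator[OF m J(2)])
  ultimately have "integrable lebesgue (\<lambda>x. indicator A x + indicator A x *\<^sub>R (norm (J x))\<^sup>2)"
    by (rule Bochner_Integration.integrable_add)
  then show ?thesis
  proof (rule Bochner_Integration.integrable_bound)
    show "(\<lambda>x. indicator A x *\<^sub>R J x) \<in> borel_measurable lebesgue"
      using J(1) m by (intro borel_measurable_scaleR borel_measurable_indicator)
    show "AE x in lebesgue. norm (indicator A x *\<^sub>R J x) \<le> norm (indicator A x + indicator A x *\<^sub>R (norm (J x))\<^sup>2)"
      using le_one_plus_square by (intro AE_I2) (auto simp: indicator_def)
  qed
qed

lemma integrable_fourier_integrand:
  assumes "L2_on UNIV J"
  shows "integrable lebesgue (\<lambda>x. indicator (cube L) x *\<^sub>R (J x $ j * cnj (fourier_basis L l x)))"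
proof -
  have "cube L \<in> sets borel" "bounded (cube L)" by (simp_all add: cube_eq_box)
  then have i: "integrable lebesgue (\<lambda>x. (indicator (cube L) x *\<^sub>R J x) $ j)"
    by (intro integrable_bounded_linear[OF bounded_linear_vec_nth]
        integrable_square_integrable_on_bounded L2_on_UNIV assms)
  show ?thesis
  proof (rule Bochner_Integration.integrable_bound[OF i])
    have "(\<lambda>x. (indicator (cube L) x *\<^sub>R J x) $ j * cnj (fourier_basis L l x)) \<in> borel_measurable lebesgue"
      by (intro borel_measurable_times borel_measurable_integrable[OF i] borel_measurable_lebesgue_continuous
          continuous_on_cnj continuous_on_fourier_basis)
    then show "(\<lambda>x. indicator (cube L) x *\<^sub>R (J x $ j * cnj (fourier_basis L l x))) \<in> borel_measurable lebesgue"
      by simp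
    show "AE x in lebesgue. norm (indicator (cube L) x *\<^sub>R (J x $ j * cnj (fourier_basis L l x)))
        \<le> norm ((indicator (cube L) x *\<^sub>R J x) $ j)"
      by (intro AE_I2) (simp add: norm_mult fourier_basis_def)
  qed
qed

text \<open>A single finite partial sum suffices, if its index set contains \<open>l\<close> and it
  is close to \<open>J\<close> in L2. Its \<open>l\<close>-th coefficient is exact by orthogonality,
  and on a cube of finite volume the L2 distance controls the error.\<close>

lemma expansion_coefficient:
  assumes L: "L > 0" and J: "L2_on UNIV J" and ex: "termwise_expansion L p f g J"
    and l: "1 \<le> norm (rvec l)"
  shows "(LINT x:cube L|lebesgue. J x $ j * cnj (fourier_basis L l x))
    = of_real (L ^ 3) * ((fourier_coeff L f l *s cvec p +
      (2 * of_real pi * \<i> / of_real L * fourier_coeff L g l) *s cvec (cross3 p (rvec l))) $ j)"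
proof -
  define v where "v m = fourier_coeff L f m *s cvec p +
      (2 * of_real pi * \<i> / of_real L * fourier_coeff L g m) *s cvec (cross3 p (rvec m))" for m
  define c0 where "c0 = fourier_coeff L f 0 *s cvec p"
  define T where "T S x = c0 + (\<Sum>m\<in>S. source_term L p f g m x)" for S x
  define ic where "ic x = indicat_real (cube L) x" for x
  define I where "I = (LINT x|lebesgue. ic x *\<^sub>R (J x $ j * cnj (fourier_basis L l x)))"
  note Jm = L2_on_UNIV[OF J]
  have cb: "cube L \<in> sets borel" "bounded (cube L)" by (simp_all add: cube_eq_box)
  have l0: "l \<noteq> 0" using l by (auto simp: rvec_def norm_vec_def L2_set_def)
  have Tcont: "continuous_on UNIV (T S)" for S
    unfolding T_def source_term_def vector_scalar_mult_def
    by (intro continuous_intros continuous_on_vec_lambda continuous_on_fourier_basis)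
  have Tint: "has_bochner_integral lebesgue (\<lambda>x. ic x *\<^sub>R (T S x $ j * cnj (fourier_basis L l x)))
      (of_real (L ^ 3) * v l $ j)" if S: "finite S" "l \<in> S" for S
  proof -
    have f0: "fourier_basis L 0 x = 1" for x by (simp add: fourier_basis_def rvec_def inner_vec_def)
    have st: "source_term L p f g m x = fourier_basis L m x *s v m" for m x
      by (simp only: source_term_def v_def)
    have "T S x $ j * cnj (fourier_basis L l x)
        = c0 $ j * (fourier_basis L 0 x * cnj (fourier_basis L l x))
          + (\<Sum>m\<in>S. v m $ j * (fourier_basis L m x * cnj (fourier_basis L l x)))" for x
      by (simp add: T_def st f0 distrib_left sum_distrib_left mult_ac)
    then have eq: "(\<lambda>x. ic x *\<^sub>R (T S x $ j * cnj (fourier_basis L l x)))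
        = (\<lambda>x. c0 $ j * (ic x *\<^sub>R fourier_basis L (0 - l) x) + (\<Sum>m\<in>S. v m $ j * (ic x *\<^sub>R fourier_basis L (m - l) x)))"
      unfolding fourier_basis_mult_cnj by (simp add: fun_eq_iff scaleR_right_distrib scaleR_sum_right)
    have "has_bochner_integral lebesgue (\<lambda>x. c0 $ j * (ic x *\<^sub>R fourier_basis L (0 - l) x)
        + (\<Sum>m\<in>S. v m $ j * (ic x *\<^sub>R fourier_basis L (m - l) x)))
        (c0 $ j * (if 0 - l = 0 then of_real (L ^ 3) else 0) + (\<Sum>m\<in>S. v m $ j * (if m - l = 0 then of_real (L ^ 3) else 0)))"
      unfolding ic_def
      by (intro has_bochner_integral_add has_bochner_integral_sum has_bochner_integral_mult_right
          has_integral_fourier_basis L)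
    moreover have "(\<Sum>m\<in>S. v m $ j * (if m - l = 0 then of_real (L ^ 3) else 0)) = (\<Sum>m\<in>S. if m = l then v l $ j * of_real (L ^ 3) else 0)"
      by (rule sum.cong) auto
    ultimately show ?thesis unfolding eq using S l0 by (simp add: mult.commute)
  qed
  have Jint: "integrable lebesgue (\<lambda>x. ic x *\<^sub>R (J x $ j * cnj (fourier_basis L l x)))"
    unfolding ic_def by (rule integrable_fourier_integrand[OF J])
  have "norm (I - of_real (L ^ 3) * v l $ j) \<le> 0"
  proof (rule field_le_epsilon)
    fix e :: real assume e: "e > 0"
    \<comment> \<open>Chosen such that the two error terms \<delta>^2 / \<delta> and \<delta> L^3
      add up to e.\<close>
    define \<delta> where "\<delta> = e / (1 + L ^ 3)"
    have L3: "1 + L ^ 3 > 0" using L by (simp add: add_pos_pos)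
    have \<delta>: "\<delta> > 0" using e L3 by (simp add: \<delta>_def)
    have "((\<lambda>S. LINT x:cube L|lebesgue. (norm (J x - T S x))\<^sup>2) \<longlongrightarrow> 0) (finite_subsets_at_top {l. 1 \<le> norm (rvec l)})"
      using ex unfolding termwise_expansion_def T_def c0_def .
    then have "\<forall>\<^sub>F S in finite_subsets_at_top {l. 1 \<le> norm (rvec l)}. (LINT x:cube L|lebesgue. (norm (J x - T S x))\<^sup>2) < \<delta>\<^sup>2"
      by (rule order_tendstoD(2)) (use \<delta> in simp)
    \<comment> \<open>Containing \<open>l\<close> is an eventual property along the net of finite
      index sets; without it the term of index \<open>l\<close> would be missing from the partial
      sum.\<close>
    moreover have "\<forall>\<^sub>F S in finite_subsets_at_top {l. 1 \<le> norm (rvec l)}. finite S \<and> {l} \<subseteq> S"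
      unfolding eventually_finite_subsets_at_top using l by (intro exI[of _ "{l}"]) auto
    ultimately have "\<forall>\<^sub>F S in finite_subsets_at_top {l. 1 \<le> norm (rvec l)}.
        (LINT x:cube L|lebesgue. (norm (J x - T S x))\<^sup>2) < \<delta>\<^sup>2 \<and> finite S \<and> {l} \<subseteq> S"
      by (rule eventually_conj)
    then obtain S where S: "(LINT x:cube L|lebesgue. (norm (J x - T S x))\<^sup>2) < \<delta>\<^sup>2" "finite S" "l \<in> S"
      using eventually_happens[of _ "finite_subsets_at_top {l. 1 \<le> norm (rvec l)}"] finite_subsets_at_top_neq_bot
      by fastforce
    define q where "q x = ic x *\<^sub>R (norm (J x - T S x))\<^sup>2" for x
    have qint: "integrable lebesgue q"
    proof -
      have "integrable lebesgue (\<lambda>x. 2 * (norm (J x))\<^sup>2 + 2 * (ic x *\<^sub>R (norm (T S x))\<^sup>2))"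
        unfolding ic_def
        by (intro Bochner_Integration.integrable_add integrable_mult_right Jm(2) integrable_cube_continuous
            continuous_intros Tcont)
      then show ?thesis
      proof (rule Bochner_Integration.integrable_bound)
        show "q \<in> borel_measurable lebesgue"
          unfolding q_def[abs_def] ic_def using cb Jm(1) borel_measurable_lebesgue_continuous[OF Tcont]
          by (intro borel_measurable_scaleR borel_measurable_indicator borel_measurable_power
              borel_measurable_norm borel_measurable_diff) auto
        have "q x \<le> 2 * (norm (J x))\<^sup>2 + 2 * (ic x *\<^sub>R (norm (T S x))\<^sup>2)" for x
        proof (cases "x \<in> cube L")
          case True
          have "(norm (J x - T S x))\<^sup>2 \<le> (norm (J x) + norm (T S x))\<^sup>2"
            by (intro power_mono norm_triangle_ineq4) simp
          also have "\<dots> \<le> 2 * (norm (J x))\<^sup>2 + 2 * (norm (T S x))\<^sup>2"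
            using zero_le_power2[of "norm (J x) - norm (T S x)"] by (simp add: power2_eq_square algebra_simps)
          finally show ?thesis using True by (simp add: q_def ic_def)
        qed (simp add: q_def ic_def)
        moreover have "q x \<ge> 0" for x by (simp add: q_def ic_def)
        ultimately show "AE x in lebesgue. norm (q x) \<le> norm (2 * (norm (J x))\<^sup>2 + 2 * (ic x *\<^sub>R (norm (T S x))\<^sup>2))"
          by (intro AE_I2) (simp add: abs_of_nonneg order_trans[OF _ abs_ge_self])
      qed
    qed
    \<comment> \<open>The volume of the cube is read off from the Fourier mode of index 0.\<close>
    have ici: "has_bochner_integral lebesgue ic (L ^ 3)"
    proof -
      have "has_bochner_integral lebesgue (\<lambda>x. Re (ic x *\<^sub>R fourier_basis L 0 x)) (Re (of_real (L ^ 3)))"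
        using has_bochner_integral_bounded_linear[OF bounded_linear_Re has_integral_fourier_basis[OF L, of 0]]
        by (simp add: ic_def)
      then show ?thesis by (simp add: fourier_basis_def rvec_def inner_vec_def ic_def[abs_def])
    qed
    define d where "d x = ic x *\<^sub>R (J x $ j * cnj (fourier_basis L l x)) - ic x *\<^sub>R (T S x $ j * cnj (fourier_basis L l x))" for x
    have "I - of_real (L ^ 3) * v l $ j = (LINT x|lebesgue. d x)"
      unfolding I_def d_def using Jint Tint[OF S(2,3)] by (simp add: has_bochner_integral_iff)
    also have "norm \<dots> \<le> (LINT x|lebesgue. norm (d x))" by (rule integral_norm_bound)
    also have "\<dots> \<le> (LINT x|lebesgue. (1 / \<delta>) * q x + \<delta> * ic x)"
    proof (rule integral_mono')
      show "integrable lebesgue (\<lambda>x. (1 / \<delta>) * q x + \<delta> * ic x)"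
        using qint ici by (intro Bochner_Integration.integrable_add integrable_mult_right) (simp_all add: has_bochner_integral_iff)
      show "norm (d x) \<le> (1 / \<delta>) * q x + \<delta> * ic x" for x
      proof (cases "x \<in> cube L")
        case True
        define a where "a = norm (J x - T S x)"
        have "d x = (J x - T S x) $ j * cnj (fourier_basis L l x)"
          using True by (simp add: d_def ic_def left_diff_distrib)
        then have "norm (d x) = cmod ((J x - T S x) $ j)"
          by (simp add: norm_mult fourier_basis_def)
        also have "\<dots> \<le> a" unfolding a_def by (rule Finite_Cartesian_Product.norm_nth_le)
        also have "a = \<delta> * (a / \<delta>)" using \<delta> by simp
        \<comment> \<open>The bound y <= 1 + y^2, scaled by \<delta>, trades the first power for the
          square integral plus a volume term.\<close>
        also have "\<dots> \<le> \<delta> * (1 + (a / \<delta>)\<^sup>2)" using le_one_plus_square[of "a / \<delta>"] \<delta> by (intro mult_left_mono) auto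
        also have "\<dots> = (1 / \<delta>) * a\<^sup>2 + \<delta>" using \<delta> by (simp add: field_simps power2_eq_square)
        finally show ?thesis using True by (simp add: q_def ic_def a_def)
      qed (simp add: d_def q_def ic_def)
      show "0 \<le> (1 / \<delta>) * q x + \<delta> * ic x" for x using \<delta> by (simp add: q_def ic_def)
    qed
    also have "\<dots> = (1 / \<delta>) * (LINT x|lebesgue. q x) + \<delta> * L ^ 3"
      using qint ici by (simp add: has_bochner_integral_iff)
    also have "\<dots> \<le> (1 / \<delta>) * \<delta>\<^sup>2 + \<delta> * L ^ 3"
      using S(1) \<delta> by (intro add_right_mono mult_left_mono) (simp_all add: set_lebesgue_integral_def q_def ic_def)
    also have "\<dots> = \<delta> * (1 + L ^ 3)" using \<delta> by (simp add: power2_eq_square algebra_simps)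
    also have "\<dots> = 0 + e" using L3 by (simp add: \<delta>_def)
    finally show "norm (I - of_real (L ^ 3) * v l $ j) \<le> 0 + e" .
  qed
  then have "I = of_real (L ^ 3) * v l $ j" by simp
  then show ?thesis by (simp add: I_def v_def ic_def set_lebesgue_integral_def)
qed

section \<open>Uniqueness\<close>

lemma closed_ess_supp: "closed (ess_supp F)"
  unfolding ess_supp_def by (intro closed_Compl open_Union) auto

text \<open>The complement of the support is a union of possibly uncountably many open sets.
  Lindelof's theorem selects countably many of them, and countably many null sets unite to a null
  set.\<close>

lemma AE_zero_outside_ess_supp: "AE x in lebesgue. x \<notin> ess_supp F \<longrightarrow> F x = 0"
proof -
  define \<U> where "\<U> = {U. open U \<and> (AE x in lebesgue. x \<in> U \<longrightarrow> F x = 0)}"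
  obtain \<V> where V: "\<V> \<subseteq> \<U>" "countable \<V>" "\<Union>\<V> = \<Union>\<U>"
    using Lindelof[of \<U>] by (auto simp: \<U>_def)
  have "AE x in lebesgue. \<forall>U\<in>\<V>. x \<in> U \<longrightarrow> F x = 0"
    using V(1,2) by (subst AE_ball_countable) (auto simp: \<U>_def)
  then show ?thesis
  proof eventually_elim
    case (elim x)
    have "x \<in> \<Union>\<V>" if "x \<notin> ess_supp F" using that V(3) by (auto simp: ess_supp_def \<U>_def)
    then show ?case using elim by blast
  qed
qed

text \<open>On the compact set that carries \<psi> the field is square integrable, hence integrable,
  and \<psi> is bounded.\<close>

lemma integrable_cdot_L2_loc:
  fixes F \<psi> :: "real ^ 3 \<Rightarrow> complex ^ 3"
  assumes F: "L2_loc F" and \<psi>: "continuous_on UNIV \<psi>" "compact K" "\<And>x. x \<notin> K \<Longrightarrow> \<psi> x = 0"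
  shows "integrable lebesgue (\<lambda>x. cdot (F x) (\<psi> x))"
proof -
  have L2: "L2_on K F" using F \<psi>(2) by (simp add: L2_loc_def)
  define F' where "F' x = indicator K x *\<^sub>R F x" for x
  have F'm: "F' \<in> borel_measurable lebesgue" using L2 by (simp add: L2_on_def set_borel_measurable_def F'_def[abs_def])
  have "(norm (F' x))\<^sup>2 = indicator K x *\<^sub>R (norm (F x))\<^sup>2" for x by (simp add: F'_def indicator_def)
  then have F'i: "integrable lebesgue (\<lambda>x. (norm (F' x))\<^sup>2)"
    using L2 by (simp add: L2_on_def set_integrable_def)
  have Kb: "K \<in> sets borel" "bounded K" using borel_closed[OF compact_imp_closed[OF \<psi>(2)]] compact_imp_bounded[OF \<psi>(2)] .
  have iF: "integrable lebesgue (\<lambda>x. indicator K x *\<^sub>R F' x)"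
    by (rule integrable_square_integrable_on_bounded[OF F'm F'i Kb])
  define s where "s x = (\<Sum>i\<in>UNIV. cmod (\<psi> x $ i))" for x
  have "continuous_on K s"
    unfolding s_def[abs_def]
    by (intro continuous_on_sum continuous_on_norm continuous_on_component continuous_on_subset[OF \<psi>(1) subset_UNIV])
  then obtain B where B: "B \<ge> 0" "\<And>x. norm (s x) \<le> B"
    by (rule bounded_if_compact_support[OF _ \<psi>(2)]) (simp_all add: s_def \<psi>(3))
  have eq: "cdot (F x) (\<psi> x) = cdot (F' x) (\<psi> x)" for x
    using \<psi>(3)[of x] by (cases "x \<in> K") (simp_all add: F'_def cdot_def)
  have "integrable lebesgue (\<lambda>x. B * norm (indicator K x *\<^sub>R F' x))"
    using iF by (intro integrable_mult_right integrable_norm)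
  then show ?thesis
  proof (rule Bochner_Integration.integrable_bound)
    show "(\<lambda>x. cdot (F x) (\<psi> x)) \<in> borel_measurable lebesgue"
      unfolding eq by (intro borel_measurable_cdot F'm borel_measurable_lebesgue_continuous \<psi>(1))
    have "cmod (cdot (F' x) (\<psi> x)) \<le> B * norm (indicator K x *\<^sub>R F' x)" for x
    proof -
      have "cmod (cdot (F' x) (\<psi> x)) \<le> norm (F' x) * s x" unfolding s_def by (rule norm_cdot_le)
      also have "\<dots> \<le> norm (F' x) * B" using B(2)[of x] by (intro mult_left_mono) auto
      also have "norm (F' x) = norm (indicator K x *\<^sub>R F' x)" by (simp add: F'_def indicator_def)
      finally show ?thesis by (simp add: mult.commute)
    qed
    then show "AE x in lebesgue. norm (cdot (F x) (\<psi> x)) \<le> norm (B * norm (indicator K x *\<^sub>R F' x))"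
      unfolding eq using B(1) by (intro AE_I2) (simp add: abs_of_nonneg)
  qed
qed

lemma L2_on_UNIV_imp_L2_loc:
  assumes "L2_on UNIV F"
  shows "L2_loc F"
  unfolding L2_loc_def L2_on_def set_borel_measurable_def set_integrable_def
proof (intro allI impI conjI)
  fix K :: "(real^3) set" assume "compact K"
  then have K: "K \<in> sets lebesgue" by (simp add: borel_closed compact_imp_closed)
  show "(\<lambda>x. indicat_real K x *\<^sub>R F x) \<in> borel_measurable lebesgue"
    using K L2_on_UNIV(1)[OF assms] by (intro borel_measurable_scaleR borel_measurable_indicator)
  show "integrable lebesgue (\<lambda>x. indicat_real K x *\<^sub>R (norm (F x))\<^sup>2)"
    by (rule integrable_mult_indicator[OF K L2_on_UNIV(2)[OF assms]])
qed

text \<open>The integral of a non-integrable function is 0 by convention, so the two weak equations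
  can be subtracted only after each pairing is shown to be integrable.\<close>

lemma maxwell_weak_diff:
  assumes E: "L2_loc E" "maxwell_weak k J E" and E': "L2_loc E'" "maxwell_weak k J' E'"
    and J: "L2_on UNIV J" "L2_on UNIV J'" and \<phi>: "test_function UNIV \<phi>"
  shows "(LINT x|lebesgue. cdot (E x - E' x) (curl (curl \<phi>) x - of_real (k\<^sup>2) *s \<phi> x))
    = \<i> * of_real k * (LINT x|lebesgue. cdot (J x - J' x) (\<phi> x))"
proof -
  define K where "K = closure {x. \<phi> x \<noteq> 0}"
  have \<phi>s: "smooth_on UNIV \<phi>" and K: "compact K" using \<phi> by (auto simp: test_function_def K_def)
  have \<phi>0: "\<phi> x = 0" if "x \<notin> K" for x using that closure_subset[of "{x. \<phi> x \<noteq> 0}"] by (auto simp: K_def)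
  have c0: "curl \<phi> x = 0" if "x \<notin> K" for x
    by (rule curl_eq_0_outside[OF compact_imp_closed[OF K] \<phi>0 that])
  have cc0: "curl (curl \<phi>) x = 0" if "x \<notin> K" for x
    by (rule curl_eq_0_outside[OF compact_imp_closed[OF K] c0 that])
  define \<psi> where "\<psi> x = curl (curl \<phi>) x - of_real (k\<^sup>2) *s \<phi> x" for x
  have "continuous_on UNIV (\<lambda>x. complex_of_real (k\<^sup>2) *s \<phi> x)"
    unfolding vector_scalar_mult_def
    by (intro continuous_on_vec_lambda continuous_intros continuous_on_component smooth_onD(3)[OF \<phi>s])
  with smooth_onD(3)[OF smooth_on_curl[OF open_UNIV smooth_on_curl[OF open_UNIV \<phi>s]]]
  have \<psi>: "continuous_on UNIV \<psi>"
    unfolding \<psi>_def[abs_def] by (rule continuous_on_diff)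
  have \<psi>0: "\<psi> x = 0" if "x \<notin> K" for x using \<phi>0[OF that] cc0[OF that] by (simp add: \<psi>_def)
  have iE: "integrable lebesgue (\<lambda>x. cdot (E x) (\<psi> x))" "integrable lebesgue (\<lambda>x. cdot (E' x) (\<psi> x))"
    using E(1) E'(1) by (auto intro!: integrable_cdot_L2_loc[OF _ \<psi> K] \<psi>0)
  have iJ: "integrable lebesgue (\<lambda>x. cdot (J x) (\<phi> x))" "integrable lebesgue (\<lambda>x. cdot (J' x) (\<phi> x))"
    using J by (auto intro!: integrable_cdot_L2_loc[OF _ smooth_onD(3)[OF \<phi>s] K] L2_on_UNIV_imp_L2_loc \<phi>0)
  have "(LINT x|lebesgue. cdot (E x - E' x) (\<psi> x)) = (LINT x|lebesgue. cdot (E x) (\<psi> x)) - (LINT x|lebesgue. cdot (E' x) (\<psi> x))"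
    unfolding cdot_diff_left by (rule Bochner_Integration.integral_diff[OF iE])
  also have "\<dots> = \<i> * of_real k * (LINT x|lebesgue. cdot (J x) (\<phi> x)) - \<i> * of_real k * (LINT x|lebesgue. cdot (J' x) (\<phi> x))"
    using E(2) E'(2) \<phi> unfolding maxwell_weak_def \<psi>_def by simp
  also have "\<dots> = \<i> * of_real k * (LINT x|lebesgue. cdot (J x - J' x) (\<phi> x))"
    using Bochner_Integration.integral_diff[OF iJ] by (simp only: cdot_diff_left right_diff_distrib)
  finally show ?thesis by (simp add: \<psi>_def)
qed

text \<open>The curl is additive where both fields are differentiable. This covers |x| >=
  \<open>R\<close>, and the limit at infinity depends on no other points.\<close>

lemma silver_mueller_diff:
  assumes "silver_mueller k E" "silver_mueller k E'"
    and U: "open U" "{x. R \<le> norm x} \<subseteq> U" and s: "smooth_on U E" "smooth_on U E'"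
  shows "silver_mueller k (\<lambda>x. E x - E' x)"
proof -
  define D where "D F x = norm x *\<^sub>R (ccross (curl F x) (cvec (x /\<^sub>R norm x)) - (\<i> * of_real k) *s F x)"
    for F :: "real^3 \<Rightarrow> complex^3" and x
  have "((\<lambda>x. D E x - D E' x) \<longlongrightarrow> 0 - 0) at_infinity"
    using assms(1,2) unfolding silver_mueller_def D_def by (intro tendsto_diff)
  moreover have "D E x - D E' x = D (\<lambda>x. E x - E' x) x" if "R \<le> norm x" for x
  proof -
    have "x \<in> U" using U(2) that by blast
    then have c: "curl (\<lambda>x. E x - E' x) x = curl E x - curl E' x"
      by (intro curl_minus smooth_onD(1)[OF s(1)] smooth_onD(1)[OF s(2)])
    show ?thesis
      unfolding D_def c ccross_diff_left vector_ssub_ldistrib scaleR_diff_right by simp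
  qed
  then have "\<forall>\<^sub>F x in at_infinity. D E x - D E' x = D (\<lambda>x. E x - E' x) x"
    by (intro eventually_at_infinityI)
  ultimately have "((\<lambda>x. D (\<lambda>x. E x - E' x) x) \<longlongrightarrow> 0 - 0) at_infinity"
    by (rule Lim_transform_eventually)
  then show ?thesis unfolding silver_mueller_def D_def by simp
qed

text \<open>The yield of the boundary data at a single wave number: the energy identity supplies the
  decay of the difference field, the beams give orthogonality, and their limit is the plane
  wave.\<close>

lemma equal_boundary_data_plane_wave:
  fixes J J' E E' :: "real ^ 3 \<Rightarrow> complex ^ 3"
  assumes R: "R > 0" and k: "k > 0" and d: "norm d = 1"
    and supp: "ess_supp J \<subseteq> ball 0 R" "ess_supp J' \<subseteq> ball 0 R"
    and J: "L2_on UNIV J" "L2_on UNIV J'"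
    and E: "radiated_field k J E" "radiated_field k J' E'"
    and eq: "\<And>x. norm x = R \<Longrightarrow> E x = E' x"
  shows "(LINT x|lebesgue. exp (\<i> * of_real (k * (x \<bullet> d))) * cdot (J x - J' x) (ccross (cvec d) c)) = 0"
proof -
  define U where "U = - (ess_supp J \<union> ess_supp J')"
  define W where "W x = E x - E' x" for x
  define Jd where "Jd x = J x - J' x" for x
  have U: "open U" "{x. R \<le> norm x} \<subseteq> U" using supp by (auto simp: U_def closed_ess_supp open_Compl)
  have s: "smooth_on U E" "smooth_on U E'"
    using E by (auto simp: radiated_field_def U_def intro: smooth_on_subset[rotated])
  have W: "smooth_on U W" unfolding W_def[abs_def] by (intro smooth_on_diff U(1) s)
  have W0: "W x = 0" if "norm x = R" for x using eq[OF that] by (simp add: W_def)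
  have JdU: "AE x in lebesgue. x \<in> U \<longrightarrow> Jd x = 0"
    using AE_zero_outside_ess_supp[of J] AE_zero_outside_ess_supp[of J']
    by eventually_elim (auto simp: U_def Jd_def)
  have weak: "(LINT x|lebesgue. cdot (W x) (curl (curl \<phi>) x - of_real (k\<^sup>2) *s \<phi> x))
      = \<i> * of_real k * (LINT x|lebesgue. cdot (Jd x) (\<phi> x))" if "test_function UNIV \<phi>" for \<phi>
    unfolding W_def Jd_def using E J that
    by (intro maxwell_weak_diff) (auto simp: radiated_field_def)
  have strong: "curl (curl W) x = of_real (k\<^sup>2) *s W x" if "x \<in> U" for x
  proof (rule weak_Maxwell_imp_strong[OF U(1) W _ that])
    fix \<phi> :: "real^3 \<Rightarrow> complex^3" assume t: "test_function U \<phi>"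
    then have t': "test_function UNIV \<phi>" by (auto simp: test_function_def)
    have "{x. \<phi> x \<noteq> 0} \<subseteq> U" using t closure_subset[of "{x. \<phi> x \<noteq> 0}"] by (auto simp: test_function_def)
    then have z: "\<phi> x = 0" if "x \<notin> U" for x using that by blast
    \<comment> \<open>Test functions supported off both sources do not see \<open>Jd\<close>, so the
      right-hand side of the weak equation is zero.\<close>
    have "AE x in lebesgue. cdot (Jd x) (\<phi> x) = 0"
      using JdU
    proof eventually_elim
      case (elim x)
      then show ?case using z[of x] by (cases "x \<in> U") (simp_all add: cdot_def)
    qed
    then have "(LINT x|lebesgue. cdot (Jd x) (\<phi> x)) = 0" by (rule integral_eq_zero_AE)
    then show "(LINT x|lebesgue. cdot (W x) (curl (curl \<phi>) x - of_real (k\<^sup>2) *s \<phi> x)) = 0"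
      using weak[OF t'] by simp
  qed
  have sm: "silver_mueller k W"
    unfolding W_def[abs_def] using E by (intro silver_mueller_diff[OF _ _ U s]) (auto simp: radiated_field_def)
  have decay: "\<exists>M>R. \<forall>\<rho>\<ge>M. shell_energy W \<rho> \<le> \<epsilon> * \<rho>"
    if \<epsilon>: "\<epsilon> > 0" for \<epsilon>
  proof (rule radiating_null_field_decay[OF U W W0 strong R k sm \<epsilon>])
    fix M
    assume "M > R" "\<And>\<rho>. \<rho> \<ge> M \<Longrightarrow> shell_energy W \<rho> \<le> \<epsilon> * \<rho>"
    then show ?thesis by blast
  qed
  have Jdm: "Jd \<in> borel_measurable lebesgue"
    unfolding Jd_def[abs_def] by (intro borel_measurable_diff L2_on_UNIV(1) J)
  have Jd0: "AE x in lebesgue. R \<le> norm x \<longrightarrow> Jd x = 0"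
    using JdU by eventually_elim (use U(2) in auto)
  have Jdi: "integrable lebesgue (\<lambda>x. norm (Jd x))"
  proof -
    have b: "ball (0::real^3) R \<in> sets borel" "bounded (ball (0::real^3) R)" by auto
    have "integrable lebesgue (\<lambda>x. indicator (ball 0 R) x *\<^sub>R J x - indicator (ball 0 R) x *\<^sub>R J' x)"
      using integrable_square_integrable_on_bounded[OF L2_on_UNIV[OF J(1)] b]
        integrable_square_integrable_on_bounded[OF L2_on_UNIV[OF J(2)] b]
      by (rule Bochner_Integration.integrable_diff)
    then have "integrable lebesgue (\<lambda>x. norm (indicator (ball 0 R) x *\<^sub>R J x - indicator (ball 0 R) x *\<^sub>R J' x))"
      by (rule integrable_norm)
    moreover have "AE x in lebesgue. norm (indicator (ball 0 R) x *\<^sub>R J x - indicator (ball 0 R) x *\<^sub>R J' x) = norm (Jd x)"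
      using Jd0
    proof eventually_elim
      case (elim x)
      then show ?case by (cases "norm x < R") (auto simp: Jd_def)
    qed
    ultimately show ?thesis
      by (rule integrable_cong_AE_imp[OF _ measurable_compose[OF Jdm borel_measurable_norm]])
  qed
  have "(LINT x|lebesgue. exp (\<i> * of_real (k * (x \<bullet> d))) * cdot (Jd x) (ccross (cvec d) c)) = 0"
  proof (rule plane_wave_orthogonality[OF d k R Jdi Jdm Jd0])
    fix t :: real assume t: "t > 0"
    show "(LINT x|lebesgue. cdot (Jd x) (ccross (grad (beam k d t) x) c)) = 0"
      by (rule null_field_orthogonality[OF U(2) W decay weak k R Jdm Jd0 smooth_on_beam laplacian_beam
            beam_decay[OF d k t]])
  qed
  then show ?thesis by (simp add: Jd_def)
qed

lemma cvec_nth: "cvec v $ i = of_real (v $ i)"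
  by (simp add: cvec_def)

text \<open>Taking \<open>c\<close> as p x m or as p isolates one coefficient: m x (p x m) is
  orthogonal to p x m, m x p is orthogonal to p, and both remaining products equal |p x m|^2 up to
  sign.\<close>

lemma polarization_separation:
  fixes p m :: "real ^ 3" and \<alpha> \<beta> :: complex
  assumes w: "cross3 p m \<noteq> 0"
    and orth: "\<And>c. cdot (\<alpha> *s cvec p + \<beta> *s cvec (cross3 p m)) (ccross (cvec m) c) = 0"
  shows "\<alpha> = 0" "\<beta> = 0"
proof -
  define n2 where "n2 = (cross3 p m $ 1)\<^sup>2 + (cross3 p m $ 2)\<^sup>2 + (cross3 p m $ 3)\<^sup>2"
  have "n2 = (norm (cross3 p m))\<^sup>2"
    unfolding n2_def power2_norm_eq_inner by (simp add: inner_vec_def sum_3 power2_eq_square)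
  then have n2: "complex_of_real n2 \<noteq> 0" using w by simp
  have "cdot (\<alpha> *s cvec p + \<beta> *s cvec (cross3 p m)) (ccross (cvec m) (cvec (cross3 p m))) = \<alpha> * of_real n2"
    by (simp add: cdot_3 ccross_nth cvec_nth cross3_def n2_def power2_eq_square algebra_simps)
  then show "\<alpha> = 0" using orth n2 by simp
  have "cdot (\<alpha> *s cvec p + \<beta> *s cvec (cross3 p m)) (ccross (cvec m) (cvec p)) = - \<beta> * of_real n2"
    by (simp add: cdot_3 ccross_nth cvec_nth cross3_def n2_def power2_eq_square algebra_simps)
  then show "\<beta> = 0" using orth n2 by simp
qed

theorem theorem3p2:
  fixes L R :: real and N :: nat and p :: "real ^ 3"
    and f g f' g' :: "real ^ 3 \<Rightarrow> complex"
    and J J' :: "real ^ 3 \<Rightarrow> complex ^ 3"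
    and E E' :: "real \<Rightarrow> real ^ 3 \<Rightarrow> complex ^ 3"
  assumes "L > 0" and "R > 0" and "cube L \<subseteq> ball 0 R"
    and "p \<in> admissible_polarizations"
    and "N \<ge> 1"
    and "is_source L p f g J" and "is_source L p f' g' J'"
    and "\<And>k. k > 0 \<Longrightarrow> radiated_field k J (E k)"
    and "\<And>k. k > 0 \<Longrightarrow> radiated_field k J' (E' k)"
    and "\<And>k x. k \<in> wavenumbers L N \<Longrightarrow> x \<in> sphere 0 R \<Longrightarrow> E k x = E' k x"
  shows "\<forall>l :: int ^ 3. 1 \<le> norm (rvec l) \<and> norm (rvec l) \<le> real N \<longrightarrow>
           fourier_coeff L f l = fourier_coeff L f' l \<and>
           fourier_coeff L g l = fourier_coeff L g' l"
proof (intro allI impI)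
  fix l :: "int ^ 3" assume l: "1 \<le> norm (rvec l) \<and> norm (rvec l) \<le> real N"
  define m where "m = rvec l"
  have m: "norm m \<ge> 1" using l by (simp add: m_def)
  define k where "k = 2 * pi * norm m / L"
  \<comment> \<open>With this sign the plane wave at wave number k in direction d is the complex
    conjugate of the Fourier mode \<open>l\<close>, as it occurs in the coefficients.\<close>
  define d where "d = - (m /\<^sub>R norm m)"
  have "norm m > 0" using m by linarith
  then have "k > 0" using assms(1) by (simp add: k_def)
  moreover have "k \<in> wavenumbers L N" using l by (auto simp: k_def m_def wavenumbers_def)
  ultimately have k: "k > 0" "k \<in> wavenumbers L N" by auto
  have d: "norm d = 1" using \<open>norm m > 0\<close> by (simp add: d_def)
  have J: "L2_on UNIV J" "L2_on UNIV J'" "ess_supp J \<subseteq> cube L" "ess_supp J' \<subseteq> cube L"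
    "termwise_expansion L p f g J" "termwise_expansion L p f' g' J'"
    using assms(6,7) by (auto simp: is_source_def)
  have supp: "ess_supp J \<subseteq> ball 0 R" "ess_supp J' \<subseteq> ball 0 R" using J(3,4) assms(3) by auto
  have bdry: "E k x = E' k x" if "norm x = R" for x using assms(10)[OF k(2)] that by simp
  have wave: "exp (\<i> * of_real (k * (x \<bullet> d))) = cnj (fourier_basis L l x)" for x
  proof -
    have "k * (x \<bullet> d) = - (2 * pi / L * (m \<bullet> x))"
      using \<open>norm m > 0\<close> by (simp add: k_def d_def inner_commute field_simps)
    then show ?thesis by (simp add: fourier_basis_def exp_cnj m_def)
  qed
  define \<alpha> where "\<alpha> = fourier_coeff L f l - fourier_coeff L f' l"
  \<comment> \<open>\<beta> absorbs the nonzero factor 2 pi \<i> / L that comes from the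
    differentiated series of g.\<close>
  define \<beta> where "\<beta> = 2 * of_real pi * \<i> / of_real L * (fourier_coeff L g l - fourier_coeff L g' l)"
  define I where "I F j x = indicator (cube L) x *\<^sub>R (F x $ j * cnj (fourier_basis L l x))"
    for F :: "real^3 \<Rightarrow> complex^3" and j x
  have Ii: "integrable lebesgue (I F j)" if "L2_on UNIV F" for F j
    unfolding I_def[abs_def] by (rule integrable_fourier_integrand[OF that])
  have coeff: "(LINT x|lebesgue. I J j x - I J' j x) = of_real (L ^ 3) * (\<alpha> *s cvec p + \<beta> *s cvec (cross3 p m)) $ j" for j
    using expansion_coefficient[OF assms(1) J(1,5) conjunct1[OF l], of j]
      expansion_coefficient[OF assms(1) J(2,6) conjunct1[OF l], of j] Ii[OF J(1), of j] Ii[OF J(2), of j]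
    by (simp add: set_lebesgue_integral_def I_def[abs_def] \<alpha>_def \<beta>_def m_def algebra_simps diff_divide_distrib)
  have "cdot (\<alpha> *s cvec p + \<beta> *s cvec (cross3 p m)) (ccross (cvec m) c) = 0" for c
  proof -
    \<comment> \<open>Both sources vanish almost everywhere off the cube, so the integral over the
      whole space is a combination of Fourier coefficients of the sources.\<close>
    have z: "AE x in lebesgue. x \<notin> cube L \<longrightarrow> J x - J' x = 0"
      using AE_zero_outside_ess_supp[of J] AE_zero_outside_ess_supp[of J']
      by eventually_elim (use J(3,4) in auto)
    define v where "v = ccross (cvec d) c"
    have "0 = (LINT x|lebesgue. exp (\<i> * of_real (k * (x \<bullet> d))) * cdot (J x - J' x) v)"
      unfolding v_def
      by (rule equal_boundary_data_plane_wave[OF assms(2) k(1) d supp J(1,2) assms(8)[OF k(1)] assms(9)[OF k(1)] bdry, symmetric])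
    also have "\<dots> = (LINT x|lebesgue. (\<Sum>j\<in>UNIV. v $ j * (I J j x - I J' j x)))"
    proof (rule integral_cong_AE)
      show "(\<lambda>x. exp (\<i> * of_real (k * (x \<bullet> d))) * cdot (J x - J' x) v) \<in> borel_measurable lebesgue"
        unfolding wave
        by (intro borel_measurable_times borel_measurable_cdot borel_measurable_diff L2_on_UNIV(1) J(1,2)
            borel_measurable_const borel_measurable_lebesgue_continuous continuous_on_cnj continuous_on_fourier_basis)
      show "(\<lambda>x. \<Sum>j\<in>UNIV. v $ j * (I J j x - I J' j x)) \<in> borel_measurable lebesgue"
        by (intro borel_measurable_sum borel_measurable_times borel_measurable_const borel_measurable_diff
            borel_measurable_integrable Ii J(1,2))
      show "AE x in lebesgue. exp (\<i> * of_real (k * (x \<bullet> d))) * cdot (J x - J' x) v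
          = (\<Sum>j\<in>UNIV. v $ j * (I J j x - I J' j x))"
        using z
      proof eventually_elim
        case (elim x)
        show ?case
        proof (cases "x \<in> cube L")
          case True
          then show ?thesis unfolding wave by (simp add: cdot_3 sum_3 I_def algebra_simps)
        next
          case False
          then show ?thesis using elim by (simp add: cdot_def I_def)
        qed
      qed
    qed
    also have "\<dots> = (\<Sum>j\<in>UNIV. v $ j * (LINT x|lebesgue. I J j x - I J' j x))"
      using Ii[OF J(1)] Ii[OF J(2)] by simp
    also have "\<dots> = of_real (L ^ 3) * cdot (\<alpha> *s cvec p + \<beta> *s cvec (cross3 p m)) v"
      unfolding coeff cdot_def sum_distrib_left by (rule sum.cong) (simp_all add: mult_ac)
    finally have "cdot (\<alpha> *s cvec p + \<beta> *s cvec (cross3 p m)) v = 0" using assms(1) by simp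
    \<comment> \<open>\<open>d\<close> is a nonzero multiple of m, and such a factor does not affect
      orthogonality.\<close>
    moreover have v: "v = (- of_real (inverse (norm m))) *s ccross (cvec m) c"
      by (simp add: v_def d_def vec_eq_iff forall_3 ccross_nth cvec_nth algebra_simps)
    moreover have "- complex_of_real (inverse (norm m)) \<noteq> 0" using \<open>norm m > 0\<close> by simp
    ultimately show ?thesis unfolding v cdot_smult_right by simp
  qed
  note orth = this
  have "l \<noteq> 0" using m by (auto simp: m_def rvec_def norm_vec_def L2_set_def)
  then have "cross3 p m \<noteq> 0" using assms(4) by (simp add: admissible_polarizations_def m_def)
  from polarization_separation[OF this orth] have "\<alpha> = 0" "\<beta> = 0" .
  then show "fourier_coeff L f l = fourier_coeff L f' l \<and> fourier_coeff L g l = fourier_coeff L g' l"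
    using assms(1) by (simp add: \<alpha>_def \<beta>_def)
qed

end
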